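(* Let $h$ be a discrete Morse function on a Lefschetz complex $X$. Let $\alpha=(\alpha^{\circ},\alpha^{\times})\in\widehat{\mathrm{BD}}(h)$ be an off-diagonal birth-death pair (with both components defined). Suppose that the forbidden regions of its death and birth cells do not intersect, i.e. $\mathcal R^{\urcorner}_h(\alpha)\cap\mathcal R^{\llcorner}_h(\alpha)=\emptyset$, and that there is exactly one path from $\alpha^{\times}$ to $\alpha^{\circ}$ in the digraph $G_{\mathcal V_h}$. Then there exists a discrete Morse function $h'$ on $X$ such that $\widehat{\mathrm{BD}}(h')=\widehat{\mathrm{BD}}(h)\setminus\{\alpha\}$ and $h(x)=h'(x)$ for all $x\in\mathrm{Crit}(\mathcal V_{h'})$.
   Context: Lefschetz complex: a triple $(X,\dim,D)$ with $X$ a finite set of cells, $\dim:X\to\mathbb N$, $D:X\times X\to\mathbb Z_2$ such that $D(x,y)\neq0$ implies $\dim x+1=\dim y$ ($x$ is a facet of $y$, $y$ a cofacet of $x$), and $\sum_{z}D(x,z)D(z,y)=0$ for all $x,y$. $X_n$ is the set of $n$-cells; $D^{\perp}(y,x)=D(x,y)$. $D_n$ is the matrix of $D$ with rows $X_{n-1}$, columns $X_n$; $D^{\perp}_n$ is the matrix of $D^\perp$ with rows $X_{n+1}$, columns $X_n$. Discrete Morse function (dMf): $h:X\to\mathbb R$ such that (i) $D(x,y)=1$ implies $h(x)\le h(y)$; (ii) for $x\ne y$, $h(x)=h(y)$ implies $D(x,y)=1$ or $D(y,x)=1$; (iii) $\#h^{-1}(a)\le2$ for every $a\in\mathbb R$.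 The $h$-order: $x<_hy$ iff $h(x)<h(y)$, or $h(x)=h(y)$ and $\dim x<\dim y$. Rows and columns of $D_n$ are ordered by the $h$-order, those of $D_n^\perp$ by the reversed $h$-order. Lazy reduction (over $\mathbb Z_2$) of a matrix $M$: start with $R=M$, $U=I$ (indexed by the columns of $M$). For columns $y$ from left to right: while $R[:,y]\ne0$ and some preceding column $x$ has $\mathrm{low}(R[:,x])=\mathrm{low}(R[:,y])$ (low = row index of the lowest nonzero entry), set $R[:,y]\leftarrow R[:,y]+R[:,x]$ and $U[x,:]\leftarrow U[x,:]+U[y,:]$. This gives $M=RU$. Applied to $D_n$ and $D^\perp_n$ it yields $D_n=R_nU_n$ and $D^\perp_n=R^\perp_nU^\perp_n$. Birth-death pairs: $\alpha=(\alpha^\circ,\alpha^\times)\in X_n\times X_{n+1}$ is an $n$-dimensional birth-death pair if $\mathrm{low}(R_{n+1}[:,\alpha^\times])=\alpha^\circ$ (equivalently $\mathrm{low}(R^\perp_n[:,\alpha^\circ])=\alpha^\times$); $\alpha^\circ$ is its birth cell and $\alpha^\times$ its death cell. By convention an unpaired cell is the birth cell of a pair with undefined second component. $\mathrm{BD}(h)$ is the set of all pairs, $\mathrm{BD}_n(h)$ of the $n$-dimensional ones; $\widehat{\mathrm{BD}}(h)$, $\widehat{\mathrm{BD}}_n(h)$ are the subsets of off-diagonal pairs, i.e. those that do not satisfy $h(\alpha^\circ)=h(\alpha^\times)$. Relations: for distinct cells $x,y\in X_n$, $x\to^{\times}y$ iff $U_n[x,y]=1$ (homological relation) and $x\to^{\circ}y$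 iff $U_n^\perp[x,y]=1$ (cohomological relation). For distinct pairs $\beta,\alpha$ of the same dimension, $\beta\to^{\times}\alpha$ iff $\beta^\times\to^\times\alpha^\times$, and $\beta\to^\circ\alpha$ iff $\beta^\circ\to^\circ\alpha^\circ$. Vector fields: a combinatorial vector field $\mathcal V$ on $X$ is a partition of $X$ into singletons (critical cells, forming $\mathrm{Crit}(\mathcal V)$) and facet–cofacet pairs (vectors). $G_{\mathcal V}$ is the digraph on $X$ with an arc from $x$ to $y$ whenever $x$ is a facet of $y$ and $\{x,y\}\in\mathcal V$ (explicit arc), or $y$ is a facet of $x$ and $\{x,y\}\notin\mathcal V$ (implicit arc). $x\rightsquigarrow y$ means there is a directed path from $x$ to $y$ in $G_{\mathcal V}$. For a dMf $h$, $\mathcal V_h$ is the partition of $X$ into nonempty fibres of $h$. Forbidden regions for an $n$-dimensional $\alpha\in\widehat{\mathrm{BD}}(h)$ (with $\mathcal V=\mathcal V_h$, subsets of $[-\infty,\infty]^2$): for the death cell, $$\mathcal R^{\urcorner}_h(\alpha)=\bigcup_{\beta\in\widehat{\mathrm{BD}}_n(h),\ \beta\ne\alpha,\ \beta\to^\times\alpha}[-\infty,h(\beta^\circ)]\times[-\infty,h(\beta^\times)]\ \cup\bigcup_{x\in\mathrm{Crit}(\mathcal V_h),\ x\ne\alpha^\times,\ \alpha^\times\rightsquigarrow x}[-\infty,h(x)]\times[-\infty,h(x)];$$ for the birth cell, $$\mathcal R^{\llcorner}_h(\alpha)=\bigcup_{\beta\in\widehat{\mathrm{BD}}_n(h),\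 \beta\ne\alpha,\ \beta\to^\circ\alpha}[h(\beta^\circ),+\infty]\times[h(\beta^\times),+\infty]\ \cup\bigcup_{y\in\mathrm{Crit}(\mathcal V_h),\ y\ne\alpha^\circ,\ y\rightsquigarrow\alpha^\circ}[h(y),+\infty]\times[h(y),+\infty].$$ *)

theory Defs
  imports
    "HOL-Library.Z2"
    "HOL-Library.While_Combinator"
    "HOL-Library.Disjoint_Sets"
    "HOL-Library.Extended_Real"
    "Graph_Theory.Graph_Theory"
begin

section \<open>Lefschetz complexes\<close>

record 'a cell_data =
  cells :: "'a set"
  cdim :: "'a \<Rightarrow> nat"
  inc :: "'a \<Rightarrow> 'a \<Rightarrow> bit"

locale lefschetz_complex =
  fixes X :: "'a cell_data"
  assumes finite_cells: "finite (cells X)"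
    and inc_dim: "\<And>x y. x \<in> cells X \<Longrightarrow> y \<in> cells X \<Longrightarrow> inc X x y \<noteq> 0 \<Longrightarrow> cdim X x + 1 = cdim X y"
    and inc_inc: "\<And>x y. x \<in> cells X \<Longrightarrow> y \<in> cells X \<Longrightarrow> (\<Sum>z\<in>cells X. inc X x z * inc X z y) = 0"

definition facet :: "'a cell_data \<Rightarrow> 'a \<Rightarrow> 'a \<Rightarrow> bool" where
  "facet X x y \<longleftrightarrow> x \<in> cells X \<and> y \<in> cells X \<and> inc X x y \<noteq> 0"

definition n_cells :: "'a cell_data \<Rightarrow> nat \<Rightarrow> 'a set" where
  "n_cells X n = {x \<in> cells X. cdim X x = n}"

text \<open>Written so that there are no cells of dimension one below \<open>0\<close>.\<close>

definition cells_below :: "'a cell_data \<Rightarrow> nat \<Rightarrow> 'a set" where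
  "cells_below X n = {x \<in> cells X. cdim X x + 1 = n}"


section \<open>Discrete Morse functions and vector fields\<close>

definition discrete_morse :: "'a cell_data \<Rightarrow> ('a \<Rightarrow> real) \<Rightarrow> bool" where
  "discrete_morse X h \<longleftrightarrow>
     (\<forall>x\<in>cells X. \<forall>y\<in>cells X. inc X x y = 1 \<longrightarrow> h x \<le> h y) \<and>
     (\<forall>x\<in>cells X. \<forall>y\<in>cells X. x \<noteq> y \<and> h x = h y \<longrightarrow> inc X x y = 1 \<or> inc X y x = 1) \<and>
     (\<forall>a. card {x \<in> cells X. h x = a} \<le> 2)"

definition h_less :: "'a cell_data \<Rightarrow> ('a \<Rightarrow> real) \<Rightarrow> 'a \<Rightarrow> 'a \<Rightarrow> bool" where
  "h_less X h x y \<longleftrightarrow> h x < h y \<or> (h x = h y \<and> cdim X x < cdim X y)"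

definition vector_field :: "'a cell_data \<Rightarrow> 'a set set \<Rightarrow> bool" where
  "vector_field X V \<longleftrightarrow> partition_on (cells X) V \<and>
     (\<forall>A\<in>V. (\<exists>x. A = {x}) \<or> (\<exists>x y. facet X x y \<and> A = {x, y}))"

definition Crit :: "'a set set \<Rightarrow> 'a set" where
  "Crit V = {x. {x} \<in> V}"

definition vf_digraph :: "'a cell_data \<Rightarrow> 'a set set \<Rightarrow> ('a, 'a \<times> 'a) pre_digraph" where
  "vf_digraph X V =
     \<lparr> verts = cells X,
       arcs = {(x, y). (facet X x y \<and> {x, y} \<in> V) \<or> (facet X y x \<and> {x, y} \<notin> V)},
       tail = fst, head = snd \<rparr>"

definition morse_vf :: "'a cell_data \<Rightarrow> ('a \<Rightarrow> real) \<Rightarrow> 'a set set" where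
  "morse_vf X h = {A. A \<noteq> {} \<and> (\<exists>a. A = {x \<in> cells X. h x = a})}"

lemma (in lefschetz_complex) vector_field_morse_vf:
  assumes "discrete_morse X h"
  shows "vector_field X (morse_vf X h)"
proof -
  have part: "partition_on (cells X) (morse_vf X h)"
  proof (rule partition_onI)
    show "\<Union> (morse_vf X h) = cells X" unfolding morse_vf_def by blast
  qed (auto simp: morse_vf_def disjnt_def)
  have "(\<exists>x. A = {x}) \<or> (\<exists>x y. facet X x y \<and> A = {x, y})" if A: "A \<in> morse_vf X h" for A
  proof -
    from A obtain a where a: "A \<noteq> {}" "A = {x \<in> cells X. h x = a}"
      unfolding morse_vf_def by blast
    have "card A > 0" using a finite_cells by (simp add: card_gt_0_iff)
    moreover have "card A \<le> 2"
      unfolding a(2) using assms unfolding discrete_morse_def by blast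
    ultimately have "card A = 1 \<or> card A = 2" by linarith
    then consider x where "A = {x}" | x y where "x \<noteq> y" "A = {x, y}"
      by (auto simp: card_1_singleton_iff card_2_iff)
    then show ?thesis
    proof cases
      case 2
      then have xy: "x \<in> cells X" "y \<in> cells X" "h x = a" "h y = a"
        using a(2) by blast+
      then have "inc X x y = 1 \<or> inc X y x = 1"
        using assms 2(1) unfolding discrete_morse_def by metis
      then have "facet X x y \<or> facet X y x" using xy unfolding facet_def by force
      then show ?thesis using 2(2) insert_commute[of x y "{}"] by blast
    qed blast
  qed
  with part show ?thesis unfolding vector_field_def by blast
qed


section \<open>Lazy reduction\<close>

text \<open>
  A matrix is a function of its row and column index; the order of rows (top to bottom) and of
  columns (left to right) is given by two lists of indices.
\<close>

type_synonym 'a mtx = "'a \<Rightarrow> 'a \<Rightarrow> bit"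

definition col_nonzero :: "'a list \<Rightarrow> 'a mtx \<Rightarrow> 'a \<Rightarrow> bool" where
  "col_nonzero rs R y \<longleftrightarrow> (\<exists>i\<in>set rs. R i y \<noteq> 0)"

text \<open>Meaningful for nonzero columns only.\<close>

definition low :: "'a list \<Rightarrow> 'a mtx \<Rightarrow> 'a \<Rightarrow> 'a" where
  "low rs R y = last (filter (\<lambda>i. R i y \<noteq> 0) rs)"

definition low_conflict :: "'a list \<Rightarrow> 'a list \<Rightarrow> 'a mtx \<Rightarrow> 'a \<Rightarrow> 'a \<Rightarrow> bool" where
  "low_conflict rs preceding R y x \<longleftrightarrow>
     x \<in> set preceding \<and> col_nonzero rs R x \<and> col_nonzero rs R y \<and> low rs R x = low rs R y"

definition add_column :: "'a \<Rightarrow> 'a \<Rightarrow> 'a mtx \<Rightarrow> 'a mtx" where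
  "add_column x y R = (\<lambda>i j. if j = y then R i y + R i x else R i j)"

definition add_row :: "'a \<Rightarrow> 'a \<Rightarrow> 'a mtx \<Rightarrow> 'a mtx" where
  "add_row y x U = (\<lambda>i j. if i = x then U x j + U y j else U i j)"

definition reduce_column :: "'a list \<Rightarrow> 'a list \<Rightarrow> 'a \<Rightarrow> 'a mtx \<times> 'a mtx \<Rightarrow> 'a mtx \<times> 'a mtx" where
  "reduce_column rs preceding y =
     while (\<lambda>(R, U). \<exists>x. low_conflict rs preceding R y x)
       (\<lambda>(R, U). let x = (SOME x. low_conflict rs preceding R y x)
                 in (add_column x y R, add_row y x U))"

definition lazy_reduction :: "'a list \<Rightarrow> 'a list \<Rightarrow> 'a mtx \<Rightarrow> 'a mtx \<times> 'a mtx" where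
  "lazy_reduction rs cs M =
     fold (\<lambda>k. reduce_column rs (take k cs) (cs ! k)) [0..<length cs]
       (M, \<lambda>i j. if i = j then 1 else 0)"

text \<open>
  The enumeration of \<open>A\<close> in increasing order, for a relation \<open>lt\<close> that is a strict
  linear order on the finite set \<open>A\<close>.  The \<open>h\<close>-order is one on the cells of a Lefschetz
  complex whenever \<open>h\<close> is a discrete Morse function.
\<close>

definition enum_by :: "('a \<Rightarrow> 'a \<Rightarrow> bool) \<Rightarrow> 'a set \<Rightarrow> 'a list" where
  "enum_by lt A = (THE xs. set xs = A \<and> sorted_wrt lt xs)"

definition D_rows :: "'a cell_data \<Rightarrow> ('a \<Rightarrow> real) \<Rightarrow> nat \<Rightarrow> 'a list" where
  "D_rows X h n = enum_by (h_less X h) (cells_below X n)"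

definition D_reduction :: "'a cell_data \<Rightarrow> ('a \<Rightarrow> real) \<Rightarrow> nat \<Rightarrow> 'a mtx \<times> 'a mtx" where
  "D_reduction X h n =
     lazy_reduction (D_rows X h n) (enum_by (h_less X h) (n_cells X n)) (inc X)"

definition Dperp_reduction :: "'a cell_data \<Rightarrow> ('a \<Rightarrow> real) \<Rightarrow> nat \<Rightarrow> 'a mtx \<times> 'a mtx" where
  "Dperp_reduction X h n =
     lazy_reduction
       (enum_by (\<lambda>x y. h_less X h y x) (n_cells X (n + 1)))
       (enum_by (\<lambda>x y. h_less X h y x) (n_cells X n))
       (\<lambda>y x. inc X x y)"


section \<open>Birth-death pairs\<close>

definition paired :: "'a cell_data \<Rightarrow> ('a \<Rightarrow> real) \<Rightarrow> 'a \<Rightarrow> 'a \<Rightarrow> bool" where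
  "paired X h a b \<longleftrightarrow>
     a \<in> cells X \<and> b \<in> n_cells X (cdim X a + 1) \<and>
     (let n = cdim X a; rs = D_rows X h (n + 1); R = fst (D_reduction X h (n + 1))
      in col_nonzero rs R b \<and> low rs R b = a)"

text \<open>The first component is the birth cell, the second the death cell, if there is one.\<close>

type_synonym 'a bd_pair = "'a \<times> 'a option"

definition BD :: "'a cell_data \<Rightarrow> ('a \<Rightarrow> real) \<Rightarrow> 'a bd_pair set" where
  "BD X h =
     {(a, Some b) | a b. paired X h a b} \<union>
     {(a, None) | a. a \<in> cells X \<and> (\<nexists>c. paired X h a c \<or> paired X h c a)}"

definition offdiag_BD :: "'a cell_data \<Rightarrow> ('a \<Rightarrow> real) \<Rightarrow> 'a bd_pair set" where
  "offdiag_BD X h = {(a, d) \<in> BD X h. \<not> (\<exists>b. d = Some b \<and> h a = h b)}"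

text \<open>The dimension of a pair is the dimension of its birth cell.\<close>

definition offdiag_BD_n :: "'a cell_data \<Rightarrow> ('a \<Rightarrow> real) \<Rightarrow> nat \<Rightarrow> 'a bd_pair set" where
  "offdiag_BD_n X h n = {\<beta> \<in> offdiag_BD X h. cdim X (fst \<beta>) = n}"

text \<open>In the extended plane an undefined death cell is given the value \<open>\<infinity>\<close>.\<close>

definition death_value :: "('a \<Rightarrow> real) \<Rightarrow> 'a bd_pair \<Rightarrow> ereal" where
  "death_value h \<beta> = (case snd \<beta> of None \<Rightarrow> \<infinity> | Some b \<Rightarrow> ereal (h b))"


section \<open>Homological and cohomological relations\<close>

definition hom_rel :: "'a cell_data \<Rightarrow> ('a \<Rightarrow> real) \<Rightarrow> 'a \<Rightarrow> 'a \<Rightarrow> bool" where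
  "hom_rel X h x y \<longleftrightarrow> x \<in> cells X \<and> y \<in> cells X \<and> cdim X x = cdim X y \<and> x \<noteq> y \<and>
     snd (D_reduction X h (cdim X y)) x y = 1"

definition cohom_rel :: "'a cell_data \<Rightarrow> ('a \<Rightarrow> real) \<Rightarrow> 'a \<Rightarrow> 'a \<Rightarrow> bool" where
  "cohom_rel X h x y \<longleftrightarrow> x \<in> cells X \<and> y \<in> cells X \<and> cdim X x = cdim X y \<and> x \<noteq> y \<and>
     snd (Dperp_reduction X h (cdim X y)) x y = 1"

definition pair_hom_rel :: "'a cell_data \<Rightarrow> ('a \<Rightarrow> real) \<Rightarrow> 'a bd_pair \<Rightarrow> 'a bd_pair \<Rightarrow> bool" where
  "pair_hom_rel X h \<beta> \<alpha> \<longleftrightarrow> \<beta> \<noteq> \<alpha> \<and> cdim X (fst \<beta>) = cdim X (fst \<alpha>) \<and>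
     (\<exists>b a. snd \<beta> = Some b \<and> snd \<alpha> = Some a \<and> hom_rel X h b a)"

definition pair_cohom_rel :: "'a cell_data \<Rightarrow> ('a \<Rightarrow> real) \<Rightarrow> 'a bd_pair \<Rightarrow> 'a bd_pair \<Rightarrow> bool" where
  "pair_cohom_rel X h \<beta> \<alpha> \<longleftrightarrow> \<beta> \<noteq> \<alpha> \<and> cdim X (fst \<beta>) = cdim X (fst \<alpha>) \<and>
     cohom_rel X h (fst \<beta>) (fst \<alpha>)"


section \<open>Forbidden regions\<close>

definition death_region ::
  "'a cell_data \<Rightarrow> ('a \<Rightarrow> real) \<Rightarrow> 'a bd_pair \<Rightarrow> (ereal \<times> ereal) set" where
  "death_region X h \<alpha> =
     (\<Union>\<beta>\<in>{\<beta> \<in> offdiag_BD_n X h (cdim X (fst \<alpha>)). \<beta> \<noteq> \<alpha> \<and> pair_hom_rel X h \<beta> \<alpha>}.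
        {..ereal (h (fst \<beta>))} \<times> {..death_value h \<beta>}) \<union>
     (\<Union>x\<in>{x \<in> Crit (morse_vf X h). \<exists>d. snd \<alpha> = Some d \<and> x \<noteq> d \<and>
              reachable (vf_digraph X (morse_vf X h)) d x}.
        {..ereal (h x)} \<times> {..ereal (h x)})"

definition birth_region ::
  "'a cell_data \<Rightarrow> ('a \<Rightarrow> real) \<Rightarrow> 'a bd_pair \<Rightarrow> (ereal \<times> ereal) set" where
  "birth_region X h \<alpha> =
     (\<Union>\<beta>\<in>{\<beta> \<in> offdiag_BD_n X h (cdim X (fst \<alpha>)). \<beta> \<noteq> \<alpha> \<and> pair_cohom_rel X h \<beta> \<alpha>}.
        {ereal (h (fst \<beta>))..} \<times> {death_value h \<beta>..}) \<union>
     (\<Union>y\<in>{y \<in> Crit (morse_vf X h). y \<noteq> fst \<alpha> \<and>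
              reachable (vf_digraph X (morse_vf X h)) y (fst \<alpha>)}.
        {ereal (h y)..} \<times> {ereal (h y)..})"

end

theory Submission
  imports Defs "HOL-Library.Function_Algebras"
begin

text \<open>
  Let \<open>V\<close> be the gradient vector field of \<open>h\<close>, with vectors \<open>(t, s)\<close>, tail \<open>t\<close> and head \<open>s\<close>. A chain is
  called invariant if neither it nor its boundary contains a tail. The largest cell of an invariant
  chain is critical, and \<open>stab\<close> is a chain map onto the invariant chains that preserves critical
  leading cells. Applied to the reduced basis of the lazy reduction it yields invariant chains
  \<open>u x\<close> of the critical cells \<open>x\<close>.

  Reversing the unique path from \<open>b\<close> to \<open>a\<close> turns \<open>a\<close> into a tail and \<open>b\<close> into a head, so an invariant
  chain stays invariant once the coefficient of \<open>a\<close> has been cleared in it and in its boundary.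
  This is done by adding \<open>u a\<close> and the invariant chain of \<open>b\<close>. The lazy reduction expands the
  boundary of the latter in the reduced boundaries of the pairs related to \<open>(a, b)\<close>, and dually
  for the coboundary of \<open>a\<close>; since a coboundary of a pair \<open>(g, y)\<close> meets the chain of a pair
  \<open>(z, x)\<close> only if \<open>g \<le> z\<close> and \<open>y \<le> x\<close>, disjointness of the forbidden regions ensures that leading
  cells survive, and with them all other pairs. On the remaining critical cells the values of \<open>h\<close> are
  strictly monotone for the acyclic reversed vector field, hence extend to a discrete Morse function.
\<close>

section \<open>Lazy reduction\<close>

text \<open>The values of \<open>h'\<close> outside its critical cells are arbitrary up to
  monotonicity, so the reductions for \<open>h\<close> and \<open>h'\<close> cannot be compared
  column by column. Two facts get around this. The pairs do not depend on how the matrix is reduced: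
  any family of chains \<open>f z\<close> with leading cell \<open>z\<close> whose boundaries have
  distinct leading cells yields them, so one such family has to be exhibited for \<open>h'\<close>.
  And leading cells of invariant chains are critical, where the orders of \<open>h\<close> and
  \<open>h'\<close> coincide, so leads for \<open>h'\<close> can be found with the order of
  \<open>h\<close>. Laziness matters at one point: a column is added only where the lows agree,
  hence a column related to \<open>y\<close> has a larger birth cell than \<open>y\<close>. It
  follows that the columns of heads are never changed, and therefore the vectors drop out of the
  expansions of the boundary of \<open>b\<close> and the coboundary of \<open>a\<close>. The
  cohomological half is the homological one for the dual complex with \<open>- h\<close>. The two
  halves meet in the evaluation of cochains on chains, whose adjointness yields the inequalities
  that describe the intersection of two rectangles.\<close>

declare add_bit_eq_xor [simp del] mult_bit_eq_and [simp del]

lemma bit_add_self [simp]: "x + x = (0::bit)" by (cases x) auto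

lemma bit_add_eq_0_iff: "x + y = 0 \<longleftrightarrow> x = y" for x y :: bit
  by (cases x; cases y) auto

lemma sum_fun_apply: "(\<Sum>i\<in>I. f i) x = (\<Sum>i\<in>I. f i x)"
  by (induction I rule: infinite_finite_induct) auto

lemma low_spec:
  assumes "sorted_wrt lt rs" and "col_nonzero rs R y"
  shows "low rs R y \<in> set rs" and "R (low rs R y) y = 1"
    and "\<And>i. i \<in> set rs \<Longrightarrow> R i y = 1 \<Longrightarrow> i = low rs R y \<or> lt i (low rs R y)"
proof -
  define fs where "fs = filter (\<lambda>i. R i y \<noteq> 0) rs"
  have ne: "fs \<noteq> []" using assms(2) by (auto simp: fs_def col_nonzero_def filter_empty_conv)
  have last: "low rs R y = last fs" by (simp add: low_def fs_def)
  have in_fs: "last fs \<in> set fs" using ne by simp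
  then show "low rs R y \<in> set rs" "R (low rs R y) y = 1" by (auto simp: last fs_def)
  have sorted: "sorted_wrt lt (butlast fs @ [last fs])"
    using assms(1) ne by (simp add: fs_def sorted_wrt_filter)
  fix i assume "i \<in> set rs" "R i y = 1"
  then have "i \<in> set (butlast fs @ [last fs])" using ne by (simp add: fs_def)
  then show "i = low rs R y \<or> lt i (low rs R y)"
    using sorted by (auto simp: sorted_wrt_append last)
qed

text \<open>Besides triangularity this keeps the mark of laziness: column \<open>x\<close> is added
  to \<open>y\<close> only while their lows agree, and the low of \<open>y\<close> drops with each
  addition, so it ends strictly before the low of \<open>x\<close>.\<close>

definition lazy_ops ::
  "'a list \<Rightarrow> 'a list \<Rightarrow> ('a \<Rightarrow> 'a \<Rightarrow> bool) \<Rightarrow> nat \<Rightarrow> 'a mtx \<Rightarrow> 'a mtx \<Rightarrow> bool" where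
  "lazy_ops rs cs lt l R U \<longleftrightarrow> (\<forall>x y. U x y = 1 \<longrightarrow> x \<noteq> y \<longrightarrow>
     (\<exists>m n. m < n \<and> n < l \<and> n < length cs \<and> x = cs ! m \<and> y = cs ! n) \<and> col_nonzero rs R x \<and>
     (col_nonzero rs R y \<longrightarrow> lt (low rs R y) (low rs R x)))"

lemma lazy_ops_mono: "lazy_ops rs cs lt l R U \<Longrightarrow> l \<le> l' \<Longrightarrow> lazy_ops rs cs lt l' R U"
  unfolding lazy_ops_def by (elim all_forward imp_forward conj_forward ex_forward) simp_all

text \<open>Column form of \<open>R = M V\<close> with \<open>V\<close> unitriangular; carrying
  \<open>V\<close> along as an existential avoids inverting \<open>U\<close> at the end.\<close>

definition lazy_basis :: "'a list \<Rightarrow> 'a mtx \<Rightarrow> 'a mtx \<Rightarrow> bool" where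
  "lazy_basis cs M R \<longleftrightarrow> (\<forall>m<length cs. \<exists>v. v (cs ! m) = 1 \<and>
     (\<forall>x. v x = 1 \<longrightarrow> x \<in> set (take (Suc m) cs)) \<and>
     (\<forall>i. R i (cs ! m) = (\<Sum>x\<in>set cs. M i x * v x)))"

definition distinct_lows :: "'a list \<Rightarrow> 'a list \<Rightarrow> nat \<Rightarrow> 'a mtx \<Rightarrow> bool" where
  "distinct_lows rs cs k R \<longleftrightarrow> (\<forall>m n. m < n \<longrightarrow> n < k \<longrightarrow> col_nonzero rs R (cs ! m) \<longrightarrow>
     col_nonzero rs R (cs ! n) \<longrightarrow> low rs R (cs ! m) \<noteq> low rs R (cs ! n))"

text \<open>While column \<open>k\<close> is being reduced, the invariant holds with \<open>l = Suc k\<close>.\<close>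

definition lazy_inv ::
  "'a list \<Rightarrow> 'a list \<Rightarrow> 'a mtx \<Rightarrow> ('a \<Rightarrow> 'a \<Rightarrow> bool) \<Rightarrow> nat \<Rightarrow> nat \<Rightarrow> 'a mtx \<Rightarrow> 'a mtx \<Rightarrow> bool" where
  "lazy_inv rs cs M lt k l R U \<longleftrightarrow>
     (\<forall>i. \<forall>j\<in>set cs. M i j = (\<Sum>x\<in>set cs. R i x * U x j)) \<and> (\<forall>x. U x x = 1) \<and>
     lazy_basis cs M R \<and> lazy_ops rs cs lt l R U \<and> distinct_lows rs cs k R"

context
  fixes rs cs :: "'a list" and M :: "'a mtx" and lt :: "'a \<Rightarrow> 'a \<Rightarrow> bool"
  assumes cs: "distinct cs" and rs: "sorted_wrt lt rs"
    and irrefl: "\<And>x. \<not> lt x x" and trans: "\<And>x y z. lt x y \<Longrightarrow> lt y z \<Longrightarrow> lt x z"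
begin

lemma col_nonzero_cong: "(\<And>i. R i y = R' i y) \<Longrightarrow> col_nonzero rs R y = col_nonzero rs R' y"
  by (simp add: col_nonzero_def)

lemma low_cong: "(\<And>i. R i y = R' i y) \<Longrightarrow> low rs R y = low rs R' y"
  by (simp add: low_def)

text \<open>Over the field with two elements the entries at the common low cancel, and both columns
  vanish past it.\<close>

lemma low_add_column:
  assumes "col_nonzero rs R x" "col_nonzero rs R y" "low rs R x = low rs R y"
    and nz: "col_nonzero rs (add_column x y R) y"
  shows "lt (low rs (add_column x y R) y) (low rs R y)"
proof -
  let ?l = "low rs (add_column x y R) y"
  note l = low_spec[OF rs nz]
  have "R ?l y + R ?l x = 1" using l(2) by (simp add: add_column_def)
  then have "R ?l y = 1 \<or> R ?l x = 1" by (cases "R ?l y") auto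
  then have "?l = low rs R y \<or> lt ?l (low rs R y)"
    using low_spec(3)[OF rs assms(1) l(1)] low_spec(3)[OF rs assms(2) l(1)] assms(3) by auto
  moreover have "?l \<noteq> low rs R y"
  proof
    assume "?l = low rs R y"
    then have "add_column x y R (low rs R y) y = 1" using l(2) by simp
    then show False
      using low_spec(2)[OF rs assms(1)] low_spec(2)[OF rs assms(2)] assms(3)
      by (simp add: add_column_def)
  qed
  ultimately show ?thesis by blast
qed

lemma lazy_inv_add:
  assumes inv: "lazy_inv rs cs M lt k (Suc k) R U" and k: "k < length cs"
    and lc: "low_conflict rs (take k cs) R (cs ! k) x"
  shows "lazy_inv rs cs M lt k (Suc k) (add_column x (cs ! k) R) (add_row (cs ! k) x U)"
proof -
  define y where "y = cs ! k"
  define R' where "R' = add_column x y R"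
  define U' where "U' = add_row y x U"
  obtain m where m: "m < k" "x = cs ! m"
    using lc k by (auto simp: low_conflict_def in_set_conv_nth)
  have nz: "col_nonzero rs R x" "col_nonzero rs R y" and low: "low rs R x = low rs R y"
    using lc by (auto simp: low_conflict_def y_def)
  have gen: "\<exists>v. v (cs ! n) = 1 \<and> (\<forall>x. v x = 1 \<longrightarrow> x \<in> set (take (Suc n) cs)) \<and>
     (\<forall>i. R i (cs ! n) = (\<Sum>x\<in>set cs. M i x * v x))" if "n < length cs" for n
  proof -
    have "lazy_basis cs M R" using inv unfolding lazy_inv_def by blast
    then show ?thesis using that unfolding lazy_basis_def by blast
  qed
  have xy: "x \<noteq> y" using m k cs by (simp add: y_def nth_eq_iff_index_eq)
  have in_cs: "x \<in> set cs" "y \<in> set cs" using m k by (auto simp: y_def)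
  have R'_other: "R' i j = R i j" if "j \<noteq> y" for i j using that by (simp add: R'_def add_column_def)
  have R'_y: "R' i y = R i y + R i x" for i by (simp add: R'_def add_column_def)
  have nz': "col_nonzero rs R' j = col_nonzero rs R j" if "j \<noteq> y" for j
    by (rule col_nonzero_cong) (simp add: R'_other that)
  have low': "low rs R' j = low rs R j" if "j \<noteq> y" for j
    by (rule low_cong) (simp add: R'_other that)
  have low'y: "lt (low rs R' y) (low rs R y)" if "col_nonzero rs R' y"
    using low_add_column[OF nz low] that by (simp add: R'_def)
  have idx: "\<exists>m n. m < n \<and> n < Suc k \<and> n < length cs \<and> z = cs ! m \<and> w = cs ! n"
    and rel: "col_nonzero rs R z"
      "col_nonzero rs R w \<Longrightarrow> lt (low rs R w) (low rs R z)"
    if "U z w = 1" "z \<noteq> w" for z w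
    using inv that unfolding lazy_inv_def lazy_ops_def by simp_all
  \<comment> \<open>Column \<open>y\<close> is still being reduced and has not been added to any
    other column, so its row in \<open>U\<close> is a unit row. Adding that row to row
    \<open>x\<close> therefore changes a single entry.\<close>
  have Uy: "U y j = (if j = y then 1 else 0)" for j
  proof (cases "j = y")
    case True then show ?thesis using inv unfolding lazy_inv_def by simp
  next
    case False
    have "U y j \<noteq> 1"
    proof
      assume "U y j = 1"
      then obtain p q where "p < q" "q < Suc k" "q < length cs" "y = cs ! p"
        using idx[of y j] False by blast
      then show False using k cs by (simp add: y_def nth_eq_iff_index_eq)
    qed
    then show ?thesis using False by simp
  qed
  have U': "U' z j = (if z = x \<and> j = y then U x y + 1 else U z j)" for z j
    using xy by (auto simp: U'_def add_row_def Uy)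
  have prod: "M i j = (\<Sum>z\<in>set cs. R' i z * U' z j)" if "j \<in> set cs" for i j
  proof (cases "j = y")
    case False
    have "R' i z * U' z j = R i z * U z j" for z
    proof (cases "z = y")
      case True then show ?thesis using False xy by (simp add: U' Uy)
    qed (use False in \<open>simp add: R'_other U'\<close>)
    then show ?thesis using inv that unfolding lazy_inv_def by simp
  next
    case True
    let ?S = "set cs - {x} - {y}"
    have split: "(\<Sum>z\<in>set cs. f z) = f x + (f y + sum f ?S)" for f :: "'a \<Rightarrow> bit"
      using in_cs xy by (simp add: sum.remove[of "set cs" x] sum.remove[of "set cs - {x}" y])
    \<comment> \<open>The copy of \<open>R i x\<close> added to column \<open>y\<close> cancels the
      one coming from the flipped entry \<open>U x y\<close>.\<close>
    have "(\<Sum>z\<in>set cs. R' i z * U' z y) =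
        R i x * (U x y + 1) + ((R i y + R i x) + (\<Sum>z\<in>?S. R i z * U z y))"
      unfolding split using xy by (simp add: R'_y R'_other U' Uy)
    also have "\<dots> = R i x * U x y + (R i y * U y y + (\<Sum>z\<in>?S. R i z * U z y))"
      by (simp add: Uy distrib_left)
    also have "\<dots> = (\<Sum>z\<in>set cs. R i z * U z y)" unfolding split ..
    finally show ?thesis using inv True that unfolding lazy_inv_def by simp
  qed
  have gens: "\<exists>v. v (cs ! n) = 1 \<and> (\<forall>z. v z = 1 \<longrightarrow> z \<in> set (take (Suc n) cs)) \<and>
        (\<forall>i. R' i (cs ! n) = (\<Sum>z\<in>set cs. M i z * v z))" if n: "n < length cs" for n
  proof (cases "n = k")
    case False
    then have ny: "cs ! n \<noteq> y" using n k cs by (simp add: y_def nth_eq_iff_index_eq)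
    show ?thesis unfolding R'_other[OF ny] by (rule gen[OF n])
  next
    case True
    obtain v where v: "v y = 1" "\<And>z. v z = 1 \<Longrightarrow> z \<in> set (take (Suc k) cs)"
        "\<And>i. R i y = (\<Sum>z\<in>set cs. M i z * v z)"
      using gen[OF k] unfolding y_def by blast
    obtain u where u: "\<And>z. u z = 1 \<Longrightarrow> z \<in> set (take (Suc m) cs)"
        "\<And>i. R i x = (\<Sum>z\<in>set cs. M i z * u z)"
      using gen[of m] m k by auto
    \<comment> \<open>The vector of \<open>x\<close> lives on columns before \<open>y\<close>, so
      \<open>v + u\<close> keeps the coefficient 1 at \<open>y\<close>.\<close>
    have "u y \<noteq> 1"
    proof
      assume "u y = 1"
      then have "y \<in> set (take k cs)"
        using u(1) m(1) set_take_subset_set_take[of "Suc m" k cs] by auto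
      then show False using cs k by (auto simp: y_def in_set_conv_nth nth_eq_iff_index_eq)
    qed
    moreover have "z \<in> set (take (Suc k) cs)" if "v z + u z = 1" for z
    proof -
      have "v z = 1 \<or> u z = 1" using that by (cases "v z") auto
      then show ?thesis
        using v(2) u(1) m(1) set_take_subset_set_take[of "Suc m" "Suc k" cs] by auto
    qed
    ultimately show ?thesis
      unfolding True y_def[symmetric]
      by (intro exI[of _ "\<lambda>z. v z + u z"])
         (auto simp: v(1) R'_y v(3) u(2) distrib_left sum.distrib)
  qed
  have ops: "(\<exists>m n. m < n \<and> n < Suc k \<and> n < length cs \<and> z = cs ! m \<and> w = cs ! n) \<and>
      col_nonzero rs R' z \<and> (col_nonzero rs R' w \<longrightarrow> lt (low rs R' w) (low rs R' z))"
    if zw: "U' z w = 1" "z \<noteq> w" for z w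
  proof (cases "z = x \<and> w = y")
    case True
    then show ?thesis using m k nz low low'y xy by (auto simp: nz' low' y_def)
  next
    case False
    then have U: "U z w = 1" using zw(1) by (auto simp: U' split: if_splits)
    have "z \<noteq> y" using U zw(2) by (auto simp: Uy split: if_splits)
    \<comment> \<open>The low of column \<open>y\<close> only drops, so comparisons recorded earlier
      stay valid.\<close>
    have "lt (low rs R' w) (low rs R z)" if "col_nonzero rs R' w"
    proof (cases "w = y")
      case True
      then show ?thesis using rel(2)[OF U zw(2)] nz(2) low'y that by (blast intro: trans)
    next
      case False
      then show ?thesis using rel(2)[OF U zw(2)] that by (simp add: nz' low')
    qed
    then show ?thesis
      using idx[OF U zw(2)] rel(1)[OF U zw(2)] by (simp only: nz'[OF \<open>z \<noteq> y\<close>] low'[OF \<open>z \<noteq> y\<close>]) simp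
  qed
  have lows: "low rs R' (cs ! p) \<noteq> low rs R' (cs ! q)"
    if "p < q" "q < k" "col_nonzero rs R' (cs ! p)" "col_nonzero rs R' (cs ! q)" for p q
  proof -
    have "cs ! p \<noteq> y" "cs ! q \<noteq> y"
      using that k cs by (auto simp: y_def nth_eq_iff_index_eq)
    then show ?thesis
      using inv that unfolding lazy_inv_def distinct_lows_def by (simp add: nz' low')
  qed
  have "U' z z = 1" for z using inv xy unfolding lazy_inv_def by (auto simp: U')
  then show ?thesis
    unfolding lazy_inv_def y_def[symmetric] R'_def[symmetric] U'_def[symmetric]
      lazy_basis_def lazy_ops_def distinct_lows_def
    using prod gens ops lows by (intro conjI allI impI ballI) (simp_all only: simp_thms)
qed

text \<open>Termination measure of the loop: the position of the low, shifted by one so that a zero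
  column ranks below every other.\<close>

definition low_height :: "'a mtx \<Rightarrow> 'a \<Rightarrow> nat" where
  "low_height R y =
     (if col_nonzero rs R y then Suc (card {i \<in> set rs. lt i (low rs R y)}) else 0)"

lemma low_height_add_column:
  assumes "col_nonzero rs R x" "col_nonzero rs R y" "low rs R x = low rs R y"
  shows "low_height (add_column x y R) y < low_height R y"
proof (cases "col_nonzero rs (add_column x y R) y")
  case True
  let ?R = "add_column x y R"
  have lt: "lt (low rs ?R y) (low rs R y)" by (rule low_add_column[OF assms True])
  have "{i \<in> set rs. lt i (low rs ?R y)} \<subset> {i \<in> set rs. lt i (low rs R y)}"
    using lt low_spec(1)[OF rs True] trans irrefl by blast
  then have "card {i \<in> set rs. lt i (low rs ?R y)} < card {i \<in> set rs. lt i (low rs R y)}"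
    by (intro psubset_card_mono) auto
  then show ?thesis using True assms(2) by (simp add: low_height_def)
qed (use assms in \<open>simp add: low_height_def\<close>)

lemma lazy_inv_reduce_column:
  assumes inv: "lazy_inv rs cs M lt k k R U" and k: "k < length cs"
    and res: "reduce_column rs (take k cs) (cs ! k) (R, U) = (R', U')"
  shows "lazy_inv rs cs M lt (Suc k) (Suc k) R' U'"
proof -
  let ?b = "\<lambda>(R, U :: 'a mtx). \<exists>x. low_conflict rs (take k cs) R (cs ! k) x"
  let ?c = "\<lambda>(R, U). let x = (SOME x. low_conflict rs (take k cs) R (cs ! k) x)
                 in (add_column x (cs ! k) R, add_row (cs ! k) x U)"
  have "case while ?b ?c (R, U) of (R', U') \<Rightarrow>
      lazy_inv rs cs M lt k (Suc k) R' U' \<and> \<not> (\<exists>x. low_conflict rs (take k cs) R' (cs ! k) x)"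
  proof (rule while_rule[where P = "\<lambda>(R, U). lazy_inv rs cs M lt k (Suc k) R U"
        and r = "measure (\<lambda>(R, U). low_height R (cs ! k))"], goal_cases)
    case 1
    \<comment> \<open>On entering the loop the bound is relaxed by one, because off-diagonal entries
      of \<open>U\<close> may now appear in column \<open>k\<close>.\<close>
    have "lazy_ops rs cs lt (Suc k) R U"
      using lazy_ops_mono[of rs cs lt k R U "Suc k"] inv unfolding lazy_inv_def by simp
    then show ?case using inv unfolding lazy_inv_def by simp
  next
    case (2 s)
    obtain S W where s: "s = (S, W)" by force
    have "low_conflict rs (take k cs) S (cs ! k) (SOME x. low_conflict rs (take k cs) S (cs ! k) x)"
      using 2(2) unfolding s by (auto intro: someI)
    then show ?case using 2(1) k unfolding s by (simp add: Let_def lazy_inv_add)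
  next
    case (3 s) then show ?case by (auto split: prod.splits)
  next
    case 4 show ?case by simp
  next
    case (5 s)
    obtain S W where s: "s = (S, W)" by force
    define x where "x = (SOME x. low_conflict rs (take k cs) S (cs ! k) x)"
    have "low_conflict rs (take k cs) S (cs ! k) x"
      using 5(2) unfolding s x_def by (auto intro: someI)
    then have "low_height (add_column x (cs ! k) S) (cs ! k) < low_height S (cs ! k)"
      by (simp add: low_height_add_column low_conflict_def)
    then show ?case unfolding s by (simp add: Let_def x_def)
  qed
  then have inv': "lazy_inv rs cs M lt k (Suc k) R' U'"
    and nc: "\<not> low_conflict rs (take k cs) R' (cs ! k) x" for x
    using res unfolding reduce_column_def by auto
  have "low rs R' (cs ! m) \<noteq> low rs R' (cs ! n)"
    if "m < n" "n < Suc k" "col_nonzero rs R' (cs ! m)" "col_nonzero rs R' (cs ! n)" for m n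
  proof (cases "n = k")
    case True
    have "cs ! m \<in> set (take k cs)" using that(1) k True by (auto simp: in_set_conv_nth)
    then show ?thesis using nc[of "cs ! m"] that True by (auto simp: low_conflict_def)
  next
    case False
    then show ?thesis using inv' that unfolding lazy_inv_def distinct_lows_def by simp
  qed
  then have "distinct_lows rs cs (Suc k) R'" unfolding distinct_lows_def by blast
  then show ?thesis using inv' unfolding lazy_inv_def by blast
qed

lemma lazy_inv_lazy_reduction:
  "case lazy_reduction rs cs M of (R, U) \<Rightarrow> lazy_inv rs cs M lt (length cs) (length cs) R U"
proof -
  let ?s = "\<lambda>n. fold (\<lambda>k. reduce_column rs (take k cs) (cs ! k)) [0..<n]
       (M, \<lambda>i j. if i = j then 1 else 0)"
  have "case ?s n of (R, U) \<Rightarrow> lazy_inv rs cs M lt n n R U" if "n \<le> length cs" for n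
    using that
  proof (induction n)
    case 0
    have "M i j = (\<Sum>x\<in>set cs. M i x * (if x = j then 1 else 0))" if "j \<in> set cs" for i j
      using that by (simp add: if_distrib[of "(*) _"] sum.delta cong: if_cong)
    moreover have "\<exists>v. v (cs ! m) = (1::bit) \<and> (\<forall>x. v x = 1 \<longrightarrow> x \<in> set (take (Suc m) cs)) \<and>
        (\<forall>i. M i (cs ! m) = (\<Sum>x\<in>set cs. M i x * v x))" if "m < length cs" for m
      using that by (intro exI[of _ "\<lambda>x. if x = cs ! m then 1 else 0"])
        (auto simp: take_Suc_conv_app_nth if_distrib[of "(*) _"] sum.delta cong: if_cong)
    ultimately show ?case
      by (simp add: lazy_inv_def lazy_ops_def lazy_basis_def distinct_lows_def del: ex_simps all_simps)
  next
    case (Suc n)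
    obtain R U where RU: "?s n = (R, U)" by force
    obtain R' U' where RU': "reduce_column rs (take n cs) (cs ! n) (R, U) = (R', U')" by force
    have "lazy_inv rs cs M lt n n R U" using Suc RU by auto
    then have "lazy_inv rs cs M lt (Suc n) (Suc n) R' U'"
      using lazy_inv_reduce_column RU' Suc.prems by simp
    then show ?case using RU RU' by simp
  qed
  from this[OF order_refl] show ?thesis unfolding lazy_reduction_def .
qed

end


section \<open>Enumeration of finite strict linear orders\<close>

lemma enum_by_cong:
  assumes "\<And>x y. x \<in> A \<Longrightarrow> y \<in> A \<Longrightarrow> lt x y = lt' x y"
  shows "enum_by lt A = enum_by lt' A"
proof -
  have "sorted_wrt lt xs = sorted_wrt lt' xs" if "set xs = A" for xs
    using assms that by (auto simp: sorted_wrt_iff_nth_less)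
  then show ?thesis unfolding enum_by_def by metis
qed

lemma sorted_wrt_unique:
  assumes irrefl: "\<And>x. \<not> lt x x" and trans: "\<And>x y z. lt x y \<Longrightarrow> lt y z \<Longrightarrow> lt x z"
    and "sorted_wrt lt xs" "sorted_wrt lt ys" "set xs = set ys"
  shows "xs = ys"
  using assms(3-5)
proof (induction xs arbitrary: ys)
  case (Cons x xs)
  then obtain y ys' where ys: "ys = y # ys'" by (cases ys) auto
  have "x = y"
  proof (rule ccontr)
    assume "x \<noteq> y"
    then have "x \<in> set ys'" "y \<in> set xs" using Cons.prems unfolding ys by (auto simp: set_eq_iff)
    then have "lt y x" "lt x y" using Cons.prems unfolding ys by auto
    then show False using irrefl[of x] by (blast dest: trans)
  qed
  moreover have "x \<notin> set xs" "y \<notin> set ys'" using Cons.prems irrefl unfolding ys by auto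
  ultimately have "set xs = set ys'" using Cons.prems unfolding ys by auto
  then show ?case using Cons \<open>x = y\<close> unfolding ys by auto
qed simp

lemma enum_by_spec:
  assumes irrefl: "\<And>x. \<not> lt x x" and trans: "\<And>x y z. lt x y \<Longrightarrow> lt y z \<Longrightarrow> lt x z"
    and total: "\<And>x y. x \<in> A \<Longrightarrow> y \<in> A \<Longrightarrow> x \<noteq> y \<Longrightarrow> lt x y \<or> lt y x" and fin: "finite A"
  shows "set (enum_by lt A) = A" "sorted_wrt lt (enum_by lt A)"
proof -
  have "\<exists>xs. set xs = B \<and> sorted_wrt lt xs" if "B \<subseteq> A" for B
    using finite_subset[OF that fin] that
  proof (induction "card B" arbitrary: B)
    case 0 then show ?case by (intro exI[of _ "[]"]) auto
  next
    case (Suc n)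
    have "\<exists>m\<in>C. \<forall>x\<in>C. x = m \<or> lt x m" if "finite C" "C \<noteq> {}" "C \<subseteq> A" for C
      using that
    proof (induction rule: finite_ne_induct)
      case (insert x F)
      then obtain m where m: "m \<in> F" "\<forall>y\<in>F. y = m \<or> lt y m" by auto
      then have "lt x m \<or> lt m x" using insert total[of x m] by blast
      then show ?case
      proof
        assume "lt x m" then show ?thesis using m by (intro bexI[of _ m]) simp_all
      next
        assume "lt m x"
        then have "lt y x" if "y \<in> F" for y using m that trans by metis
        then show ?thesis by (intro bexI[of _ x]) simp_all
      qed
    qed auto
    moreover have "B \<noteq> {}" using Suc by auto
    ultimately obtain m where m: "m \<in> B" "\<And>x. x \<in> B \<Longrightarrow> x = m \<or> lt x m"
      using Suc by metis
    have "n = card (B - {m})" using Suc m by simp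
    from Suc(1)[OF this] obtain xs where "set xs = B - {m}" "sorted_wrt lt xs"
      using Suc.prems by blast
    then show ?case using m by (intro exI[of _ "xs @ [m]"]) (auto simp: sorted_wrt_append)
  qed
  then obtain xs where "set xs = A \<and> sorted_wrt lt xs" by blast
  then have "\<exists>!xs. set xs = A \<and> sorted_wrt lt xs"
    using sorted_wrt_unique[of lt, OF irrefl trans] by (intro ex1I[of _ xs]) auto
  then have "set (enum_by lt A) = A \<and> sorted_wrt lt (enum_by lt A)"
    unfolding enum_by_def by (rule theI')
  then show "set (enum_by lt A) = A" "sorted_wrt lt (enum_by lt A)" by blast+
qed


section \<open>Chains and bases adapted to the order\<close>

text \<open>Chains may mix dimensions; with one ungraded space the matrices of all dimensions are
  treated at once.\<close>

definition chain :: "'a cell_data \<Rightarrow> ('a \<Rightarrow> bit) \<Rightarrow> bool" where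
  "chain X c \<longleftrightarrow> (\<forall>x. c x = 1 \<longrightarrow> x \<in> cells X)"

definition bd :: "'a cell_data \<Rightarrow> ('a \<Rightarrow> bit) \<Rightarrow> 'a \<Rightarrow> bit" where
  "bd X c = (\<lambda>x. if x \<in> cells X then \<Sum>y\<in>cells X. inc X x y * c y else 0)"

definition single :: "'a \<Rightarrow> 'a \<Rightarrow> bit" where
  "single y = (\<lambda>x. if x = y then 1 else 0)"

text \<open>Counterpart of \<open>low\<close> for chains. Being a relation, it needs no default for
  the zero chain, which has no lead.\<close>

definition lead :: "'a cell_data \<Rightarrow> ('a \<Rightarrow> real) \<Rightarrow> ('a \<Rightarrow> bit) \<Rightarrow> 'a \<Rightarrow> bool" where
  "lead X h c a \<longleftrightarrow> c a = 1 \<and> (\<forall>x. c x = 1 \<longrightarrow> x = a \<or> h_less X h x a)"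

text \<open>Abstracts from the algorithm: a unitriangular change of basis, in all dimensions
  together, after which the boundary matrix is reduced.\<close>

definition reduced_basis :: "'a cell_data \<Rightarrow> ('a \<Rightarrow> real) \<Rightarrow> ('a \<Rightarrow> 'a \<Rightarrow> bit) \<Rightarrow> bool" where
  "reduced_basis X h f \<longleftrightarrow> (\<forall>z\<in>cells X. chain X (f z) \<and> lead X h (f z) z) \<and>
     (\<forall>y\<in>cells X. \<forall>z\<in>cells X. \<forall>a.
        lead X h (bd X (f y)) a \<longrightarrow> lead X h (bd X (f z)) a \<longrightarrow> y = z)"

lemma bit_add_eq_1D: "x + y = 1 \<Longrightarrow> x = 1 \<or> y = 1" for x y :: bit
  by (cases x) auto

lemma chain_add: "chain X c \<Longrightarrow> chain X d \<Longrightarrow> chain X (c + d)"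
  unfolding chain_def by (auto dest: bit_add_eq_1D)

lemma chain_0 [simp]: "chain X 0"
  by (simp add: chain_def)

lemma chain_single: "y \<in> cells X \<Longrightarrow> chain X (single y)"
  by (simp add: chain_def single_def)

lemma chain_bd [simp]: "chain X (bd X c)"
  by (simp add: chain_def bd_def)

lemma bd_add: "bd X (c + d) = bd X c + bd X d"
  by (auto simp: bd_def fun_eq_iff distrib_left sum.distrib)

lemma bd_0 [simp]: "bd X 0 = 0"
  by (auto simp: bd_def fun_eq_iff)

lemma bd_sum: "bd X (sum f I) = (\<Sum>i\<in>I. bd X (f i))"
proof (induction I rule: infinite_finite_induct)
  case (insert x F)
  then show ?case by (simp only: sum.insert bd_add not_False_eq_True)
qed (simp_all only: sum.infinite sum.empty bd_0 not_False_eq_True)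

lemma chain_add_self [simp]: "c + c = (0 :: 'a \<Rightarrow> bit)"
  by (simp add: fun_eq_iff)

lemma chain_add_eq_0_iff: "c + d = 0 \<longleftrightarrow> c = d" for c d :: "'a \<Rightarrow> bit"
  by (simp add: fun_eq_iff bit_add_eq_0_iff)

lemma chain_add_cancel [simp]: "c + (c + d) = d" "c + (d + c) = d" for c d :: "'a \<Rightarrow> bit"
  by (simp_all add: add.assoc[symmetric] add.commute[of d c])

lemma sum_eq_1D:
  assumes "(\<Sum>i\<in>I. f i) = (1::bit)" shows "\<exists>i\<in>I. f i = 1"
proof (rule ccontr)
  assume "\<not> ?thesis"
  then have "f i = 0" if "i \<in> I" for i using that by simp
  then show False using assms by simp
qed

lemma lead_unique:
  assumes "lead X h c a" "lead X h c b" shows "a = b"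
  using assms unfolding lead_def h_less_def by force

lemma lead_add:
  assumes "lead X h c a" "\<And>x. d x = 1 \<Longrightarrow> h_less X h x a" shows "lead X h (c + d) a"
proof -
  have "\<not> h_less X h a a" by (simp add: h_less_def)
  then have "d a = 0" using assms(2) bit_not_one_iff by blast
  moreover have "c x = 1 \<or> d x = 1" if "(c + d) x = 1" for x
    using that by (cases "c x") auto
  ultimately show ?thesis using assms unfolding lead_def by auto
qed

section \<open>The boundary operator\<close>

context lefschetz_complex
begin

lemma facet_cdim: "facet X x y \<Longrightarrow> cdim X y = cdim X x + 1"
  using inc_dim unfolding facet_def by force

lemma bd_bd [simp]: "bd X (bd X c) = 0"
proof
  fix x
  have "(\<Sum>y\<in>cells X. inc X x y * (\<Sum>z\<in>cells X. inc X y z * c z)) = 0" if "x \<in> cells X"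
  proof -
    have "(\<Sum>y\<in>cells X. inc X x y * (\<Sum>z\<in>cells X. inc X y z * c z)) =
        (\<Sum>z\<in>cells X. \<Sum>y\<in>cells X. inc X x y * inc X y z * c z)"
      by (subst sum.swap) (simp add: sum_distrib_left mult.assoc)
    also have "\<dots> = (\<Sum>z\<in>cells X. (\<Sum>y\<in>cells X. inc X x y * inc X y z) * c z)"
      by (simp add: sum_distrib_right)
    also have "\<dots> = 0" using inc_inc that by simp
    finally show ?thesis .
  qed
  then show "bd X (bd X c) x = 0 x" by (simp add: bd_def)
qed

lemma bd_single: "y \<in> cells X \<Longrightarrow> bd X (single y) x = (if x \<in> cells X then inc X x y else 0)"
  using finite_cells
  by (simp add: bd_def single_def if_distrib[of "(*) _"] sum.delta cong: if_cong)

lemma bd_single_eq_1: "y \<in> cells X \<Longrightarrow> bd X (single y) x = 1 \<longleftrightarrow> facet X x y"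
  by (simp add: bd_single facet_def)

lemma bd_eq_1D:
  assumes "bd X c x = 1" shows "\<exists>y. c y = 1 \<and> facet X x y"
proof -
  have x: "x \<in> cells X" using assms by (simp add: bd_def split: if_splits)
  then have "(\<Sum>y\<in>cells X. inc X x y * c y) = 1" using assms by (simp add: bd_def)
  then obtain y where "y \<in> cells X" "inc X x y * c y = 1" by (blast dest: sum_eq_1D)
  then show ?thesis using x by (cases "c y") (auto simp: facet_def)
qed

end

locale morse_complex = lefschetz_complex X for X :: "'a cell_data" +
  fixes h :: "'a \<Rightarrow> real"
  assumes morse: "discrete_morse X h"
begin

abbreviation less :: "'a \<Rightarrow> 'a \<Rightarrow> bool" (infix "\<prec>" 50) where
  "x \<prec> y \<equiv> h_less X h x y"

lemma less_irrefl [simp]: "\<not> x \<prec> x"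
  by (simp add: h_less_def)

lemma less_trans [trans]: "x \<prec> y \<Longrightarrow> y \<prec> z \<Longrightarrow> x \<prec> z"
  by (auto simp: h_less_def)

lemma less_asym: "x \<prec> y \<Longrightarrow> \<not> y \<prec> x"
  by (auto simp: h_less_def)

lemma facet_mono: "facet X x y \<Longrightarrow> h x \<le> h y"
  using morse unfolding facet_def discrete_morse_def by auto

lemma eq_facet: "x \<in> cells X \<Longrightarrow> y \<in> cells X \<Longrightarrow> h x = h y \<Longrightarrow> x \<noteq> y \<Longrightarrow> facet X x y \<or> facet X y x"
  using morse unfolding facet_def discrete_morse_def by auto

lemma less_total: "x \<in> cells X \<Longrightarrow> y \<in> cells X \<Longrightarrow> x \<noteq> y \<Longrightarrow> x \<prec> y \<or> y \<prec> x"
  using eq_facet[of x y] facet_cdim[of x y] facet_cdim[of y x] unfolding h_less_def by force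

lemma max_cell:
  assumes "A \<subseteq> cells X" "A \<noteq> {}" shows "\<exists>m\<in>A. \<forall>x\<in>A. x = m \<or> x \<prec> m"
  using finite_subset[OF assms(1) finite_cells] assms(2,1)
proof (induction rule: finite_ne_induct)
  case (insert x F)
  then obtain m where m: "m \<in> F" "\<forall>y\<in>F. y = m \<or> y \<prec> m" by auto
  then have "x \<prec> m \<or> m \<prec> x" using insert less_total[of x m] by blast
  then show ?case
  proof
    assume "x \<prec> m" then show ?thesis using m by (intro bexI[of _ m]) simp_all
  next
    assume "m \<prec> x"
    then have "y \<prec> x" if "y \<in> F" for y using m that less_trans by metis
    then show ?thesis by (intro bexI[of _ x]) simp_all
  qed
qed auto

lemma cell_induct [consumes 1, case_names less]:
  assumes "x \<in> cells X"
    and step: "\<And>x. x \<in> cells X \<Longrightarrow> (\<And>y. y \<in> cells X \<Longrightarrow> y \<prec> x \<Longrightarrow> P y) \<Longrightarrow> P x"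
  shows "P x"
  using assms(1)
proof (induction "card {y \<in> cells X. y \<prec> x}" arbitrary: x rule: less_induct)
  case less
  have "card {z \<in> cells X. z \<prec> y} < card {z \<in> cells X. z \<prec> x}" if "y \<in> cells X" "y \<prec> x" for y
    proof (rule psubset_card_mono)
    show "finite {z \<in> cells X. z \<prec> x}" using finite_cells by simp
    have "y \<notin> {z \<in> cells X. z \<prec> y}" "y \<in> {z \<in> cells X. z \<prec> x}" using that by simp_all
    moreover have "{z \<in> cells X. z \<prec> y} \<subseteq> {z \<in> cells X. z \<prec> x}"
      using that(2) by (auto intro: less_trans)
    ultimately show "{z \<in> cells X. z \<prec> y} \<subset> {z \<in> cells X. z \<prec> x}" by blast
  qed
  then show ?case using less step by blast
qed

section \<open>Leading cells and independence of the pairs from the reduced basis\<close>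

lemma lead_cells: "chain X c \<Longrightarrow> lead X h c a \<Longrightarrow> a \<in> cells X"
  by (auto simp: chain_def lead_def)

lemma lead_exists:
  assumes "chain X c" "c \<noteq> 0" shows "\<exists>a\<in>cells X. lead X h c a"
proof -
  have "{x. c x = 1} \<subseteq> cells X" "{x. c x = 1} \<noteq> {}"
    using assms by (auto simp: chain_def fun_eq_iff)
  from max_cell[OF this] show ?thesis using assms unfolding lead_def chain_def by blast
qed

lemma lead_not_0: "lead X h c a \<Longrightarrow> c \<noteq> 0"
  by (auto simp: lead_def)

text \<open>The largest of the leads belongs to one summand only and exceeds every cell of the
  others, so it cannot cancel.\<close>

lemma lead_sum:
  assumes fin: "finite S" and chain: "\<And>x. x \<in> S \<Longrightarrow> chain X (g x)"
    and dist: "\<And>x y a. x \<in> S \<Longrightarrow> y \<in> S \<Longrightarrow> lead X h (g x) a \<Longrightarrow> lead X h (g y) a \<Longrightarrow> x = y"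
    and nz: "\<exists>x\<in>S. g x \<noteq> 0"
  shows "\<exists>x\<in>S. \<exists>a. lead X h (g x) a \<and> lead X h (sum g S) a \<and>
    (\<forall>y\<in>S. \<forall>b. lead X h (g y) b \<longrightarrow> b = a \<or> b \<prec> a)"
proof -
  let ?L = "{a. \<exists>x\<in>S. lead X h (g x) a}"
  have "?L \<subseteq> cells X" using chain lead_cells by blast
  moreover have "?L \<noteq> {}" using nz chain lead_exists by blast
  ultimately obtain a where "a \<in> ?L" and max: "\<And>b. b \<in> ?L \<Longrightarrow> b = a \<or> b \<prec> a"
    using max_cell by meson
  then obtain x where x: "x \<in> S" "lead X h (g x) a" by blast
  have "y \<prec> a" if "(\<Sum>z\<in>S - {x}. g z) y = 1" for y
  proof -
    have "\<exists>z\<in>S - {x}. g z y = 1" using sum_eq_1D that unfolding sum_fun_apply .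
    then obtain z where z: "z \<in> S" "z \<noteq> x" "g z y = 1" by blast
    then have "g z \<noteq> 0" by auto
    then obtain b where b: "lead X h (g z) b" using chain z lead_exists by blast
    then have "b \<noteq> a" using dist z x by blast
    then have "b \<prec> a" using max b z(1) by blast
    then show ?thesis using b z(3) unfolding lead_def by (blast intro: less_trans)
  qed
  then have "lead X h (g x + (\<Sum>z\<in>S - {x}. g z)) a" using x(2) by (intro lead_add)
  then have "lead X h (sum g S) a" using fin x(1) by (simp add: sum.remove)
  then show ?thesis using x max by blast
qed

text \<open>Gaussian elimination from the top: adding \<open>f b\<close> cancels the lead of
  \<open>c\<close> and leaves a chain with a smaller one.\<close>

lemma basis_expansion:
  assumes f: "\<And>z. z \<in> cells X \<Longrightarrow> chain X (f z) \<and> lead X h (f z) z"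
    and "b \<in> cells X" "chain X c" "lead X h c b"
  shows "\<exists>S\<subseteq>cells X. c = sum f S \<and> b \<in> S \<and> (\<forall>x\<in>S. x = b \<or> x \<prec> b)"
  using assms(2-4)
proof (induction b arbitrary: c rule: cell_induct)
  case (less b)
  let ?d = "c + f b"
  show ?case
  proof (cases "?d = 0")
    case True
    then have "c = sum f {b}" by (simp add: chain_add_eq_0_iff)
    then show ?thesis using less by (intro exI[of _ "{b}"]) simp
  next
    case False
    have "chain X ?d" using less f by (simp add: chain_add)
    then obtain a where a: "a \<in> cells X" "lead X h ?d a" using False lead_exists by blast
    then have "a \<prec> b"
      using less.prems less.hyps f[OF less.hyps] unfolding lead_def
      by (metis bit_add_self bit_not_zero_iff zero_neq_one add.right_neutral bit_not_one_iff plus_fun_apply)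
    then obtain S where S: "S \<subseteq> cells X" "?d = sum f S" "\<forall>x\<in>S. x = a \<or> x \<prec> a"
      using less.IH[OF a(1) _ \<open>chain X ?d\<close> a(2)] by blast
    have "\<forall>x\<in>S. x \<prec> b" using S(3) \<open>a \<prec> b\<close> using less_trans by metis
    moreover have "c = f b + sum f S" unfolding S(2)[symmetric] by simp
    moreover have "finite S" using S(1) finite_cells finite_subset by blast
    ultimately show ?thesis using S(1) less.hyps
      by (intro exI[of _ "insert b S"]) (auto simp: sum.insert_if)
  qed
qed

lemma reduced_basisD:
  assumes "reduced_basis X h f"
  shows "\<And>z. z \<in> cells X \<Longrightarrow> chain X (f z)" "\<And>z. z \<in> cells X \<Longrightarrow> lead X h (f z) z"
    "\<And>y z a. y \<in> cells X \<Longrightarrow> z \<in> cells X \<Longrightarrow> lead X h (bd X (f y)) a \<Longrightarrow>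
       lead X h (bd X (f z)) a \<Longrightarrow> y = z"
  using assms unfolding reduced_basis_def by blast+

lemma reduced_basis_lead_sum:
  assumes f: "reduced_basis X h f" and S: "S \<subseteq> cells X" and nz: "\<exists>x\<in>S. bd X (f x) \<noteq> 0"
  shows "\<exists>x\<in>S. \<exists>a. lead X h (bd X (f x)) a \<and> lead X h (\<Sum>x\<in>S. bd X (f x)) a \<and>
    (\<forall>y\<in>S. \<forall>b. lead X h (bd X (f y)) b \<longrightarrow> b = a \<or> b \<prec> a)"
proof (rule lead_sum)
  show "finite S" using S finite_cells finite_subset by blast
  show "x = y" if "x \<in> S" "y \<in> S" "lead X h (bd X (f x)) a" "lead X h (bd X (f y)) a" for x y a
    using reduced_basisD(3)[OF f] that S by blast
qed (simp, rule nz)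

text \<open>Expanding \<open>c\<close> in the basis involves only elements up to \<open>b\<close>,
  and since the boundaries have distinct leads, one of them supplies the lead of the sum.\<close>

lemma reduced_basis_lead_bd:
  assumes f: "reduced_basis X h f" and b: "b \<in> cells X" "chain X c" "lead X h c b"
    and a: "lead X h (bd X c) a"
  shows "\<exists>x\<in>cells X. lead X h (bd X (f x)) a \<and> (x = b \<or> x \<prec> b)"
proof -
  obtain S where S: "S \<subseteq> cells X" "c = sum f S" "\<forall>x\<in>S. x = b \<or> x \<prec> b"
    using basis_expansion[OF _ b, of f] reduced_basisD[OF f] by blast
  have bd: "bd X c = (\<Sum>x\<in>S. bd X (f x))" by (simp add: S(2) bd_sum)
  have "\<exists>x\<in>S. bd X (f x) \<noteq> 0"
  proof (rule ccontr)
    assume "\<not> ?thesis"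
    then have "(\<Sum>x\<in>S. bd X (f x)) = 0" by (intro sum.neutral) blast
    then show False using lead_not_0[OF a] unfolding bd by blast
  qed
  from reduced_basis_lead_sum[OF f S(1) this]
  obtain x a' where "x \<in> S" "lead X h (bd X (f x)) a'" "lead X h (bd X c) a'"
    unfolding bd by blast
  then show ?thesis using S lead_unique[OF a] by blast
qed

text \<open>Passing from \<open>f\<close> to \<open>g\<close> moves the death cell of
  \<open>a\<close> to some \<open>x\<close> not after \<open>b\<close>, and passing back moves it to
  some \<open>y\<close> not after \<open>x\<close>. Distinct leads in \<open>f\<close> give
  \<open>y = b\<close>, hence \<open>x = b\<close>.\<close>

lemma reduced_basis_unique:
  assumes f: "reduced_basis X h f" and g: "reduced_basis X h g" and b: "b \<in> cells X"
    and a: "lead X h (bd X (f b)) a"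
  shows "lead X h (bd X (g b)) a"
proof -
  obtain x where x: "x \<in> cells X" "lead X h (bd X (g x)) a" "x = b \<or> x \<prec> b"
    using reduced_basis_lead_bd[OF g b _ _ a] reduced_basisD(1,2)[OF f] b by blast
  obtain y where y: "y \<in> cells X" "lead X h (bd X (f y)) a" "y = x \<or> y \<prec> x"
    using reduced_basis_lead_bd[OF f x(1) _ _ x(2)] reduced_basisD(1,2)[OF g] x by blast
  have "y = b" using reduced_basisD(3)[OF f] a b y by blast
  then show ?thesis using x y less_asym by blast
qed

text \<open>The boundary of \<open>f z\<close> is a cycle whose expansion contains
  \<open>f b\<close>. Boundaries with distinct leads can only sum to zero if each of them is
  zero.\<close>

lemma reduced_basis_birth:
  assumes f: "reduced_basis X h f" and z: "z \<in> cells X" and b: "lead X h (bd X (f z)) b"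
  shows "bd X (f b) = 0"
proof (rule ccontr)
  assume nz: "bd X (f b) \<noteq> 0"
  have bX: "b \<in> cells X" using b lead_cells chain_bd by blast
  obtain S where S: "S \<subseteq> cells X" "bd X (f z) = sum f S" "b \<in> S"
    using basis_expansion[OF _ bX chain_bd b, of f] reduced_basisD[OF f] by blast
  have "(\<Sum>x\<in>S. bd X (f x)) = 0" by (simp flip: bd_sum S(2))
  moreover have "\<exists>a. lead X h (\<Sum>x\<in>S. bd X (f x)) a"
    using reduced_basis_lead_sum[OF f S(1)] nz S(3) by blast
  ultimately show False using lead_not_0 by fastforce
qed

end


section \<open>The reduced basis of the lazy reduction\<close>

context morse_complex
begin

lemma enum_less:
  assumes "A \<subseteq> cells X"
  shows "set (enum_by (h_less X h) A) = A" "sorted_wrt (h_less X h) (enum_by (h_less X h) A)"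
    "distinct (enum_by (h_less X h) A)"
proof -
  have tot: "x \<prec> y \<or> y \<prec> x" if "x \<in> A" "y \<in> A" "x \<noteq> y" for x y
    using that assms less_total by blast
  have fin: "finite A" using assms finite_cells finite_subset by blast
  show "set (enum_by (h_less X h) A) = A"
    by (rule enum_by_spec(1)) (fact less_irrefl, fact less_trans, fact tot, fact fin)
  show sorted: "sorted_wrt (h_less X h) (enum_by (h_less X h) A)"
    by (rule enum_by_spec(2)) (fact less_irrefl, fact less_trans, fact tot, fact fin)
  have "xs ! i \<noteq> xs ! j" if "sorted_wrt (h_less X h) xs" "i < j" "j < length xs" for xs i j
    using sorted_wrt_nth_less[OF that] by auto
  from this[OF sorted] show "distinct (enum_by (h_less X h) A)"
    unfolding distinct_conv_nth by (metis nat_neq_iff)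
qed

lemma cells_below_subset: "cells_below X n \<subseteq> cells X"
  and n_cells_subset: "n_cells X n \<subseteq> cells X"
  by (auto simp: cells_below_def n_cells_def)

lemma bd_n_chain:
  assumes "\<And>x. v x = 1 \<Longrightarrow> x \<in> n_cells X n" and "bd X v x = 1"
  shows "x \<in> cells_below X n"
proof -
  obtain y where "v y = 1" "facet X x y" using assms(2) bd_eq_1D by blast
  then show ?thesis
    using assms(1)[of y] facet_cdim[of x y] by (auto simp: cells_below_def n_cells_def facet_def)
qed

lemma D_reduction_inv:
  "lazy_inv (D_rows X h n) (enum_by (h_less X h) (n_cells X n)) (inc X) (h_less X h)
     (length (enum_by (h_less X h) (n_cells X n))) (length (enum_by (h_less X h) (n_cells X n)))
     (fst (D_reduction X h n)) (snd (D_reduction X h n))"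
proof -
  have "case D_reduction X h n of (R, U) \<Rightarrow>
      lazy_inv (D_rows X h n) (enum_by (h_less X h) (n_cells X n)) (inc X) (h_less X h)
     (length (enum_by (h_less X h) (n_cells X n))) (length (enum_by (h_less X h) (n_cells X n))) R U"
    unfolding D_reduction_def
    using enum_less[OF cells_below_subset] enum_less[OF n_cells_subset]
    by (intro lazy_inv_lazy_reduction) (auto simp: D_rows_def intro: less_trans)
  then show ?thesis by (simp add: case_prod_beta)
qed

lemma D_reduction_column:
  assumes y: "y \<in> cells X"
  defines "R \<equiv> fst (D_reduction X h (cdim X y))" and "rs \<equiv> D_rows X h (cdim X y)"
  shows "\<exists>v. chain X v \<and> lead X h v y \<and> (\<forall>x. bd X v x = 1 \<longrightarrow> x \<in> cells_below X (cdim X y)) \<and>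
    (\<forall>x\<in>cells X. bd X v x = R x y)"
proof -
  define cs where "cs = enum_by (h_less X h) (n_cells X (cdim X y))"
  note cs = enum_less[OF n_cells_subset, of "cdim X y", folded cs_def]
  have "y \<in> set cs" using y cs(1) by (simp add: n_cells_def)
  then obtain m where m: "m < length cs" "y = cs ! m" by (auto simp: in_set_conv_nth)
  have "lazy_basis cs (inc X) R"
    using D_reduction_inv[of "cdim X y"] unfolding lazy_inv_def cs_def R_def by blast
  then obtain v where v: "v y = 1" "\<And>x. v x = 1 \<Longrightarrow> x \<in> set (take (Suc m) cs)"
      "\<And>i. R i y = (\<Sum>x\<in>set cs. inc X i x * v x)"
    using m unfolding lazy_basis_def by blast
  have supp: "v x = 1 \<Longrightarrow> x \<in> n_cells X (cdim X y)" for x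
    using v(2)[of x] cs(1) set_take_subset[of "Suc m" cs] by blast
  have "x = y \<or> x \<prec> y" if "v x = 1" for x
  proof -
    have "x \<in> set (take (Suc m) cs)" using v(2) that by blast
    then obtain k where "k < Suc m" "k < length cs" "x = cs ! k"
      using m(1) by (auto simp: in_set_conv_nth)
    then show ?thesis using sorted_wrt_nth_less[OF cs(2), of k m] m by (cases "k = m") auto
  qed
  then have "lead X h v y" using v(1) by (simp add: lead_def)
  moreover have "chain X v" using supp n_cells_subset by (auto simp: chain_def)
  moreover have "bd X v x = R x y" if "x \<in> cells X" for x
  proof -
    have "(\<Sum>z\<in>cells X. inc X x z * v z) = (\<Sum>z\<in>set cs. inc X x z * v z)"
      using supp cs(1) n_cells_subset finite_cells
      by (intro sum.mono_neutral_right) (auto simp: n_cells_def)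
    then show ?thesis using that v(3) by (simp add: bd_def)
  qed
  ultimately show ?thesis using bd_n_chain[OF supp] by blast
qed

text \<open>Plays the role of column \<open>y\<close> of the inverse of \<open>U\<close>; it is
  chosen because the loop invariant asserts existence only.\<close>

definition R_basis :: "'a \<Rightarrow> 'a \<Rightarrow> bit" where
  "R_basis y = (SOME v. chain X v \<and> lead X h v y \<and>
    (\<forall>x. bd X v x = 1 \<longrightarrow> x \<in> cells_below X (cdim X y)) \<and>
    (\<forall>x\<in>cells X. bd X v x = fst (D_reduction X h (cdim X y)) x y))"

lemma R_basis:
  assumes "y \<in> cells X"
  shows "chain X (R_basis y)" "lead X h (R_basis y) y"
    "\<And>x. bd X (R_basis y) x = 1 \<Longrightarrow> x \<in> cells_below X (cdim X y)"
    "\<And>x. x \<in> cells X \<Longrightarrow> bd X (R_basis y) x = fst (D_reduction X h (cdim X y)) x y"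
  using someI_ex[OF D_reduction_column[OF assms]] unfolding R_basis_def by blast+

lemma R_basis_low:
  assumes y: "y \<in> cells X"
  defines "R \<equiv> fst (D_reduction X h (cdim X y))" and "rs \<equiv> D_rows X h (cdim X y)"
  shows "col_nonzero rs R y \<longleftrightarrow> bd X (R_basis y) \<noteq> 0"
    and "lead X h (bd X (R_basis y)) a \<longleftrightarrow> col_nonzero rs R y \<and> low rs R y = a"
proof -
  have rs: "set rs = cells_below X (cdim X y)" "sorted_wrt (h_less X h) rs"
    using enum_less[OF cells_below_subset] by (auto simp: rs_def D_rows_def)
  note b = R_basis[OF y, folded R_def]
  show nz: "col_nonzero rs R y \<longleftrightarrow> bd X (R_basis y) \<noteq> 0"
  proof
    assume "col_nonzero rs R y"
    then obtain x where "x \<in> cells_below X (cdim X y)" "R x y = 1"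
      unfolding col_nonzero_def rs(1) by auto
    then have "bd X (R_basis y) x = 1" using b(4)[of x] subsetD[OF cells_below_subset] by auto
    then show "bd X (R_basis y) \<noteq> 0" by auto
  next
    assume "bd X (R_basis y) \<noteq> 0"
    then obtain x where "bd X (R_basis y) x = 1" by (auto simp: fun_eq_iff)
    then have "x \<in> set rs" "R x y = 1" using b(3,4)[of x] subsetD[OF cells_below_subset] rs(1) by auto
    then show "col_nonzero rs R y" unfolding col_nonzero_def by auto
  qed
  have l: "lead X h (bd X (R_basis y)) (low rs R y)" if c: "col_nonzero rs R y"
    unfolding lead_def
  proof (intro conjI allI impI)
    show "bd X (R_basis y) (low rs R y) = 1"
      using low_spec(1,2)[OF rs(2) c] b(4)[of "low rs R y"]
      unfolding rs(1) using cells_below_subset by auto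
    fix x assume x: "bd X (R_basis y) x = 1"
    then have "x \<in> set rs" "R x y = 1" using b(3,4)[of x] subsetD[OF cells_below_subset] rs(1) by auto
    then show "x = low rs R y \<or> x \<prec> low rs R y" using low_spec(3)[OF rs(2) c] by blast
  qed
  show "lead X h (bd X (R_basis y)) a \<longleftrightarrow> col_nonzero rs R y \<and> low rs R y = a"
    using l nz lead_unique[of X h "bd X (R_basis y)"] lead_not_0[of "bd X (R_basis y)" a] by metis
qed

lemma reduced_basis_R_basis: "reduced_basis X h R_basis"
  unfolding reduced_basis_def
proof (intro conjI ballI allI impI)
  fix y z a
  assume yz: "y \<in> cells X" "z \<in> cells X"
    and ly: "lead X h (bd X (R_basis y)) a" and lz: "lead X h (bd X (R_basis z)) a"
  \<comment> \<open>A common lead forces equal dimensions, so both cells are columns of the same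
    matrix.\<close>
  have "a \<in> cells_below X (cdim X y)" "a \<in> cells_below X (cdim X z)"
    using R_basis(3)[OF yz(1)] R_basis(3)[OF yz(2)] ly lz unfolding lead_def by blast+
  then have n: "cdim X z = cdim X y" by (auto simp: cells_below_def)
  define cs where "cs = enum_by (h_less X h) (n_cells X (cdim X y))"
  define R where "R = fst (D_reduction X h (cdim X y))"
  define rs where "rs = D_rows X h (cdim X y)"
  have "y \<in> set cs" "z \<in> set cs"
    using yz n enum_less(1)[OF n_cells_subset] by (auto simp: cs_def n_cells_def)
  then obtain p q where p: "p < length cs" "y = cs ! p" and q: "q < length cs" "z = cs ! q"
    by (auto simp: in_set_conv_nth)
  have low: "col_nonzero rs R y" "col_nonzero rs R z" "low rs R y = low rs R z"
    using ly lz R_basis_low(2)[OF yz(1)] R_basis_low(2)[OF yz(2)] unfolding n R_def rs_def by auto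
  have "distinct_lows rs cs (length cs) R"
    using D_reduction_inv[of "cdim X y"] unfolding lazy_inv_def cs_def R_def rs_def by blast
  then have "\<not> p < q" "\<not> q < p"
    using low p q unfolding distinct_lows_def by metis+
  then show "y = z" using p q by simp
qed (use R_basis in auto)

lemma paired_iff_R_basis:
  "paired X h a b \<longleftrightarrow> a \<in> cells X \<and> b \<in> cells X \<and> lead X h (bd X (R_basis b)) a"
proof
  assume p: "paired X h a b"
  then have "b \<in> cells X" "cdim X b = cdim X a + 1" by (auto simp: paired_def n_cells_def)
  then show "a \<in> cells X \<and> b \<in> cells X \<and> lead X h (bd X (R_basis b)) a"
    using p R_basis_low(2)[of b a] by (auto simp: paired_def Let_def)
next
  assume p: "a \<in> cells X \<and> b \<in> cells X \<and> lead X h (bd X (R_basis b)) a"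
  then have "a \<in> cells_below X (cdim X b)" using R_basis(3)[of b a] by (auto simp: lead_def)
  then show "paired X h a b" using p R_basis_low(2)[of b a]
    by (auto simp: paired_def Let_def n_cells_def cells_below_def)
qed

lemma paired_iff_reduced_basis:
  assumes f: "reduced_basis X h f"
  shows "paired X h a b \<longleftrightarrow> b \<in> cells X \<and> lead X h (bd X (f b)) a"
  using reduced_basis_unique[OF f reduced_basis_R_basis, of b a]
    reduced_basis_unique[OF reduced_basis_R_basis f, of b a] lead_cells[OF chain_bd, of "f b" a]
  unfolding paired_iff_R_basis by blast

text \<open>The content of \<open>lazy_ops\<close> in terms of cells: related cells are death cells
  that come earlier and have a later birth cell.\<close>

lemma hom_rel_less:
  assumes "hom_rel X h x y"
  shows "x \<prec> y" "bd X (R_basis x) \<noteq> 0"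
    "\<And>a a'. lead X h (bd X (R_basis x)) a \<Longrightarrow> lead X h (bd X (R_basis y)) a' \<Longrightarrow> a' \<prec> a"
proof -
  have xy: "x \<in> cells X" "y \<in> cells X" "cdim X x = cdim X y" "x \<noteq> y"
      "snd (D_reduction X h (cdim X y)) x y = 1"
    using assms unfolding hom_rel_def by blast+
  define cs where "cs = enum_by (h_less X h) (n_cells X (cdim X y))"
  define R where "R = fst (D_reduction X h (cdim X y))"
  define rs where "rs = D_rows X h (cdim X y)"
  have "lazy_ops rs cs (h_less X h) (length cs) R (snd (D_reduction X h (cdim X y)))"
    using D_reduction_inv[of "cdim X y"] unfolding lazy_inv_def cs_def R_def rs_def by blast
  note ops = this[unfolded lazy_ops_def, THEN spec, THEN spec, THEN mp, THEN mp, OF xy(5,4)]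
  then obtain m n where mn: "m < n" "n < length cs" "x = cs ! m" "y = cs ! n" by blast
  have c: "col_nonzero rs R x" by (rule ops[THEN conjunct2, THEN conjunct1])
  have c': "low rs R y \<prec> low rs R x" if "col_nonzero rs R y"
    by (rule ops[THEN conjunct2, THEN conjunct2, THEN mp, OF that])
  have "sorted_wrt (h_less X h) cs" using enum_less(2)[OF n_cells_subset] by (simp add: cs_def)
  then have "cs ! m \<prec> cs ! n" by (rule sorted_wrt_nth_less[OF _ mn(1,2)])
  then show "x \<prec> y" by (subst mn(3), subst mn(4))
  show "bd X (R_basis x) \<noteq> 0"
    using R_basis_low(1)[OF xy(1)] c by (simp add: xy(3) R_def rs_def)
  show "a' \<prec> a" if "lead X h (bd X (R_basis x)) a" "lead X h (bd X (R_basis y)) a'" for a a'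
    using that R_basis_low(2)[OF xy(1)] R_basis_low(2)[OF xy(2)] c'
    by (simp add: xy(3) R_def rs_def)
qed

text \<open>This is column \<open>y\<close> of \<open>D = R U\<close>, the place where the
  homological relation becomes an identity between boundaries.\<close>

lemma bd_single_R_basis:
  assumes y: "y \<in> cells X"
  shows "bd X (single y) = (\<Sum>x\<in>{x \<in> cells X. x = y \<or> hom_rel X h x y}. bd X (R_basis x))"
proof
  fix i
  let ?B = "{x \<in> cells X. x = y \<or> hom_rel X h x y}"
  define cs where "cs = enum_by (h_less X h) (n_cells X (cdim X y))"
  define R where "R = fst (D_reduction X h (cdim X y))"
  define U where "U = snd (D_reduction X h (cdim X y))"
  have cs: "set cs = n_cells X (cdim X y)" using enum_less(1)[OF n_cells_subset] by (simp add: cs_def)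
  have inv: "lazy_inv (D_rows X h (cdim X y)) cs (inc X) (h_less X h) (length cs) (length cs) R U"
    using D_reduction_inv[of "cdim X y"] by (simp add: cs_def R_def U_def)
  have "y \<in> set cs" using y by (simp add: cs n_cells_def)
  then have eq: "inc X i y = (\<Sum>x\<in>set cs. R i x * U x y)" and diag: "U y y = 1"
    using inv unfolding lazy_inv_def by blast+
  have U: "U x y = 1 \<longleftrightarrow> x = y \<or> hom_rel X h x y" if "x \<in> set cs" for x
    using that y diag by (auto simp: cs n_cells_def hom_rel_def U_def)
  show "bd X (single y) i = (\<Sum>x\<in>?B. bd X (R_basis x)) i"
  proof (cases "i \<in> cells X")
    case False
    then show ?thesis by (simp add: bd_def sum_fun_apply)
  next
    case True
    have "(\<Sum>x\<in>set cs. R i x * U x y) = (\<Sum>x\<in>{x \<in> set cs. U x y = 1}. R i x * U x y)"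
      by (intro sum.mono_neutral_right) auto
    also have "{x \<in> set cs. U x y = 1} = ?B"
      using U y by (auto simp: cs n_cells_def hom_rel_def)
    also have "(\<Sum>x\<in>?B. R i x * U x y) = (\<Sum>x\<in>?B. bd X (R_basis x) i)"
    proof (rule sum.cong[OF refl])
      fix x assume x: "x \<in> ?B"
      then have "cdim X x = cdim X y" "x \<in> set cs" by (auto simp: hom_rel_def cs n_cells_def)
      then show "R i x * U x y = bd X (R_basis x) i"
        using x R_basis(4)[of x i] True U[of x] by (auto simp: R_def)
    qed
    finally show ?thesis using eq y True by (simp add: bd_single sum_fun_apply)
  qed
qed

end


section \<open>Duality\<close>

text \<open>\<open>N\<close> is meant to bound all dimensions, so that truncated subtraction
  reverses them faithfully on cells.\<close>

definition dual :: "nat \<Rightarrow> 'a cell_data \<Rightarrow> 'a cell_data" where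
  "dual N X = \<lparr>cells = cells X, cdim = (\<lambda>x. N - cdim X x), inc = (\<lambda>y x. inc X x y)\<rparr>"

lemma dual_simps [simp]:
  "cells (dual N X) = cells X" "cdim (dual N X) x = N - cdim X x" "inc (dual N X) y x = inc X x y"
  by (simp_all add: dual_def)

lemma facet_dual: "facet (dual N X) y x \<longleftrightarrow> facet X x y"
  by (auto simp: facet_def)

lemma chain_dual [simp]: "chain (dual N X) = chain X"
  by (simp add: chain_def fun_eq_iff)

definition pairing :: "'a cell_data \<Rightarrow> ('a \<Rightarrow> bit) \<Rightarrow> ('a \<Rightarrow> bit) \<Rightarrow> bit" where
  "pairing X w c = (\<Sum>x\<in>cells X. w x * c x)"

lemma pairing_bd: "pairing X w (bd X c) = pairing X (bd (dual N X) w) c"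
proof -
  have "pairing X w (bd X c) = (\<Sum>x\<in>cells X. \<Sum>y\<in>cells X. w x * (inc X x y * c y))"
    by (simp add: pairing_def bd_def sum_distrib_left)
  also have "\<dots> = (\<Sum>y\<in>cells X. \<Sum>x\<in>cells X. w x * (inc X x y * c y))"
    by (rule sum.swap)
  also have "\<dots> = pairing X (bd (dual N X) w) c"
    by (simp add: pairing_def bd_def sum_distrib_right sum_distrib_left mult_ac)
  finally show ?thesis .
qed

lemma pairing_eq_1D: "pairing X w c = 1 \<Longrightarrow> \<exists>x\<in>cells X. w x = 1 \<and> c x = 1"
  unfolding pairing_def by (drule sum_eq_1D) (metis bit_not_one_iff mult_zero_left mult_zero_right)

lemma pairing_sum_left: "pairing X (sum w I) c = (\<Sum>i\<in>I. pairing X (w i) c)"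
  by (simp add: pairing_def sum_fun_apply sum_distrib_right) (rule sum.swap)

lemma pairing_0_left [simp]: "pairing X 0 c = 0"
  by (simp add: pairing_def)

context morse_complex
begin

lemma pairing_single: "a \<in> cells X \<Longrightarrow> pairing X (single a) c = c a"
  using finite_cells
  by (simp add: pairing_def single_def if_distrib[of "\<lambda>x. x * _"] sum.delta cong: if_cong)

lemma morse_complex_dual:
  assumes N: "\<And>x. x \<in> cells X \<Longrightarrow> cdim X x \<le> N"
  shows "morse_complex (dual N X) (\<lambda>x. - h x)"
proof unfold_locales
  show "finite (cells (dual N X))" using finite_cells by simp
  fix x y assume xy: "x \<in> cells (dual N X)" "y \<in> cells (dual N X)"
  show "cdim (dual N X) x + 1 = cdim (dual N X) y" if "inc (dual N X) x y \<noteq> 0"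
    using inc_dim[of y x] N[of x] xy that by simp
  show "(\<Sum>z\<in>cells (dual N X). inc (dual N X) x z * inc (dual N X) z y) = 0"
    using inc_inc[of y x] xy by (simp add: mult.commute)
next
  have "card {x \<in> cells X. - h x = a} \<le> 2" for a
  proof -
    have "{x \<in> cells X. - h x = a} = {x \<in> cells X. h x = - a}" by auto
    then show ?thesis using morse unfolding discrete_morse_def by simp
  qed
  then show "discrete_morse (dual N X) (\<lambda>x. - h x)"
    using morse unfolding discrete_morse_def by auto
qed

lemma h_less_dual:
  assumes "\<And>x. x \<in> cells X \<Longrightarrow> cdim X x \<le> N" "x \<in> cells X" "y \<in> cells X"
  shows "h_less (dual N X) (\<lambda>x. - h x) x y \<longleftrightarrow> y \<prec> x"
  using assms(1)[OF assms(2)] assms(1)[OF assms(3)] unfolding h_less_def by auto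

text \<open>Both sides run the same algorithm on the same matrix with the same row and column lists.
  For \<open>n = N\<close> there are no rows on either side.\<close>

lemma Dperp_reduction_dual:
  assumes N: "\<And>x. x \<in> cells X \<Longrightarrow> cdim X x \<le> N" and n: "n \<le> N"
  shows "Dperp_reduction X h n = D_reduction (dual N X) (\<lambda>x. - h x) (N - n)"
proof -
  have N': "cdim X x \<le> N" if "x \<in> cells X" for x using N that .
  have cols: "n_cells (dual N X) (N - n) = n_cells X n"
    using N n by (auto simp: n_cells_def) (metis diff_diff_cancel)
  have rows: "cells_below (dual N X) (N - n) = n_cells X (n + 1)"
    using N n by (fastforce simp: n_cells_def cells_below_def)
  \<comment> \<open>The two orders agree on cells only, which suffices for the enumeration of a set
    of cells.\<close>
  have enum: "enum_by (h_less (dual N X) (\<lambda>x. - h x)) A = enum_by (\<lambda>x y. h_less X h y x) A"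
    if "A \<subseteq> cells X" for A
    using h_less_dual[OF N'] that by (intro enum_by_cong) auto
  have "inc (dual N X) = (\<lambda>y x. inc X x y)" by (simp add: fun_eq_iff)
  then show ?thesis
    unfolding Dperp_reduction_def D_reduction_def D_rows_def cols rows
    by (simp add: enum[OF n_cells_subset])
qed

lemma cohom_rel_dual:
  assumes N: "\<And>x. x \<in> cells X \<Longrightarrow> cdim X x \<le> N"
  shows "cohom_rel X h x y \<longleftrightarrow> hom_rel (dual N X) (\<lambda>x. - h x) x y"
proof (cases "x \<in> cells X \<and> y \<in> cells X")
  case True
  then have "cdim X x \<le> N" "cdim X y \<le> N" using N by auto
  then have "N - cdim X x = N - cdim X y \<longleftrightarrow> cdim X x = cdim X y" by auto
  then show ?thesis
    using Dperp_reduction_dual[OF N \<open>cdim X y \<le> N\<close>] unfolding cohom_rel_def hom_rel_def by simp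
qed (auto simp: cohom_rel_def hom_rel_def)

section \<open>Self-duality of the pairing\<close>

context
  fixes N assumes N: "\<And>x. x \<in> cells X \<Longrightarrow> cdim X x \<le> N"
begin

interpretation d: morse_complex "dual N X" "\<lambda>x. - h x"
  using N by (rule morse_complex_dual)

lemma lead_dual:
  assumes "chain X w"
  shows "lead (dual N X) (\<lambda>x. - h x) w a \<longleftrightarrow> w a = 1 \<and> (\<forall>x. w x = 1 \<longrightarrow> x = a \<or> a \<prec> x)"
proof -
  have "h_less (dual N X) (\<lambda>x. - h x) x a \<longleftrightarrow> a \<prec> x" if "w x = 1" "w a = 1" for x
    using h_less_dual[OF N, of x a] that assms unfolding chain_def by blast
  then show ?thesis unfolding lead_def by blast
qed

text \<open>\<open>a\<close> is the smallest cell of \<open>w\<close> and the largest cell of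
  \<open>c\<close>, so the supports meet in \<open>a\<close> alone.\<close>

lemma pairing_lead:
  assumes "chain X w" "lead (dual N X) (\<lambda>x. - h x) w a" "chain X c" "lead X h c a"
  shows "pairing X w c = 1"
proof -
  have w: "w a = 1" "\<And>x. w x = 1 \<Longrightarrow> x = a \<or> a \<prec> x" using assms(1,2) lead_dual by auto
  have c: "c a = 1" "\<And>x. c x = 1 \<Longrightarrow> x = a \<or> x \<prec> a" using assms(4) unfolding lead_def by auto
  have "w x * c x = 0" if "x \<noteq> a" for x
  proof (rule ccontr)
    assume "w x * c x \<noteq> 0"
    then have "w x = 1" "c x = 1" by (cases "w x"; cases "c x"; simp)+
    then show False using w(2)[of x] c(2)[of x] that less_asym by blast
  qed
  then have "pairing X w c = (\<Sum>x\<in>{a}. w x * c x)"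
    unfolding pairing_def using finite_cells lead_cells[OF assms(3,4)]
    by (intro sum.mono_neutral_right) auto
  then show ?thesis using w c by simp
qed

lemma dual_death_le:
  assumes b: "b \<in> cells X" and a: "lead X h (bd X (R_basis b)) a"
  shows "\<exists>y. lead (dual N X) (\<lambda>x. - h x) (bd (dual N X) (d.R_basis a)) y"
proof -
  have aX: "a \<in> cells X" using a lead_cells chain_bd by blast
  have "pairing X (d.R_basis a) (bd X (R_basis b)) = 1"
    using d.R_basis(1,2)[of a] aX a by (intro pairing_lead) auto
  then have "pairing X (bd (dual N X) (d.R_basis a)) (R_basis b) = 1"
    by (simp add: pairing_bd[of _ _ _ N])
  then have "bd (dual N X) (d.R_basis a) \<noteq> 0" by auto
  then show ?thesis using d.lead_exists chain_bd by blast
qed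

text \<open>By adjointness the dual basis cochain of \<open>a\<close> is nonzero on the boundary of
  \<open>R_basis y\<close>. All cells of the former are at least \<open>a\<close>, all cells of the
  latter at most its lead \<open>z\<close>.\<close>

lemma birth_ge:
  assumes a: "a \<in> cells X"
    and y: "lead (dual N X) (\<lambda>x. - h x) (bd (dual N X) (d.R_basis a)) y"
  shows "\<exists>z. lead X h (bd X (R_basis y)) z \<and> (z = a \<or> a \<prec> z)"
proof -
  have yX: "y \<in> cells X" using d.lead_cells[OF chain_bd y] by simp
  have "pairing X (bd (dual N X) (d.R_basis a)) (R_basis y) = 1"
    using R_basis(1,2)[OF yX] y chain_bd[of "dual N X"] by (intro pairing_lead) auto
  then have "pairing X (d.R_basis a) (bd X (R_basis y)) = 1" by (simp add: pairing_bd[of _ _ _ N])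
  then obtain x where x: "d.R_basis a x = 1" "bd X (R_basis y) x = 1"
    by (blast dest: pairing_eq_1D)
  then have "bd X (R_basis y) \<noteq> 0" by auto
  then obtain z where z: "lead X h (bd X (R_basis y)) z" using lead_exists chain_bd by blast
  moreover have "x = a \<or> a \<prec> x" using d.R_basis(1,2)[of a] a x lead_dual by auto
  moreover have "x = z \<or> x \<prec> z" using z x by (auto simp: lead_def)
  ultimately show ?thesis using less_trans by metis
qed

text \<open>Induction on \<open>a\<close> downwards in the order of \<open>h\<close>: some
  \<open>y\<close> is dually paired with \<open>a\<close>, and its birth cell \<open>z\<close> is at
  least \<open>a\<close>. A larger \<open>z\<close> would already be dually paired with the same
  \<open>y\<close>.\<close>

lemma lead_bd_dual:
  assumes "a \<in> cells X" "b \<in> cells X" "lead X h (bd X (R_basis b)) a"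
  shows "lead (dual N X) (\<lambda>x. - h x) (bd (dual N X) (d.R_basis a)) b"
proof -
  have "a \<in> cells (dual N X)" using assms by simp
  then show ?thesis using assms(2,3)
  proof (induction a arbitrary: b rule: d.cell_induct)
    case (less a)
    then have a: "a \<in> cells X" by simp
    obtain y where y: "lead (dual N X) (\<lambda>x. - h x) (bd (dual N X) (d.R_basis a)) y"
      using dual_death_le less.prems by blast
    then obtain z where z: "lead X h (bd X (R_basis y)) z" "z = a \<or> a \<prec> z"
      using birth_ge a by blast
    have yX: "y \<in> cells X" using d.lead_cells[OF chain_bd y] by simp
    have zX: "z \<in> cells X" using z(1) lead_cells chain_bd by blast
    have "z = a"
    proof (rule ccontr)
      assume "z \<noteq> a"
      then have "h_less (dual N X) (\<lambda>x. - h x) z a" using z(2) h_less_dual[OF N zX a] by blast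
      then have "lead (dual N X) (\<lambda>x. - h x) (bd (dual N X) (d.R_basis z)) y"
        using less.IH[of z y] zX yX z(1) by simp
      then show False
        using d.reduced_basisD(3)[OF d.reduced_basis_R_basis, of a z y] y a zX \<open>z \<noteq> a\<close> by simp
    qed
    then have "y = b"
      using reduced_basisD(3)[OF reduced_basis_R_basis, of y b a] z(1) yX less.prems by simp
    then show ?case using y by simp
  qed
qed

lemma paired_dual: "paired (dual N X) (\<lambda>x. - h x) b a \<longleftrightarrow> paired X h a b"
proof
  assume "paired X h a b"
  then show "paired (dual N X) (\<lambda>x. - h x) b a"
    using lead_bd_dual unfolding paired_iff_R_basis d.paired_iff_R_basis by simp
next
  assume "paired (dual N X) (\<lambda>x. - h x) b a"
  then have ab: "a \<in> cells X" "b \<in> cells X"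
    and l: "lead (dual N X) (\<lambda>x. - h x) (bd (dual N X) (d.R_basis a)) b"
    unfolding d.paired_iff_R_basis by auto
  obtain z where z: "lead X h (bd X (R_basis b)) z" using birth_ge[OF ab(1) l] by blast
  have zX: "z \<in> cells X" using z lead_cells chain_bd by blast
  then have "z = a"
    using d.reduced_basisD(3)[OF d.reduced_basis_R_basis, of z a b] lead_bd_dual[OF zX ab(2) z] l ab
    by simp
  then show "paired X h a b" using z ab unfolding paired_iff_R_basis by simp
qed

end

end


section \<open>Gradient-invariant chains\<close>

definition vec :: "'a cell_data \<Rightarrow> ('a \<Rightarrow> real) \<Rightarrow> 'a \<Rightarrow> 'a \<Rightarrow> bool" where
  "vec X h t s \<longleftrightarrow> facet X t s \<and> h t = h s"

definition tails :: "'a cell_data \<Rightarrow> ('a \<Rightarrow> real) \<Rightarrow> 'a set" where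
  "tails X h = {t. \<exists>s. vec X h t s}"

definition heads :: "'a cell_data \<Rightarrow> ('a \<Rightarrow> real) \<Rightarrow> 'a set" where
  "heads X h = {s. \<exists>t. vec X h t s}"

definition critical :: "'a cell_data \<Rightarrow> ('a \<Rightarrow> real) \<Rightarrow> 'a set" where
  "critical X h = cells X - tails X h - heads X h"

definition no_tails :: "'a cell_data \<Rightarrow> ('a \<Rightarrow> real) \<Rightarrow> ('a \<Rightarrow> bit) \<Rightarrow> bool" where
  "no_tails X h c \<longleftrightarrow> (\<forall>t\<in>tails X h. c t = 0)"

definition head_chain :: "'a cell_data \<Rightarrow> ('a \<Rightarrow> real) \<Rightarrow> ('a \<Rightarrow> bit) \<Rightarrow> bool" where
  "head_chain X h q \<longleftrightarrow> (\<forall>x. q x = 1 \<longrightarrow> x \<in> heads X h)"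

definition invariant :: "'a cell_data \<Rightarrow> ('a \<Rightarrow> real) \<Rightarrow> ('a \<Rightarrow> bit) \<Rightarrow> bool" where
  "invariant X h c \<longleftrightarrow> chain X c \<and> no_tails X h c \<and> no_tails X h (bd X c)"

text \<open>The unique chain of heads whose boundary agrees with \<open>c\<close> on all
  tails.\<close>

definition tail_lift :: "'a cell_data \<Rightarrow> ('a \<Rightarrow> real) \<Rightarrow> ('a \<Rightarrow> bit) \<Rightarrow> 'a \<Rightarrow> bit" where
  "tail_lift X h c = (SOME q. head_chain X h q \<and> no_tails X h (c + bd X q))"

text \<open>The identity plus \<open>bd T + T bd\<close> for the homotopy \<open>T\<close> given by
  \<open>tail_lift\<close>. This plays the role of the stabilised gradient flow of discrete Morse
  theory, without iterating a flow.\<close>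

definition stab :: "'a cell_data \<Rightarrow> ('a \<Rightarrow> real) \<Rightarrow> ('a \<Rightarrow> bit) \<Rightarrow> 'a \<Rightarrow> bit" where
  "stab X h c = c + bd X (tail_lift X h c) + tail_lift X h (bd X c)"

lemma vec_cells: "vec X h t s \<Longrightarrow> t \<in> cells X \<and> s \<in> cells X"
  by (simp add: vec_def facet_def)

lemma no_tails_0 [simp]: "no_tails X h 0"
  by (simp add: no_tails_def)

lemma no_tails_add: "no_tails X h c \<Longrightarrow> no_tails X h d \<Longrightarrow> no_tails X h (c + d)"
  by (simp add: no_tails_def)

lemma invariant_0 [simp]: "invariant X h 0"
  by (simp add: invariant_def)

lemma invariant_add: "invariant X h c \<Longrightarrow> invariant X h d \<Longrightarrow> invariant X h (c + d)"
  by (simp add: invariant_def chain_add no_tails_add bd_add)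

lemma invariant_sum: "(\<And>i. i \<in> I \<Longrightarrow> invariant X h (f i)) \<Longrightarrow> invariant X h (sum f I)"
  by (induction I rule: infinite_finite_induct) (auto intro: invariant_add)

context morse_complex
begin

lemma fibre:
  assumes "x \<in> cells X" "y \<in> cells X" "z \<in> cells X" "h x = h y" "h y = h z"
  shows "x = y \<or> y = z \<or> x = z"
proof (rule ccontr)
  assume "\<not> ?thesis"
  then have "card {x, y, z} = 3" by auto
  moreover have "card {x, y, z} \<le> card {w \<in> cells X. h w = h y}"
    using assms finite_cells by (intro card_mono) auto
  moreover have "card {w \<in> cells X. h w = h y} \<le> 2"
    using morse unfolding discrete_morse_def by blast
  ultimately show False by simp
qed

lemma facet_irrefl [simp]: "\<not> facet X x x"
  using facet_cdim[of x x] by auto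

lemma vec_unique_head: "vec X h t s \<Longrightarrow> vec X h t s' \<Longrightarrow> s = s'"
  using fibre[of t s s'] vec_cells unfolding vec_def by fastforce

lemma vec_unique_tail: "vec X h t s \<Longrightarrow> vec X h t' s \<Longrightarrow> t = t'"
  using fibre[of t t' s] vec_cells unfolding vec_def by fastforce

text \<open>Otherwise three cells of consecutive dimensions would share one fibre.\<close>

lemma tails_heads_disjoint: "t \<in> tails X h \<Longrightarrow> t \<notin> heads X h"
proof
  assume "t \<in> tails X h" "t \<in> heads X h"
  then obtain s r where sr: "vec X h t s" "vec X h r t" unfolding tails_def heads_def by blast
  then have "r = t \<or> t = s \<or> r = s" by (intro fibre) (auto simp: vec_def facet_def)
  moreover have "cdim X s = cdim X t + 1" "cdim X t = cdim X r + 1"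
    using sr facet_cdim unfolding vec_def by blast+
  ultimately show False by auto
qed

lemma vec_same: "vec X h t s \<Longrightarrow> x \<in> cells X \<Longrightarrow> h x = h s \<Longrightarrow> x = t \<or> x = s"
  using fibre[of x t s] vec_cells[of X h t s] unfolding vec_def by fastforce

lemma facet_not_vec: "facet X x y \<Longrightarrow> \<not> vec X h x y \<Longrightarrow> h x < h y"
  using facet_mono[of x y] unfolding vec_def by auto

lemma critical_neq:
  assumes "z \<in> critical X h" "x \<in> cells X" "x \<noteq> z"
  shows "h x \<noteq> h z"
proof
  assume "h x = h z"
  then have "vec X h x z \<or> vec X h z x"
    using eq_facet[of x z] assms by (auto simp: critical_def vec_def)
  then show False using assms by (auto simp: critical_def tails_def heads_def)
qed

lemma less_critical: "z \<in> critical X h \<Longrightarrow> x \<in> cells X \<Longrightarrow> x \<prec> z \<Longrightarrow> h x < h z"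
  using critical_neq[of z x] by (auto simp: h_less_def)

lemma head_chain_chain: "head_chain X h q \<Longrightarrow> chain X q"
  using vec_cells by (fastforce simp: head_chain_def chain_def heads_def)

lemma head_chain_add: "head_chain X h p \<Longrightarrow> head_chain X h q \<Longrightarrow> head_chain X h (p + q)"
  by (auto simp: head_chain_def dest: bit_add_eq_1D)

lemma head_chain_no_tails: "head_chain X h q \<Longrightarrow> no_tails X h q"
  using tails_heads_disjoint by (fastforce simp: head_chain_def no_tails_def)

lemma tails_finite: "finite (tails X h)" and heads_finite: "finite (heads X h)"
  using vec_cells by (fastforce simp: tails_def heads_def intro: finite_subset[OF _ finite_cells])+

text \<open>Another cell \<open>y\<close> of \<open>q\<close> with facet \<open>t\<close> would
  satisfy \<open>h t \<le> h y \<le> h s = h t\<close>, but the fibre is \<open>{t, s}\<close>.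
  Hence the tail of the top head does not cancel.\<close>

lemma bd_lead_head:
  assumes "vec X h t s" "lead X h q s" "chain X q"
  shows "bd X q t = 1"
proof -
  have ts: "t \<in> cells X" "s \<in> cells X" "facet X t s" "h t = h s"
    using assms(1) by (auto simp: vec_def facet_def)
  have "inc X t y * q y = 0" if "y \<in> cells X" "y \<noteq> s" for y
  proof (rule ccontr)
    assume "inc X t y * q y \<noteq> 0"
    then have "inc X t y = 1" and q: "q y = 1" by (cases "inc X t y"; cases "q y"; simp)+
    then have f: "facet X t y" using that ts by (simp add: facet_def)
    moreover have "y \<prec> s" using assms(2) q that unfolding lead_def by blast
    ultimately have "h y = h s" using facet_mono[of t y] ts by (auto simp: h_less_def)
    then have "y = t" using vec_same assms(1) that by blast
    then show False using f by simp
  qed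
  then have "(\<Sum>y\<in>cells X. inc X t y * q y) = (\<Sum>y\<in>{s}. inc X t y * q y)"
    using ts finite_cells by (intro sum.mono_neutral_right) auto
  then show ?thesis using ts assms(2) by (simp add: bd_def facet_def lead_def)
qed

text \<open>Shows that a chain of heads without tails in its boundary is zero: the incidence matrix
  of heads against tails is unitriangular.\<close>

lemma head_chain_top:
  assumes "head_chain X h q" "q \<noteq> 0"
  shows "\<exists>t s. vec X h t s \<and> bd X q t = 1 \<and> (\<forall>x. q x = 1 \<longrightarrow> h x \<le> h s)"
proof -
  note q = head_chain_chain[OF assms(1)]
  obtain s where s: "lead X h q s" using lead_exists[OF q assms(2)] by blast
  then obtain t where t: "vec X h t s"
    using assms(1) unfolding head_chain_def heads_def lead_def by blast
  have "\<forall>x. q x = 1 \<longrightarrow> h x \<le> h s" using s by (auto simp: lead_def h_less_def)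
  then show ?thesis using bd_lead_head[OF t s q] t by blast
qed

lemma card_tails_heads: "card (tails X h) = card (heads X h)"
proof (rule bij_betw_same_card)
  have the: "(THE s. vec X h t s) = s" if "vec X h t s" for t s
    using that vec_unique_head by blast
  show "bij_betw (\<lambda>t. THE s. vec X h t s) (tails X h) (heads X h)"
    unfolding bij_betw_def inj_on_def
  proof (intro conjI ballI impI set_eqI iffI)
    fix t t' assume t: "t \<in> tails X h" "t' \<in> tails X h" "(THE s. vec X h t s) = (THE s. vec X h t' s)"
    then obtain s s' where s: "vec X h t s" "vec X h t' s'" unfolding tails_def by blast
    then show "t = t'" using t(3) vec_unique_tail[of t s t'] unfolding the[OF s(1)] the[OF s(2)] by simp
  next
    fix s assume "s \<in> (\<lambda>t. THE s. vec X h t s) ` tails X h"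
    then show "s \<in> heads X h" using the unfolding tails_def heads_def by auto
  next
    fix s assume "s \<in> heads X h"
    then obtain t where t: "vec X h t s" unfolding heads_def by blast
    then have "t \<in> tails X h" unfolding tails_def by blast
    then show "s \<in> (\<lambda>t. THE s. vec X h t s) ` tails X h" using the[OF t] by force
  qed
qed

text \<open>Assigning to a chain of heads the tails in its boundary is an injective map between
  finite sets of the same size.\<close>

lemma tail_lift_exists: "\<exists>q. head_chain X h q \<and> no_tails X h (c + bd X q)"
proof -
  define ind :: "'a set \<Rightarrow> 'a \<Rightarrow> bit" where "ind Q = (\<lambda>x. if x \<in> Q then 1 else 0)" for Q
  define g where "g Q = {t \<in> tails X h. bd X (ind Q) t = 1}" for Q
  have hc: "head_chain X h (ind Q)" if "Q \<in> Pow (heads X h)" for Q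
    using that by (auto simp: head_chain_def ind_def)
  have "inj_on g (Pow (heads X h))"
  proof (rule inj_onI)
    fix Q Q' assume Q: "Q \<in> Pow (heads X h)" "Q' \<in> Pow (heads X h)" "g Q = g Q'"
    have "bd X (ind Q + ind Q') t = 0" if "t \<in> tails X h" for t
    proof -
      have "bd X (ind Q) t = 1 \<longleftrightarrow> bd X (ind Q') t = 1" using Q(3) that by (auto simp: g_def)
      then show ?thesis by (cases "bd X (ind Q) t"; cases "bd X (ind Q') t") (auto simp: bd_add)
    qed
    then have "ind Q + ind Q' = 0"
      using head_chain_top[OF head_chain_add[OF hc[OF Q(1)] hc[OF Q(2)]]]
      unfolding tails_def by fastforce
    then have "ind Q = ind Q'" by (simp add: chain_add_eq_0_iff)
    then show "Q = Q'" by (auto simp: ind_def fun_eq_iff split: if_splits)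
  qed
  then have "card (g ` Pow (heads X h)) = card (Pow (tails X h))"
    using card_tails_heads tails_finite heads_finite by (simp add: card_image card_Pow)
  then have "g ` Pow (heads X h) = Pow (tails X h)"
    using tails_finite by (intro card_subset_eq) (auto simp: g_def)
  then have "{t \<in> tails X h. c t = 1} \<in> g ` Pow (heads X h)" by simp
  then obtain Q where Q: "Q \<in> Pow (heads X h)" "g Q = {t \<in> tails X h. c t = 1}" by (auto elim!: imageE)
  have "(c + bd X (ind Q)) t = 0" if "t \<in> tails X h" for t
  proof -
    have "bd X (ind Q) t = 1 \<longleftrightarrow> c t = 1" using Q(2) that by (auto simp: g_def)
    then show ?thesis by (cases "bd X (ind Q) t"; cases "c t") auto
  qed
  then show ?thesis using hc[OF Q(1)] unfolding no_tails_def by blast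
qed

section \<open>The homotopy and the projection onto invariant chains\<close>

lemma tail_lift:
  shows head_chain_tail_lift: "head_chain X h (tail_lift X h c)"
    and no_tails_tail_lift: "no_tails X h (c + bd X (tail_lift X h c))"
  using someI_ex[OF tail_lift_exists[of c]] unfolding tail_lift_def by blast+

lemma tail_lift_eqI:
  assumes "head_chain X h q" "no_tails X h (c + bd X q)"
  shows "tail_lift X h c = q"
proof -
  let ?d = "tail_lift X h c + q"
  have "no_tails X h ((c + bd X (tail_lift X h c)) + (c + bd X q))"
    using assms(2) no_tails_tail_lift by (rule no_tails_add[rotated])
  also have "(c + bd X (tail_lift X h c)) + (c + bd X q) = bd X ?d"
    by (simp add: bd_add add.assoc add.left_commute[of _ c])
  finally have "?d = 0"
    using head_chain_top[OF head_chain_add[OF head_chain_tail_lift[of c] assms(1)]]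
    unfolding no_tails_def tails_def by fastforce
  then show ?thesis by (simp add: chain_add_eq_0_iff)
qed

lemma tail_lift_no_tails: "no_tails X h c \<Longrightarrow> tail_lift X h c = 0"
  by (rule tail_lift_eqI) (auto simp: head_chain_def)

lemma tail_lift_add: "tail_lift X h (c + d) = tail_lift X h c + tail_lift X h d"
proof (rule tail_lift_eqI)
  have "no_tails X h ((c + bd X (tail_lift X h c)) + (d + bd X (tail_lift X h d)))"
    by (intro no_tails_add no_tails_tail_lift)
  then show "no_tails X h (c + d + bd X (tail_lift X h c + tail_lift X h d))"
    by (simp only: bd_add ac_simps)
qed (intro head_chain_add head_chain_tail_lift)

text \<open>The tail of the top head of the lift must occur in \<open>c\<close>, and it has the same
  value as that head.\<close>

lemma tail_lift_bound:
  assumes "\<And>t. t \<in> tails X h \<Longrightarrow> c t = 1 \<Longrightarrow> h t < r" and x: "tail_lift X h c x = 1"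
  shows "h x < r"
proof -
  have "tail_lift X h c \<noteq> 0" using x by auto
  from head_chain_top[OF head_chain_tail_lift this]
  obtain t s where ts: "vec X h t s" "bd X (tail_lift X h c) t = 1" "h x \<le> h s" using x by blast
  have t: "t \<in> tails X h" using ts(1) by (auto simp: tails_def)
  then have "(c + bd X (tail_lift X h c)) t = 0" using no_tails_tail_lift unfolding no_tails_def by blast
  then have "c t = 1" using ts(2) by (simp add: bit_add_eq_0_iff)
  then show ?thesis using assms(1)[OF t] ts by (simp add: vec_def)
qed

lemma stab_add: "stab X h (c + d) = stab X h c + stab X h d"
  by (simp only: stab_def tail_lift_add bd_add ac_simps)

lemma stab_0 [simp]: "stab X h 0 = 0"
  by (simp add: stab_def tail_lift_no_tails)

lemma stab_sum: "stab X h (sum f I) = (\<Sum>i\<in>I. stab X h (f i))"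
proof (induction I rule: infinite_finite_induct)
  case (insert x F)
  then show ?case by (simp only: sum.insert stab_add not_False_eq_True)
qed (simp_all only: sum.infinite sum.empty stab_0 not_False_eq_True)

text \<open>As the boundary squares to zero, both sides are
  \<open>bd X c + bd X (tail_lift X h (bd X c))\<close>.\<close>

lemma bd_stab: "bd X (stab X h c) = stab X h (bd X c)"
  by (simp add: stab_def bd_add tail_lift_no_tails)

lemma chain_stab: "chain X c \<Longrightarrow> chain X (stab X h c)"
  unfolding stab_def
  by (intro chain_add chain_bd head_chain_chain[OF head_chain_tail_lift])

lemma no_tails_stab: "no_tails X h (stab X h c)"
  unfolding stab_def
  by (intro no_tails_add no_tails_tail_lift head_chain_no_tails head_chain_tail_lift)

lemma invariant_stab: "chain X c \<Longrightarrow> invariant X h (stab X h c)"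
  unfolding invariant_def by (auto simp: bd_stab chain_stab no_tails_stab)

lemma invariant_bd: "invariant X h c \<Longrightarrow> invariant X h (bd X c)"
  by (simp add: invariant_def)

text \<open>The lift of the boundary of a head is the head itself. This removes heads from the
  expansion of a boundary.\<close>

lemma stab_bd_head:
  assumes "s \<in> heads X h" shows "stab X h (bd X (single s)) = 0"
proof -
  have "tail_lift X h (bd X (single s)) = single s"
    using assms by (intro tail_lift_eqI) (auto simp: head_chain_def single_def)
  then show ?thesis by (simp add: stab_def tail_lift_no_tails)
qed

text \<open>All correction terms lie at values strictly below \<open>h z\<close>: the facets of a
  critical cell have smaller values, and neither lifting nor taking boundaries raises the
  bound.\<close>

lemma lead_stab:
  assumes c: "chain X c" "lead X h c z" and z: "z \<in> critical X h"
  shows "lead X h (stab X h c) z"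
proof -
  have lt: "h x < h z" if "c x = 1" "x \<noteq> z" for x
    using less_critical[OF z, of x] c that unfolding lead_def chain_def by blast
  have lift: "h x < h z" if "tail_lift X h c x = 1" for x
  proof (rule tail_lift_bound[OF _ that])
    fix t assume "t \<in> tails X h" "c t = 1"
    then show "h t < h z" using lt[of t] z by (auto simp: critical_def)
  qed
  have bd: "h x < h z" if x: "bd X c x = 1" for x
  proof -
    obtain y where y: "c y = 1" "facet X x y" using bd_eq_1D[OF x] by blast
    show ?thesis
    proof (cases "y = z")
      case True
      then have "\<not> vec X h x y" using z by (auto simp: critical_def heads_def)
      then show ?thesis using facet_not_vec y True by blast
    next
      case False
      then show ?thesis using lt[OF y(1)] facet_mono[OF y(2)] by simp
    qed
  qed
  have bd_lift: "h x < h z" if x: "bd X (tail_lift X h c) x = 1" for x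
    using bd_eq_1D[OF x] lift facet_mono by force
  have lift_bd: "h x < h z" if x: "tail_lift X h (bd X c) x = 1" for x
    by (rule tail_lift_bound[OF _ x]) (rule bd)
  have "x \<prec> z" if "(bd X (tail_lift X h c) + tail_lift X h (bd X c)) x = 1" for x
    using that bd_lift lift_bd by (auto simp: h_less_def dest: bit_add_eq_1D)
  then show ?thesis unfolding stab_def add.assoc by (rule lead_add[OF c(2)])
qed

text \<open>A leading head would leave its tail in the boundary, by
  \<open>bd_lead_head\<close>.\<close>

lemma invariant_lead_critical:
  assumes c: "invariant X h c" "lead X h c z"
  shows "z \<in> critical X h"
proof -
  have chain: "chain X c" and nt: "no_tails X h c" "no_tails X h (bd X c)"
    using c(1) by (auto simp: invariant_def)
  have "z \<notin> tails X h" using nt(1) c(2) by (auto simp: no_tails_def lead_def)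
  moreover have "z \<notin> heads X h"
  proof
    assume "z \<in> heads X h"
    then obtain t where t: "vec X h t z" unfolding heads_def by blast
    then have "bd X c t = 1" using bd_lead_head c(2) chain by blast
    then show False using nt(2) t by (auto simp: no_tails_def tails_def)
  qed
  ultimately show ?thesis using lead_cells[OF chain c(2)] by (simp add: critical_def)
qed

lemma stab_single_critical:
  assumes b: "b \<in> critical X h" and x: "x \<notin> heads X h"
  shows "stab X h (single b) x = single b x"
proof -
  have "no_tails X h (single b)" using b by (auto simp: no_tails_def single_def critical_def)
  then have "stab X h (single b) = single b + tail_lift X h (bd X (single b))"
    by (simp add: stab_def tail_lift_no_tails)
  moreover have "tail_lift X h (bd X (single b)) x = 0"
    using head_chain_tail_lift[of "bd X (single b)"] x bit_not_one_iff unfolding head_chain_def by blast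
  ultimately show ?thesis by simp
qed

lemma lead_bd_head:
  assumes ts: "vec X h t s" shows "lead X h (bd X (single s)) t"
proof -
  have s: "s \<in> cells X" "facet X t s" "h t = h s" using ts by (auto simp: vec_def facet_def)
  have "x = t \<or> x \<prec> t" if "facet X x s" for x
  proof (cases "h x = h s")
    case True
    then have "vec X h x s" using that by (simp add: vec_def)
    then show ?thesis using ts vec_unique_tail by blast
  next
    case False
    then show ?thesis using facet_mono[OF that] s by (auto simp: h_less_def)
  qed
  then show ?thesis using s by (simp add: lead_def bd_single_eq_1)
qed

end


section \<open>Pairs of critical cells\<close>

lemma critical_cell: "x \<in> critical X h \<Longrightarrow> x \<in> cells X"
  by (simp add: critical_def)

context morse_complex
begin

lemma le_trans: "x = y \<or> x \<prec> y \<Longrightarrow> y = z \<or> y \<prec> z \<Longrightarrow> x = z \<or> x \<prec> z"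
  by (auto intro: less_trans)

text \<open>No column is related to a head. A related \<open>x\<close> has values below
  \<open>h t\<close> in its reduced boundary, so these cannot cancel \<open>t\<close>, and the birth
  cell of \<open>s\<close> is at least \<open>t\<close>; laziness would make the birth cell of
  \<open>x\<close> larger still.\<close>

lemma R_basis_head:
  assumes ts: "vec X h t s"
  shows "bd X (R_basis s) = bd X (single s)"
proof -
  have cells: "t \<in> cells X" "s \<in> cells X" and f: "facet X t s" "h t = h s"
    using ts by (auto simp: vec_def facet_def)
  let ?B = "{x \<in> cells X. x = s \<or> hom_rel X h x s}"
  have low: "h i < h t" if x: "hom_rel X h x s" and i: "bd X (R_basis x) i = 1" for x i
  proof -
    have xX: "x \<in> cells X" and "cdim X x = cdim X s" using x by (auto simp: hom_rel_def)
    then have "h x < h s" using hom_rel_less(1)[OF x] by (auto simp: h_less_def)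
    moreover obtain y where "R_basis x y = 1" "facet X i y" using bd_eq_1D[OF i] by blast
    moreover have "y = x \<or> y \<prec> x" using R_basis(2)[OF xX] calculation(2) by (auto simp: lead_def)
    ultimately show ?thesis using facet_mono[of i y] f by (auto simp: h_less_def)
  qed
  have B: "?B = insert s {x \<in> cells X. hom_rel X h x s}" using cells by auto
  have "s \<notin> {x \<in> cells X. hom_rel X h x s}" by (simp add: hom_rel_def)
  then have eq: "bd X (single s) = bd X (R_basis s) + (\<Sum>x\<in>{x \<in> cells X. hom_rel X h x s}. bd X (R_basis x))"
    using finite_cells unfolding bd_single_R_basis[OF cells(2)] B by (subst sum.insert) auto
  have "(\<Sum>x\<in>{x \<in> cells X. hom_rel X h x s}. bd X (R_basis x)) t = 0"
    unfolding sum_fun_apply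
  proof (rule sum.neutral, rule ballI)
    fix x assume "x \<in> {x \<in> cells X. hom_rel X h x s}"
    then show "bd X (R_basis x) t = 0"
      using low[of x t] by (cases "bd X (R_basis x) t") auto
  qed
  moreover have "bd X (single s) t = 1" using f cells by (simp add: bd_single_eq_1)
  ultimately have t1: "bd X (R_basis s) t = 1" using fun_cong[OF eq, of t] by simp
  \<comment> \<open>The birth cell \<open>i\<close> of \<open>x\<close> would be both above
    \<open>t\<close> by laziness and below it by \<open>low\<close>.\<close>
  have none: "\<not> hom_rel X h x s" for x
  proof
    assume x: "hom_rel X h x s"
    obtain i where i: "lead X h (bd X (R_basis x)) i"
      using hom_rel_less(2)[OF x] lead_exists chain_bd by blast
    have "bd X (R_basis s) \<noteq> 0" using t1 by auto
    then obtain j where j: "lead X h (bd X (R_basis s)) j" using lead_exists chain_bd by blast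
    have "t = j \<or> t \<prec> j" using j t1 by (auto simp: lead_def)
    moreover have "j \<prec> i" by (rule hom_rel_less(3)[OF x i j])
    ultimately have "h t \<le> h i" by (auto simp: h_less_def)
    moreover have "h i < h t" using low[OF x] i by (auto simp: lead_def)
    ultimately show False by simp
  qed
  show ?thesis using eq none by simp
qed

lemma vec_paired: "vec X h t s \<Longrightarrow> paired X h t s"
  using R_basis_head lead_bd_head vec_cells unfolding paired_iff_R_basis by metis

lemma paired_unique_death: "paired X h a b \<Longrightarrow> paired X h a b' \<Longrightarrow> b = b'"
  unfolding paired_iff_R_basis using reduced_basisD(3)[OF reduced_basis_R_basis] by blast

lemma paired_unique_birth: "paired X h a b \<Longrightarrow> paired X h a' b \<Longrightarrow> a = a'"
  unfolding paired_iff_R_basis using lead_unique by metis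

lemma bd_R_basis_birth: "paired X h a b \<Longrightarrow> bd X (R_basis a) = 0"
  unfolding paired_iff_R_basis using reduced_basis_birth[OF reduced_basis_R_basis] by blast

lemma paired_not_birth_death: "paired X h a b \<Longrightarrow> \<not> paired X h c a"
  using bd_R_basis_birth[of a b] lead_not_0 unfolding paired_iff_R_basis by metis

lemma paired_cells: "paired X h a b \<Longrightarrow> a \<in> cells X \<and> b \<in> cells X"
  unfolding paired_iff_R_basis by blast

text \<open>A noncritical cell lies in a vector, vectors are pairs, and partners are unique. Equal
  values lead to this case because a critical cell shares its value with no other cell.\<close>

lemma paired_vec:
  assumes p: "paired X h a b" and eq: "a \<notin> critical X h \<or> b \<notin> critical X h \<or> h a = h b"
  shows "vec X h a b"
proof -
  have ab: "a \<in> cells X" "b \<in> cells X" using p paired_cells by auto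
  have "a \<noteq> b" using p by (auto simp: paired_def n_cells_def)
  then have "a \<notin> critical X h \<or> b \<notin> critical X h"
    using eq critical_neq[of b a] ab by auto
  then have "(\<exists>s. vec X h a s) \<or> (\<exists>t. vec X h t a) \<or> (\<exists>s. vec X h b s) \<or> (\<exists>t. vec X h t b)"
    using ab by (auto simp: critical_def tails_def heads_def)
  then show ?thesis
    using p vec_paired paired_unique_death paired_unique_birth paired_not_birth_death by metis
qed

lemma offdiag_BD_iff:
  "\<beta> \<in> offdiag_BD X h \<longleftrightarrow>
     (\<exists>x y. \<beta> = (x, Some y) \<and> paired X h x y \<and> y \<in> critical X h) \<or>
     (\<exists>x. \<beta> = (x, None) \<and> x \<in> critical X h \<and> (\<nexists>y. paired X h x y \<or> paired X h y x))"
proof -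
  have 1: "h x \<noteq> h y \<longleftrightarrow> y \<in> critical X h" if "paired X h x y" for x y
    using paired_vec[OF that] by (auto simp: vec_def critical_def heads_def)
  have 2: "x \<in> cells X \<longleftrightarrow> x \<in> critical X h" if "\<nexists>y. paired X h x y \<or> paired X h y x" for x
    using that vec_paired by (auto simp: critical_def tails_def heads_def)
  show ?thesis
    using 1 2 by (cases \<beta>; cases "snd \<beta>") (auto simp: offdiag_BD_def BD_def)
qed

end


section \<open>Cancelling a pair\<close>

text \<open>The new function enters only through its tails, its heads and its values at critical
  cells. The assumption \<open>disjoint\<close> says that the rectangles of the pairs
  \<open>(z, x)\<close> and \<open>(g, y)\<close> in the two regions do not meet.\<close>

locale cancellation = morse_complex X h for X :: "'a cell_data" and h :: "'a \<Rightarrow> real" +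
  fixes h' :: "'a \<Rightarrow> real" and N :: nat and a b :: 'a
  assumes morse': "discrete_morse X h'"
    and N: "\<And>x. x \<in> cells X \<Longrightarrow> cdim X x \<le> N"
    and pair: "paired X h a b" and b_critical: "b \<in> critical X h"
    and disjoint: "\<And>x z g y. hom_rel X h x b \<Longrightarrow> x \<in> critical X h \<Longrightarrow> paired X h z x \<Longrightarrow>
      cohom_rel X h g a \<Longrightarrow> g \<in> critical X h \<Longrightarrow> paired X h g y \<Longrightarrow> h g \<le> h z \<Longrightarrow> h x < h y"
    and tails': "tails X h' = insert a (tails X h)"
    and heads': "heads X h' = insert b (heads X h)"
    and agree: "\<And>x. x \<in> critical X h' \<Longrightarrow> h' x = h x"
begin

lemma a_critical: "a \<in> critical X h"
  using paired_vec[OF pair] b_critical by (auto simp: critical_def heads_def)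

lemma a_cells: "a \<in> cells X" and b_cells: "b \<in> cells X"
  using pair paired_cells by auto

lemma a_neq_b: "a \<noteq> b"
  using pair paired_not_birth_death by blast

lemma critical': "x \<in> critical X h' \<longleftrightarrow> x \<in> critical X h \<and> x \<noteq> a \<and> x \<noteq> b"
  by (auto simp: critical_def tails' heads')

definition u :: "'a \<Rightarrow> 'a \<Rightarrow> bit" where
  "u x = stab X h (R_basis x)"

lemma invariant_u: "x \<in> cells X \<Longrightarrow> invariant X h (u x)"
  unfolding u_def by (intro invariant_stab R_basis)

lemma lead_u: "x \<in> critical X h \<Longrightarrow> lead X h (u x) x"
  unfolding u_def by (intro lead_stab R_basis critical_cell)

lemma bd_u: "bd X (u x) = stab X h (bd X (R_basis x))"
  by (simp add: u_def bd_stab)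

lemma paired_critical: "paired X h z x \<Longrightarrow> x \<in> critical X h \<Longrightarrow> z \<in> critical X h"
  using paired_vec[of z x] by (auto simp: critical_def heads_def)

lemma lead_bd_u: "paired X h z x \<Longrightarrow> x \<in> critical X h \<Longrightarrow> lead X h (bd X (u x)) z"
  unfolding bd_u using paired_critical[of z x]
  by (intro lead_stab) (auto simp: paired_iff_R_basis)

lemma bd_u_neq_0D:
  assumes "x \<in> critical X h" "bd X (u x) \<noteq> 0"
  shows "\<exists>z. paired X h z x"
proof -
  have "bd X (R_basis x) \<noteq> 0" using assms(2) unfolding bd_u by (metis stab_0)
  from lead_exists[OF chain_bd this]
  obtain z where "z \<in> cells X" "lead X h (bd X (R_basis x)) z" by blast
  then have "paired X h z x" using critical_cell[OF assms(1)] unfolding paired_iff_R_basis by blast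
  then show ?thesis by blast
qed

text \<open>The indices that survive in the expansion of the boundary of \<open>b\<close> once it is
  made invariant; \<open>G\<close> is the analogue for the coboundary of \<open>a\<close>.\<close>

definition B :: "'a set" where
  "B = {x \<in> critical X h. x = b \<or> hom_rel X h x b}"

definition G :: "'a set" where
  "G = {g \<in> critical X h. g = a \<or> cohom_rel X h g a}"

text \<open>Differs from \<open>u b\<close> in starting from the bare cell: its only critical cell
  is \<open>b\<close>, so adding it leaves the other critical coefficients unchanged.\<close>

definition ub :: "'a \<Rightarrow> bit" where
  "ub = stab X h (single b)"

lemma B_finite: "finite B"
  using finite_cells by (rule finite_subset[rotated]) (auto simp: B_def critical_cell)

lemma b_in_B: "b \<in> B"
  using b_critical by (simp add: B_def)

lemma invariant_ub: "invariant X h ub"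
  unfolding ub_def by (intro invariant_stab chain_single b_cells)

text \<open>Apply \<open>stab\<close> to the expansion of the boundary of \<open>b\<close>. A tail
  contributes nothing because it is a birth cell, and a head because its reduced boundary is its own
  boundary, which \<open>stab\<close> kills.\<close>

lemma bd_ub: "bd X ub = (\<Sum>x\<in>B. bd X (u x))"
proof -
  have "bd X ub = (\<Sum>x\<in>{x \<in> cells X. x = b \<or> hom_rel X h x b}. bd X (u x))"
    unfolding ub_def bd_stab bd_single_R_basis[OF b_cells] stab_sum bd_u ..
  also have "\<dots> = (\<Sum>x\<in>B. bd X (u x))"
  proof (rule sum.mono_neutral_right)
    show "finite {x \<in> cells X. x = b \<or> hom_rel X h x b}" using finite_cells by simp
    show "B \<subseteq> {x \<in> cells X. x = b \<or> hom_rel X h x b}"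
      by (auto simp: B_def critical_cell)
    show "\<forall>x\<in>{x \<in> cells X. x = b \<or> hom_rel X h x b} - B. bd X (u x) = 0"
    proof
      fix x assume "x \<in> {x \<in> cells X. x = b \<or> hom_rel X h x b} - B"
      then have "x \<in> tails X h \<or> x \<in> heads X h" by (auto simp: B_def critical_def)
      then show "bd X (u x) = 0"
      proof
        assume "x \<in> tails X h"
        then obtain s where "vec X h x s" unfolding tails_def by blast
        then show ?thesis unfolding bd_u by (simp add: bd_R_basis_birth[OF vec_paired])
      next
        assume "x \<in> heads X h"
        then obtain t where "vec X h t x" unfolding heads_def by blast
        then have "bd X (R_basis x) = bd X (single x)" by (rule R_basis_head)
        then show ?thesis unfolding bd_u using stab_bd_head[OF \<open>x \<in> heads X h\<close>] by simp
      qed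
    qed
  qed
  finally show ?thesis .
qed

interpretation d: morse_complex "dual N X" "\<lambda>x. - h x"
  using N by (rule morse_complex_dual)

lemma vec_dual: "vec (dual N X) (\<lambda>x. - h x) s t \<longleftrightarrow> vec X h t s"
  by (auto simp: vec_def facet_dual)

text \<open>The coefficient is the value of the coboundary of \<open>a\<close> on \<open>c\<close>,
  expanded by the dual reduction. A tail \<open>g\<close> is a head of the dual field, so its term
  is the coefficient of \<open>g\<close> in the boundary of \<open>c\<close>, which is zero by
  invariance; a head is a dual birth cell with zero term.\<close>

lemma bd_invariant_at_a:
  assumes c: "invariant X h c"
  shows "bd X c a = (\<Sum>g\<in>G. pairing X (bd (dual N X) (d.R_basis g)) c)"
proof -
  let ?G = "{g \<in> cells X. g = a \<or> cohom_rel X h g a}"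
  have "bd X c a = pairing X (bd (dual N X) (single a)) c"
    unfolding pairing_bd[symmetric] pairing_single[OF a_cells] ..
  also have "\<dots> = (\<Sum>g\<in>?G. pairing X (bd (dual N X) (d.R_basis g)) c)"
    using d.bd_single_R_basis[of a] a_cells
    by (simp add: pairing_sum_left cohom_rel_dual[OF N])
  also have "\<dots> = (\<Sum>g\<in>G. pairing X (bd (dual N X) (d.R_basis g)) c)"
  proof (rule sum.mono_neutral_right)
    show "finite ?G" using finite_cells by simp
    show "G \<subseteq> ?G" by (auto simp: G_def critical_cell)
    show "\<forall>g\<in>?G - G. pairing X (bd (dual N X) (d.R_basis g)) c = 0"
    proof
      fix g assume g: "g \<in> ?G - G"
      then have "g \<in> tails X h \<or> g \<in> heads X h" by (auto simp: G_def critical_def)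
      then show "pairing X (bd (dual N X) (d.R_basis g)) c = 0"
      proof
        assume t: "g \<in> tails X h"
        then obtain s where "vec (dual N X) (\<lambda>x. - h x) s g" unfolding vec_dual tails_def by blast
        then have "bd (dual N X) (d.R_basis g) = bd (dual N X) (single g)" by (rule d.R_basis_head)
        then have "pairing X (bd (dual N X) (d.R_basis g)) c = bd X c g"
          using g pairing_single[of g] by (simp flip: pairing_bd)
        then show ?thesis using c t by (simp add: invariant_def no_tails_def)
      next
        assume "g \<in> heads X h"
        then obtain t where "vec (dual N X) (\<lambda>x. - h x) g t" unfolding vec_dual heads_def by blast
        then have "bd (dual N X) (d.R_basis g) = 0"
          using d.vec_paired d.bd_R_basis_birth by blast
        then show ?thesis by simp
      qed
    qed
  qed
  finally show ?thesis .
qed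

text \<open>Some term of the expansion over \<open>G\<close> is 1. Evaluated on \<open>u x\<close>,
  the coboundary gives the comparison of the death cells \<open>y\<close> and \<open>x\<close>;
  evaluated on the boundary of \<open>u x\<close>, the cochain gives that of the birth
  cells.\<close>

lemma below_G:
  assumes x: "x \<in> critical X h" and A: "bd X (u x) a = 1"
  shows "\<exists>g\<in>G. \<exists>y z. paired X h g y \<and> paired X h z x \<and> (g = z \<or> g \<prec> z) \<and> (y = x \<or> y \<prec> x)"
proof -
  have xX: "x \<in> cells X" using x by (rule critical_cell)
  have "(\<Sum>g\<in>G. pairing X (bd (dual N X) (d.R_basis g)) (u x)) = 1"
    using A bd_invariant_at_a[OF invariant_u[OF xX]] by simp
  then obtain g where g: "g \<in> G" "pairing X (bd (dual N X) (d.R_basis g)) (u x) = 1"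
    by (blast dest: sum_eq_1D)
  have gX: "g \<in> cells X" using g critical_cell by (auto simp: G_def)
  obtain p where p: "bd (dual N X) (d.R_basis g) p = 1" "u x p = 1"
    using pairing_eq_1D[OF g(2)] by blast
  have "bd (dual N X) (d.R_basis g) \<noteq> 0" using p(1) by auto
  then obtain y where y: "lead (dual N X) (\<lambda>x. - h x) (bd (dual N X) (d.R_basis g)) y" "y \<in> cells X"
    using d.lead_exists chain_bd by fastforce
  have "paired (dual N X) (\<lambda>x. - h x) y g" using y gX unfolding d.paired_iff_R_basis by simp
  then have gy: "paired X h g y" using paired_dual[OF N] by simp
  have "chain X (bd (dual N X) (d.R_basis g))" using chain_bd[of "dual N X"] by simp
  from iffD1[OF lead_dual[OF N this] y(1)] have "y = p \<or> y \<prec> p" using p(1) by auto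
  moreover have "p = x \<or> p \<prec> x" using lead_u[OF x] p(2) by (auto simp: lead_def)
  ultimately have yx: "y = x \<or> y \<prec> x" by (rule le_trans)
  have "pairing X (d.R_basis g) (bd X (u x)) = 1" using g(2) by (simp add: pairing_bd[of _ _ _ N])
  then obtain q where q: "d.R_basis g q = 1" "bd X (u x) q = 1" by (blast dest: pairing_eq_1D)
  have "bd X (u x) \<noteq> 0" using q(2) by auto
  then obtain z where z: "paired X h z x" using bd_u_neq_0D x by blast
  have w: "chain X (d.R_basis g)" "lead (dual N X) (\<lambda>x. - h x) (d.R_basis g) g"
    using d.R_basis(1,2)[of g] gX by simp_all
  from iffD1[OF lead_dual[OF N w(1)] w(2)] have "g = q \<or> g \<prec> q" using q(1) by auto
  moreover have "q = z \<or> q \<prec> z" using lead_bd_u[OF z x] q(2) by (auto simp: lead_def)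
  ultimately have gz: "g = z \<or> g \<prec> z" by (rule le_trans)
  show ?thesis using g(1) gy z gz yx by blast
qed

text \<open>By \<open>below_G\<close> the rectangles of two related pairs would meet. In the
  remaining case \<open>g = a\<close> the death cell is \<open>b\<close>, which comes after
  \<open>x\<close>.\<close>

lemma bd_u_B_at_a:
  assumes "x \<in> B" "x \<noteq> b" shows "bd X (u x) a = 0"
proof (rule ccontr)
  assume "bd X (u x) a \<noteq> 0"
  moreover have x: "x \<in> critical X h" "hom_rel X h x b" using assms by (auto simp: B_def)
  ultimately obtain g y z where *: "g \<in> G" "paired X h g y" "paired X h z x"
      "g = z \<or> g \<prec> z" "y = x \<or> y \<prec> x"
    using below_G[of x] by auto
  show False
  proof (cases "g = a")
    case True
    then have "y = b" using *(2) pair paired_unique_death by blast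
    then show False using *(5) hom_rel_less(1)[OF x(2)] less_asym assms(2) by blast
  next
    case False
    then have "cohom_rel X h g a" "g \<in> critical X h" using *(1) by (auto simp: G_def)
    moreover have "h g \<le> h z" using *(4) by (auto simp: h_less_def)
    ultimately have "h x < h y" using disjoint x *(2,3) by blast
    then show False using *(5) by (auto simp: h_less_def)
  qed
qed

lemma bd_u_b_at_a: "bd X (u b) a = 1"
  using lead_bd_u[OF pair b_critical] by (simp add: lead_def)

lemma bd_ub_at_a: "bd X ub a = 1"
proof -
  have "bd X ub a = (\<Sum>x\<in>B. bd X (u x) a)" by (simp add: bd_ub sum_fun_apply)
  also have "\<dots> = (\<Sum>x\<in>{b}. bd X (u x) a)"
    using bd_u_B_at_a b_in_B B_finite by (intro sum.mono_neutral_right) auto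
  finally show ?thesis using bd_u_b_at_a by simp
qed

lemma bd_u_a: "bd X (u a) = 0"
  using bd_R_basis_birth[OF pair] by (simp add: bd_u)

lemma ub_at_a: "ub a = 0" and ub_critical: "x \<in> critical X h \<Longrightarrow> ub x = 1 \<Longrightarrow> x = b"
  using stab_single_critical[OF b_critical] a_critical a_neq_b
  by (auto simp: ub_def critical_def single_def split: if_splits)

section \<open>Leading cells and pairs for the new function\<close>

interpretation m': morse_complex X h'
  by unfold_locales (rule morse')

lemma invariant':
  assumes "invariant X h c" "c a = 0" "bd X c a = 0"
  shows "invariant X h' c"
  using assms by (auto simp: invariant_def no_tails_def tails')

text \<open>The lead for \<open>h'\<close> is critical for \<open>h'\<close>, and there the two
  functions agree, so only coefficients at those cells have to be compared, in the order of
  \<open>h\<close>.\<close>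

lemma lead':
  assumes c: "invariant X h c" "c a = 0" "bd X c a = 0"
    and z: "z \<in> critical X h'" "c z = 1"
    and max: "\<And>x. x \<in> critical X h' \<Longrightarrow> c x = 1 \<Longrightarrow> x = z \<or> x \<prec> z"
  shows "lead X h' c z"
proof -
  have "chain X c" "c \<noteq> 0" using c(1) z(2) by (auto simp: invariant_def)
  then obtain y where y: "lead X h' c y" using m'.lead_exists by blast
  have yc: "y \<in> critical X h'" using m'.invariant_lead_critical[OF invariant'[OF c] y] .
  have "y = z"
  proof (rule ccontr)
    assume "y \<noteq> z"
    then have "y \<prec> z" using max[OF yc] y by (auto simp: lead_def)
    moreover have "z \<in> critical X h" "y \<in> cells X"
      using z(1) critical_cell[OF yc] critical' by auto
    ultimately have "h y < h z" using less_critical by blast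
    then have "h' y < h' z" using agree yc z(1) by simp
    moreover have "h_less X h' z y" using y z(2) \<open>y \<noteq> z\<close> by (auto simp: lead_def)
    ultimately show False by (auto simp: h_less_def)
  qed
  then show ?thesis using y by simp
qed

text \<open>If \<open>a\<close> occurs in the boundary of \<open>u y\<close>, it is removed by adding \<open>ub\<close>. This may introduce
  birth cells larger than that of \<open>y\<close>; they are removed by adding \<open>u x\<close> for their death cells \<open>x\<close>,
  which precede \<open>y\<close> because the forbidden regions are disjoint.\<close>

lemma critical_basis_chain:
  assumes y: "y \<in> critical X h'"
  shows "\<exists>f. chain X f \<and> lead X h' f y \<and> ((\<nexists>z. paired X h z y) \<longrightarrow> bd X f = 0) \<and>
    (\<forall>z. paired X h z y \<longrightarrow> z \<in> critical X h' \<and> lead X h' (bd X f) z)"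
proof -
  have yc: "y \<in> critical X h" "y \<noteq> a" "y \<noteq> b" using y critical' by auto
  have yX: "y \<in> cells X" using yc(1) by (rule critical_cell)
  define A where "A = (bd X (u y) a = 1)"
  \<comment> \<open>The summands of the boundary of \<open>ub\<close> whose birth cell would
    overtake that of \<open>y\<close>; adding them once more cancels them.\<close>
  define K where "K = (if A then {x \<in> B. x \<noteq> b \<and> (\<exists>p z. paired X h p x \<and> paired X h z y \<and> z \<prec> p)} else {})"
  have K: "K \<subseteq> B" "b \<notin> K" by (auto simp: K_def)
  have K_less: "x \<prec> y" if "x \<in> K" for x
  proof -
    from that obtain p z where x: "x \<in> B" "x \<noteq> b" A and p: "paired X h p x" "paired X h z y" "z \<prec> p"
      unfolding K_def by (auto split: if_splits)
    obtain g q z' where g: "g \<in> G" "paired X h g q" "paired X h z' y"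
        "g = z' \<or> g \<prec> z'" "q = y \<or> q \<prec> y"
      using below_G[OF yc(1)] x(3) unfolding A_def by blast
    have "z' = z" using g(3) p(2) paired_unique_birth by blast
    have xc: "x \<in> critical X h" "hom_rel X h x b" using x by (auto simp: B_def)
    have "x \<prec> q"
    proof (cases "g = a")
      case True
      then have "q = b" using g(2) pair paired_unique_death by blast
      then show ?thesis using hom_rel_less(1)[OF xc(2)] by simp
    next
      case False
      then have "cohom_rel X h g a" "g \<in> critical X h" using g(1) by (auto simp: G_def)
      moreover have "h g \<le> h p" using g(4) p(3) \<open>z' = z\<close> by (auto simp: h_less_def)
      ultimately have "h x < h q" using disjoint xc p(1) g(2) by blast
      then show ?thesis by (simp add: h_less_def)
    qed
    then show ?thesis using g(5) less_trans[of x q y] by blast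
  qed
  define c where "c = u y + (\<Sum>x\<in>K. u x)"
  \<comment> \<open>\<open>ub\<close> clears \<open>a\<close> in the boundary; \<open>u a\<close>
    then clears \<open>a\<close> in the chain and, being a cycle, leaves the boundary alone.\<close>
  define f where "f = c + (if A then ub else 0) + (if c a = 1 then u a else 0)"
  have BX: "B \<subseteq> cells X" by (auto simp: B_def critical_cell)
  have inv_c: "invariant X h c"
    unfolding c_def using K BX yX by (intro invariant_add invariant_sum invariant_u) auto
  have inv_f: "invariant X h f"
    unfolding f_def using inv_c invariant_ub invariant_u[OF a_cells] by (auto intro!: invariant_add)
  have c_le: "x = y \<or> x \<prec> y" if "c x = 1" for x
  proof -
    have "u y x = 1 \<or> (\<Sum>z\<in>K. u z) x = 1"
      using that unfolding c_def by (auto dest: bit_add_eq_1D)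
    then show ?thesis
    proof
      assume "u y x = 1" then show ?thesis using lead_u[OF yc(1)] by (auto simp: lead_def)
    next
      assume "(\<Sum>z\<in>K. u z) x = 1"
      then obtain z where z: "z \<in> K" "u z x = 1" unfolding sum_fun_apply by (blast dest: sum_eq_1D)
      then have "x = z \<or> x \<prec> z" using lead_u[of z] K by (auto simp: lead_def B_def)
      then show ?thesis using K_less[OF z(1)] less_trans[of x z y] by blast
    qed
  qed
  have c_y: "c y = 1"
  proof -
    have "(\<Sum>z\<in>K. u z) y \<noteq> 1"
    proof
      assume "(\<Sum>z\<in>K. u z) y = 1"
      then obtain z where z: "z \<in> K" "u z y = 1" unfolding sum_fun_apply by (blast dest: sum_eq_1D)
      then have "y = z \<or> y \<prec> z" using lead_u[of z] K by (auto simp: lead_def B_def)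
      then show False using K_less[OF z(1)] less_asym by blast
    qed
    then show ?thesis using lead_u[OF yc(1)] unfolding c_def by (simp add: lead_def)
  qed
  have u_a: "u a a = 1" "\<And>x. u a x = 1 \<Longrightarrow> x = a \<or> x \<prec> a"
    using lead_u[OF a_critical] by (auto simp: lead_def)
  have bd_c: "bd X c = bd X (u y) + (\<Sum>x\<in>K. bd X (u x))"
    by (simp add: c_def bd_add bd_sum)
  have "(\<Sum>x\<in>K. bd X (u x)) a = 0"
    unfolding sum_fun_apply using K bd_u_B_at_a by (intro sum.neutral) blast
  then have bd_c_a: "bd X c a = (if A then 1 else 0)" by (simp add: bd_c A_def)
  have bd_f: "bd X f = bd X c + (if A then bd X ub else 0)"
    unfolding f_def by (auto simp: bd_add bd_u_a)
  have f_a: "f a = 0"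
    unfolding f_def using ub_at_a u_a(1) by (cases "c a") auto
  have bd_f_a: "bd X f a = 0" unfolding bd_f using bd_ub_at_a bd_c_a by auto
  \<comment> \<open>If \<open>u a\<close> is added at all, it lies entirely before \<open>y\<close>
    and cannot disturb the lead.\<close>
  have ua_le: "a \<prec> y" if "c a = 1" using c_le[OF that] yc(2) by auto
  have lead_f: "lead X h' f y"
  proof (rule lead'[OF inv_f f_a bd_f_a y])
    have "ub y = 0" using ub_critical[OF yc(1)] yc(3) by (cases "ub y") auto
    moreover have "u a y = 0" if "c a = 1"
    proof (rule ccontr)
      assume "u a y \<noteq> 0"
      then have "y = a \<or> y \<prec> a" using u_a(2) by simp
      then show False using ua_le[OF that] less_asym by blast
    qed
    ultimately show "f y = 1" unfolding f_def using c_y by auto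
    fix x assume x: "x \<in> critical X h'" "f x = 1"
    then have xc: "x \<in> critical X h" "x \<noteq> a" "x \<noteq> b" using critical' by auto
    have "ub x = 0" using ub_critical[OF xc(1)] xc(3) by (cases "ub x") auto
    then have "c x = 1 \<or> (c a = 1 \<and> u a x = 1)"
      using x(2) unfolding f_def by (auto split: if_splits dest: bit_add_eq_1D)
    then show "x = y \<or> x \<prec> y"
      using c_le[of x] u_a(2)[of x] ua_le xc(2) less_trans[of x a y] by blast
  qed
  have bd_none: "bd X f = 0" if "\<nexists>z. paired X h z y"
  proof -
    have "bd X (u y) = 0" using bd_u_neq_0D[OF yc(1)] that by blast
    then show ?thesis unfolding bd_f bd_c by (simp add: A_def K_def)
  qed
  have bd_pair: "z \<in> critical X h' \<and> lead X h' (bd X f) z" if z: "paired X h z y" for z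
  proof
    have "z \<noteq> a" using z pair paired_unique_death yc(3) by blast
    moreover have "z \<noteq> b" using z pair paired_not_birth_death by blast
    ultimately show zc': "z \<in> critical X h'" using paired_critical[OF z yc(1)] critical' by blast
    have lead_y: "lead X h (bd X (u y)) z" by (rule lead_bd_u[OF z yc(1)])
    have lead_z: "lead X h (bd X f) z"
    proof (cases A)
      case False
      then show ?thesis unfolding bd_f bd_c using lead_y by (simp add: K_def)
    next
      case True
      have "(\<Sum>x\<in>B. bd X (u x)) = (\<Sum>x\<in>B - K. bd X (u x)) + (\<Sum>x\<in>K. bd X (u x))"
        by (rule sum.subset_diff[OF K(1) B_finite])
      then have eq: "bd X f = bd X (u y) + (\<Sum>x\<in>B - K. bd X (u x))"
        unfolding bd_f bd_c bd_ub using True by (simp add: add.assoc)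
      show ?thesis unfolding eq
      proof (rule lead_add[OF lead_y])
        fix q assume "(\<Sum>x\<in>B - K. bd X (u x)) q = 1"
        then obtain x where x: "x \<in> B" "x \<notin> K" "bd X (u x) q = 1"
          unfolding sum_fun_apply by (blast dest: sum_eq_1D)
        have xc: "x \<in> critical X h" using x(1) by (simp add: B_def)
        have "bd X (u x) \<noteq> 0" using x(3) by auto
        then obtain p where p: "paired X h p x" using bd_u_neq_0D xc by blast
        have "q = p \<or> q \<prec> p" using lead_bd_u[OF p xc] x(3) by (auto simp: lead_def)
        moreover have "p \<prec> z"
        proof (cases "x = b")
          case True
          then have "p = a" using p pair paired_unique_birth by blast
          \<comment> \<open>\<open>a\<close> occurs in the boundary of \<open>u y\<close> without
            being its lead \<open>z\<close>.\<close>
          then show ?thesis using lead_y \<open>A\<close> \<open>z \<noteq> a\<close> by (auto simp: lead_def A_def)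
        next
          case False
          then have "\<not> z \<prec> p" using x(1,2) p z \<open>A\<close> by (auto simp: K_def)
          moreover have "p \<noteq> z"
          proof
            assume "p = z"
            then have "x = y" using p z paired_unique_death by blast
            then show False using bd_u_B_at_a[OF x(1) False] \<open>A\<close> by (simp add: A_def)
          qed
          ultimately show ?thesis using less_total p z paired_cells by blast
        qed
        ultimately show "q \<prec> z" using less_trans[of q p z] by blast
      qed
    qed
    show "lead X h' (bd X f) z"
    proof (rule lead'[OF invariant_bd[OF inv_f] bd_f_a _ zc'])
      show "bd X (bd X f) a = 0" by simp
    qed (use lead_z in \<open>auto simp: lead_def\<close>)
  qed
  have "chain X f" using inv_f by (simp add: invariant_def)
  then show ?thesis using lead_f bd_none bd_pair by blast
qed

text \<open>A reduced basis for \<open>h'\<close> is assembled from trivial chains at the vectors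
  and the chains of \<open>critical_basis_chain\<close> at the critical cells; its leads are the
  pairs of \<open>h'\<close>.\<close>

lemma paired':
  "paired X h' p y \<longleftrightarrow> vec X h' p y \<or> (y \<in> critical X h' \<and> paired X h p y)"
proof -
  have "\<forall>y\<in>critical X h'. \<exists>f. chain X f \<and> lead X h' f y \<and>
      ((\<nexists>z. paired X h z y) \<longrightarrow> bd X f = 0) \<and>
      (\<forall>z. paired X h z y \<longrightarrow> z \<in> critical X h' \<and> lead X h' (bd X f) z)"
    using critical_basis_chain by blast
  from bchoice[OF this] obtain F where F: "\<And>y. y \<in> critical X h' \<Longrightarrow> chain X (F y)"
      "\<And>y. y \<in> critical X h' \<Longrightarrow> lead X h' (F y) y"
      "\<And>y. y \<in> critical X h' \<Longrightarrow> \<nexists>z. paired X h z y \<Longrightarrow> bd X (F y) = 0"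
      "\<And>y z. y \<in> critical X h' \<Longrightarrow> paired X h z y \<Longrightarrow> z \<in> critical X h'"
      "\<And>y z. y \<in> critical X h' \<Longrightarrow> paired X h z y \<Longrightarrow> lead X h' (bd X (F y)) z"
    by blast
  \<comment> \<open>A tail gets the boundary of its head: this is a cycle whose lead is that
    tail.\<close>
  define f where "f y = (if y \<in> heads X h' then single y
      else if y \<in> tails X h' then bd X (single (THE s. vec X h' y s)) else F y)" for y
  have f_head: "f s = single s" if "vec X h' t s" for t s
    using that by (auto simp: f_def heads_def)
  have f_tail: "f t = bd X (single s)" if "vec X h' t s" for t s
  proof -
    have t: "t \<in> tails X h'" using that by (auto simp: tails_def)
    have "(THE s. vec X h' t s) = s" using that m'.vec_unique_head by blast
    then show ?thesis using m'.tails_heads_disjoint[OF t] t by (simp add: f_def)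
  qed
  have f_crit: "f y = F y" if "y \<in> critical X h'" for y
    using that by (simp add: f_def critical_def)
  have cases: "(\<exists>s. vec X h' y s) \<or> (\<exists>t. vec X h' t y) \<or> y \<in> critical X h'" if "y \<in> cells X" for y
    using that by (auto simp: critical_def tails_def heads_def)
  have lead_bd: "vec X h' p y \<or> (y \<in> critical X h' \<and> paired X h p y)"
    if y: "y \<in> cells X" and p: "lead X h' (bd X (f y)) p" for p y
    using cases[OF y]
  proof (elim disjE exE)
    fix s assume "vec X h' y s"
    then have "bd X (f y) = 0" by (simp add: f_tail)
    then show ?thesis using m'.lead_not_0[OF p] by blast
  next
    fix t assume t: "vec X h' t y"
    then have "lead X h' (bd X (f y)) t" unfolding f_head[OF t] by (rule m'.lead_bd_head)
    then show ?thesis using lead_unique[OF p] t by blast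
  next
    assume yc: "y \<in> critical X h'"
    then have "bd X (F y) \<noteq> 0" using m'.lead_not_0[OF p] by (simp add: f_crit)
    then obtain z where z: "paired X h z y" using F(3) yc by blast
    then have "p = z" using lead_unique[OF p] F(5) yc by (simp add: f_crit)
    then show ?thesis using z yc by blast
  qed
  have "reduced_basis X h' f"
    unfolding reduced_basis_def
  proof (intro conjI ballI allI impI)
    fix y assume y: "y \<in> cells X"
    have "chain X (f y) \<and> lead X h' (f y) y"
      using cases[OF y]
    proof (elim disjE exE)
      fix s assume s: "vec X h' y s"
      then show ?thesis unfolding f_tail[OF s] using m'.lead_bd_head by simp
    next
      fix t assume t: "vec X h' t y"
      then show ?thesis
        unfolding f_head[OF t] using chain_single[OF y] by (simp add: lead_def single_def)
    next
      assume "y \<in> critical X h'"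
      then show ?thesis using F f_crit by simp
    qed
    then show "chain X (f y)" "lead X h' (f y) y" by auto
  next
    fix y z p assume yz: "y \<in> cells X" "z \<in> cells X"
      and y: "lead X h' (bd X (f y)) p" and z: "lead X h' (bd X (f z)) p"
    \<comment> \<open>Vectors contribute leads at tails, critical cells at critical cells, so
      collisions can occur only within one kind.\<close>
    have "p \<notin> critical X h'" if "vec X h' p s" for s using that by (auto simp: critical_def tails_def)
    then show "y = z"
      using lead_bd[OF yz(1) y] lead_bd[OF yz(2) z] F(4) m'.vec_unique_head paired_unique_death
      by metis
  qed
  from m'.paired_iff_reduced_basis[OF this]
  have iff: "paired X h' p y \<longleftrightarrow> y \<in> cells X \<and> lead X h' (bd X (f y)) p" .
  show ?thesis
  proof
    assume "paired X h' p y"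
    then show "vec X h' p y \<or> (y \<in> critical X h' \<and> paired X h p y)" using iff lead_bd by blast
  next
    assume "vec X h' p y \<or> (y \<in> critical X h' \<and> paired X h p y)"
    then show "paired X h' p y"
    proof
      assume "vec X h' p y" then show ?thesis by (rule m'.vec_paired)
    next
      assume "y \<in> critical X h' \<and> paired X h p y"
      then show ?thesis using iff F(5) f_crit paired_cells[of p y] by simp
    qed
  qed
qed

lemma offdiag_BD': "offdiag_BD X h' = offdiag_BD X h - {(a, Some b)}"
proof -
  have *: "paired X h' x y \<longleftrightarrow> paired X h x y \<and> (x, y) \<noteq> (a, b)"
    if "x \<in> critical X h' \<or> y \<in> critical X h'" for x y
  proof -
    have "\<not> vec X h' x y" using that by (auto simp: critical_def tails_def heads_def)
    then have 1: "paired X h' x y \<longleftrightarrow> y \<in> critical X h' \<and> paired X h x y" using paired' by blast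
    show ?thesis
    proof (cases "paired X h x y")
      case True
      have "x \<in> critical X h \<longleftrightarrow> y \<in> critical X h"
        using paired_vec[OF True] by (auto simp: critical_def heads_def tails_def)
      moreover have "y \<noteq> a" using True pair paired_not_birth_death by blast
      moreover have "y = b \<longleftrightarrow> x = a"
        using True pair paired_unique_birth paired_unique_death by blast
      ultimately show ?thesis using 1 that critical' by auto
    qed (use 1 in blast)
  qed
  have pa: "paired X h a b" "a \<noteq> b" using pair a_neq_b by auto
  show ?thesis
  proof (intro set_eqI)
    fix \<beta>
    have some: "paired X h' x y \<and> y \<in> critical X h' \<longleftrightarrow>
        paired X h x y \<and> y \<in> critical X h \<and> (x, y) \<noteq> (a, b)" for x y
      using *[of x y] critical' pa paired_not_birth_death[of a b x] paired_unique_birth[of a b x] by auto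
    have none: "x \<in> critical X h' \<and> (\<nexists>y. paired X h' x y \<or> paired X h' y x) \<longleftrightarrow>
        x \<in> critical X h \<and> (\<nexists>y. paired X h x y \<or> paired X h y x)" for x
    proof (cases "x \<in> critical X h'")
      case True
      then have "x \<noteq> a" "x \<noteq> b" "x \<in> critical X h" using critical' by auto
      then show ?thesis using * True by auto
    next
      case False
      then show ?thesis using pa critical' by auto
    qed
    show "\<beta> \<in> offdiag_BD X h' \<longleftrightarrow> \<beta> \<in> offdiag_BD X h - {(a, Some b)}"
      unfolding Diff_iff m'.offdiag_BD_iff offdiag_BD_iff using some none by auto
  qed
qed

end


section \<open>Extending a strictly monotone function\<close>

lemma real_between_avoiding:
  fixes L H F :: "real set"
  assumes fin: "finite L" "finite H" "finite F" and less: "\<And>l u. l \<in> L \<Longrightarrow> u \<in> H \<Longrightarrow> l < u"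
  shows "\<exists>v. v \<notin> F \<and> (\<forall>l\<in>L. l < v) \<and> (\<forall>u\<in>H. v < u)"
proof -
  \<comment> \<open>Where a bound is missing, an interval of length 1 next to the other bound is
    used, and \<open>(0, 1)\<close> if both are missing.\<close>
  define lo where "lo = (if L = {} then if H = {} then 0 else Min H - 1 else Max L)"
  define hi where "hi = (if H = {} then lo + 1 else Min H)"
  have lo: "l \<le> lo" if "l \<in> L" for l using that fin by (auto simp: lo_def)
  have hi: "hi \<le> u" if "u \<in> H" for u using that fin by (auto simp: hi_def)
  have "lo < hi"
  proof (cases "L = {} \<or> H = {}")
    case False
    then have "Max L \<in> L" "Min H \<in> H" using fin by auto
    then show ?thesis using less False by (simp add: lo_def hi_def)
  qed (auto simp: lo_def hi_def)
  then have "infinite ({lo<..<hi} - F)" using fin infinite_Ioo[of lo hi] by simp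
  then obtain v where "v \<in> {lo<..<hi} - F" by (metis finite.emptyI ex_in_conv)
  then show ?thesis using lo hi by (intro exI[of _ v]) force
qed

text \<open>Values are chosen one element at a time. The condition on \<open>Q\<close> concerns the
  transitive closure because chains of \<open>r\<close> may pass through elements that have no value
  yet.\<close>

lemma extend_strict_mono:
  fixes g :: "'b \<Rightarrow> real"
  assumes fin: "finite P" and r: "r \<subseteq> P \<times> P" "acyclic r"
    and "Q \<subseteq> P" "inj_on g Q" "\<And>x y. x \<in> Q \<Longrightarrow> y \<in> Q \<Longrightarrow> (x, y) \<in> r\<^sup>+ \<Longrightarrow> g x < g y"
  shows "\<exists>f. inj_on f P \<and> (\<forall>x y. (x, y) \<in> r \<longrightarrow> f x < f y) \<and> (\<forall>x\<in>Q. f x = g x)"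
  using assms(4-6)
proof (induction "card (P - Q)" arbitrary: Q g)
  case 0
  then have "Q = P" using fin by auto
  then show ?case using 0 r by (intro exI[of _ g]) auto
next
  case (Suc n)
  then have "P - Q \<noteq> {}" by auto
  then obtain p where p: "p \<in> P" "p \<notin> Q" by blast
  let ?L = "g ` {q \<in> Q. (q, p) \<in> r\<^sup>+}" and ?H = "g ` {q \<in> Q. (p, q) \<in> r\<^sup>+}"
  have finQ: "finite Q" using Suc.prems(1) fin finite_subset by blast
  \<comment> \<open>Lower and upper bounds are separated by chains through \<open>p\<close>;
    avoiding the values in use preserves injectivity.\<close>
  have "\<exists>v. v \<notin> g ` Q \<and> (\<forall>l\<in>?L. l < v) \<and> (\<forall>u\<in>?H. v < u)"
  proof (rule real_between_avoiding)
    fix l u assume "l \<in> ?L" "u \<in> ?H"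
    then obtain x y where "x \<in> Q" "y \<in> Q" "l = g x" "u = g y" "(x, p) \<in> r\<^sup>+" "(p, y) \<in> r\<^sup>+" by blast
    then show "l < u" using Suc.prems(3) trancl_trans by metis
  qed (use finQ in auto)
  then obtain v where v_new: "v \<notin> g ` Q" and v_less: "\<forall>l\<in>?L. l < v" "\<forall>u\<in>?H. v < u" by (elim exE conjE)
  have v: "g q < v" if "q \<in> Q" "(q, p) \<in> r\<^sup>+" for q using v_less(1) that by simp
  have v': "v < g q" if "q \<in> Q" "(p, q) \<in> r\<^sup>+" for q using v_less(2) that by simp
  let ?g = "g(p := v)"
  have pp: "(p, p) \<notin> r\<^sup>+" using r(2) by (auto simp: acyclic_def)
  have "P - insert p Q = (P - Q) - {p}" by blast
  then have n: "n = card (P - insert p Q)" using Suc.hyps(2) p fin by simp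
  have "\<exists>f. inj_on f P \<and> (\<forall>x y. (x, y) \<in> r \<longrightarrow> f x < f y) \<and> (\<forall>x\<in>insert p Q. f x = ?g x)"
  proof (rule Suc.hyps(1)[OF n])
    show "insert p Q \<subseteq> P" using p Suc.prems(1) by blast
    show "inj_on ?g (insert p Q)"
      using Suc.prems(2) p v_new by (auto simp: inj_on_def)
    show "?g x < ?g y" if "x \<in> insert p Q" "y \<in> insert p Q" "(x, y) \<in> r\<^sup>+" for x y
      using that pp v v' Suc.prems(3) p(2) by (cases "x = p"; cases "y = p") auto
  qed
  then obtain f where f: "inj_on f P" "\<forall>x y. (x, y) \<in> r \<longrightarrow> f x < f y" "\<forall>x\<in>insert p Q. f x = ?g x"
    by blast
  have "f x = g x" if "x \<in> Q" for x using f(3) p(2) that by auto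
  then show ?case using f(1,2) by blast
qed


section \<open>The gradient graph\<close>

definition garcs :: "'a cell_data \<Rightarrow> ('a \<Rightarrow> real) \<Rightarrow> ('a \<times> 'a) set" where
  "garcs X h = {(x, y). vec X h x y \<or> (facet X y x \<and> \<not> vec X h y x)}"

context morse_complex
begin

abbreviation gpath :: "'a \<Rightarrow> 'a \<Rightarrow> bool" (infix "\<leadsto>" 50) where
  "x \<leadsto> y \<equiv> (x, y) \<in> (garcs X h)\<^sup>*"

lemma pair_in_morse_vf:
  assumes f: "facet X x y" shows "{x, y} \<in> morse_vf X h \<longleftrightarrow> vec X h x y"
proof
  assume "{x, y} \<in> morse_vf X h"
  then obtain v where "{x, y} = {z \<in> cells X. h z = v}" by (auto simp: morse_vf_def)
  then have "h x = v" "h y = v" by blast+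
  then show "vec X h x y" using f by (simp add: vec_def)
next
  assume v: "vec X h x y"
  then have "{x, y} = {z \<in> cells X. h z = h y}"
    using vec_same[OF v] vec_cells[OF v] by (auto simp: vec_def)
  then show "{x, y} \<in> morse_vf X h" by (auto simp: morse_vf_def)
qed

lemma arcs_vf_digraph: "arcs (vf_digraph X (morse_vf X h)) = garcs X h"
proof -
  have "{x, y} \<in> morse_vf X h \<longleftrightarrow> vec X h y x" if "facet X y x" for x y
    using pair_in_morse_vf[OF that] by (simp add: insert_commute)
  then show ?thesis
    using pair_in_morse_vf by (auto simp: vf_digraph_def garcs_def vec_def)
qed

lemma Crit_morse_vf: "Crit (morse_vf X h) = critical X h"
proof (intro set_eqI iffI)
  fix x assume "x \<in> Crit (morse_vf X h)"
  then obtain v where v: "{x} = {z \<in> cells X. h z = v}" by (auto simp: Crit_def morse_vf_def)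
  then have x: "x \<in> cells X" "h x = v" by blast+
  have eq: "z = x" if "z \<in> cells X" "h z = h x" for z using v x that by blast
  have "\<not> vec X h x s" for s
  proof
    assume "vec X h x s"
    then have "s \<in> cells X" "h s = h x" "facet X x s" by (simp_all add: vec_def facet_def)
    then show False using eq[of s] by simp
  qed
  moreover have "\<not> vec X h s x" for s
  proof
    assume "vec X h s x"
    then have "s \<in> cells X" "h s = h x" "facet X s x" by (simp_all add: vec_def facet_def)
    then show False using eq[of s] by simp
  qed
  ultimately show "x \<in> critical X h" using x by (auto simp: critical_def tails_def heads_def)
next
  fix x assume x: "x \<in> critical X h"
  then have "{x} = {z \<in> cells X. h z = h x}" using critical_neq[OF x] critical_cell[OF x] by auto
  then show "x \<in> Crit (morse_vf X h)" by (auto simp: Crit_def morse_vf_def)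
qed

lemma garcs_cells: "(x, y) \<in> garcs X h \<Longrightarrow> x \<in> cells X \<and> y \<in> cells X"
  by (auto simp: garcs_def vec_def facet_def)

lemma wf_digraph_vf: "wf_digraph (vf_digraph X (morse_vf X h))"
proof
  fix e assume "e \<in> arcs (vf_digraph X (morse_vf X h))"
  then have "e \<in> garcs X h" by (simp add: arcs_vf_digraph)
  then show "tail (vf_digraph X (morse_vf X h)) e \<in> verts (vf_digraph X (morse_vf X h))"
    "head (vf_digraph X (morse_vf X h)) e \<in> verts (vf_digraph X (morse_vf X h))"
    using garcs_cells[of "fst e" "snd e"] by (auto simp: vf_digraph_def)
qed

lemma reachable_vf_iff:
  assumes x: "x \<in> cells X"
  shows "reachable (vf_digraph X (morse_vf X h)) x y \<longleftrightarrow> x \<leadsto> y"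
proof -
  have "arcs_ends (vf_digraph X (morse_vf X h)) = garcs X h"
    unfolding arcs_ends_conv arcs_vf_digraph by (force simp: vf_digraph_def)
  then show ?thesis
    using wf_digraph.reachable_conv'[OF wf_digraph_vf, of x y] x by (simp add: vf_digraph_def)
qed

lemma garcs_cdim: "(x, y) \<in> garcs X h \<Longrightarrow> h y < h x \<or> (h y = h x \<and> cdim X x < cdim X y)"
  using facet_cdim[of x y] facet_not_vec[of y x] by (auto simp: garcs_def vec_def)

text \<open>Each arc lowers \<open>h\<close>, or keeps it and raises the dimension, so no vertex
  recurs. Uniqueness of paths thereby applies to concatenated walks.\<close>

lemma awalk_apath:
  assumes "pre_digraph.awalk (vf_digraph X (morse_vf X h)) x p y"
  shows "pre_digraph.apath (vf_digraph X (morse_vf X h)) x p y"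
proof -
  interpret G: wf_digraph "vf_digraph X (morse_vf X h)" by (rule wf_digraph_vf)
  have tail_head: "tail (vf_digraph X (morse_vf X h)) = fst" "head (vf_digraph X (morse_vf X h)) = snd"
    by (simp_all add: vf_digraph_def)
  have "distinct (G.awalk_verts x p) \<and> (\<forall>w\<in>set (G.awalk_verts x p).
      w = x \<or> h w < h x \<or> (h w = h x \<and> cdim X x < cdim X w))"
    using assms
  proof (induction p arbitrary: x)
    case (Cons e p)
    obtain v w where e: "e = (v, w)" by force
    have arc: "(x, w) \<in> garcs X h" and v: "v = x" and p: "G.awalk w p y"
      using Cons.prems arcs_vf_digraph unfolding e G.awalk_Cons_iff by (auto simp: vf_digraph_def)
    note IH = Cons.IH[OF p]
    have less: "h u < h x \<or> (h u = h x \<and> cdim X x < cdim X u)" if "u \<in> set (G.awalk_verts w p)" for u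
      using bspec[OF conjunct2[OF IH] that] garcs_cdim[OF arc] by auto
    have verts: "G.awalk_verts x (e # p) = x # G.awalk_verts w p" 
      by (simp add: e v tail_head)
    have "x \<notin> set (G.awalk_verts w p)" using less[of x] by auto
    then show ?case unfolding verts using IH less by simp
  qed simp
  then show ?thesis using assms by (simp add: G.apath_def)
qed

text \<open>Local form of uniqueness: two choices of an arc would extend to two different walks from
  \<open>b\<close> to \<open>a\<close>.\<close>

lemma unique_apath_arcs:
  assumes ex1: "\<exists>!p. pre_digraph.apath (vf_digraph X (morse_vf X h)) b p a" and b: "b \<in> cells X"
  shows "b \<leadsto> a"
    and "\<And>z w w'. b \<leadsto> z \<Longrightarrow> (z, w) \<in> garcs X h \<Longrightarrow> (z, w') \<in> garcs X h \<Longrightarrow> w \<leadsto> a \<Longrightarrow> w' \<leadsto> a \<Longrightarrow> w = w'"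
    and "\<And>z z' w. b \<leadsto> z \<Longrightarrow> b \<leadsto> z' \<Longrightarrow> (z, w) \<in> garcs X h \<Longrightarrow> (z', w) \<in> garcs X h \<Longrightarrow> w \<leadsto> a \<Longrightarrow> z = z'"
proof -
  interpret G: wf_digraph "vf_digraph X (morse_vf X h)" by (rule wf_digraph_vf)
  have walk: "\<exists>p. G.awalk x p y" if "x \<leadsto> y" "x \<in> cells X" for x y
    using that reachable_vf_iff G.reachable_awalk by blast
  obtain p where "G.apath b p a" using ex1 by blast
  then have "reachable (vf_digraph X (morse_vf X h)) b a"
    using G.awalkI_apath G.reachable_awalk by blast
  then show "b \<leadsto> a" using reachable_vf_iff b by blast
  have arc: "G.awalk x (p @ (z, w) # q) y" if "G.awalk x p z" "(z, w) \<in> garcs X h" "G.awalk w q y"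
    for x p z w q y
  proof (rule G.awalk_appendI[OF that(1)])
    show "G.awalk z ((z, w) # q) y"
      using that(2,3) arcs_vf_digraph unfolding G.awalk_Cons_iff by (simp add: vf_digraph_def)
  qed
  have unique: "p = q" if "G.awalk b p a" "G.awalk b q a" for p q
    using ex1 awalk_apath that by blast
  show "w = w'" if *: "b \<leadsto> z" "(z, w) \<in> garcs X h" "(z, w') \<in> garcs X h" "w \<leadsto> a" "w' \<leadsto> a" for z w w'
  proof -
    obtain p q q' where "G.awalk b p z" "G.awalk w q a" "G.awalk w' q' a"
      using * walk b garcs_cells by metis
    \<comment> \<open>The prefix is shared, so the arcs after it coincide.\<close>
    then have "p @ (z, w) # q = p @ (z, w') # q'" using arc * by (intro unique) blast+
    then show ?thesis by simp
  qed
  show "z = z'" if *: "b \<leadsto> z" "b \<leadsto> z'" "(z, w) \<in> garcs X h" "(z', w) \<in> garcs X h" "w \<leadsto> a" for z z' w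
  proof -
    obtain p p' q where "G.awalk b p z" "G.awalk b p' z'" "G.awalk w q a"
      using * walk b garcs_cells by metis
    \<comment> \<open>The suffix is shared, so the arcs before it coincide.\<close>
    then have "p @ (z, w) # q = p' @ (z', w) # q" using arc * by (intro unique) blast+
    then show ?thesis by simp
  qed
qed

text \<open>The gradient graph has no arc from a head to its tail, but a tail can be reached through
  another facet of the preceding cell, because \<open>D\<^sup>2 = 0\<close>.\<close>

lemma gpath_tail:
  assumes x: "x \<in> critical X h" and "x \<leadsto> z" "vec X h t z"
  shows "x \<leadsto> t"
  using assms(2,3)
proof (induction arbitrary: t rule: rtrancl_induct)
  case base
  then show ?case using x by (auto simp: critical_def heads_def)
next
  case (step y z)
  show ?case
  proof (cases "vec X h y z")
    case True
    then have "t = y" using step.prems vec_unique_tail by blast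
    then show ?thesis using step.hyps(1) by simp
  next
    case False
    then have zy: "facet X z y" using step.hyps(2) by (simp add: garcs_def)
    have tz: "facet X t z" using step.prems by (simp add: vec_def)
    \<comment> \<open>\<open>z\<close> contributes 1 to a vanishing sum, so another cell between
      \<open>t\<close> and \<open>y\<close> must contribute too.\<close>
    have "\<exists>s\<in>cells X. s \<noteq> z \<and> inc X t s * inc X s y = 1"
    proof (rule ccontr)
      assume "\<not> ?thesis"
      then have none: "inc X t s * inc X s y = 0" if "s \<in> cells X" "s \<noteq> z" for s using that by auto
      have "(\<Sum>s\<in>cells X. inc X t s * inc X s y) = (\<Sum>s\<in>{z}. inc X t s * inc X s y)"
        using none zy finite_cells by (intro sum.mono_neutral_right) (auto simp: facet_def)
      also have "\<dots> = 1" using zy tz by (simp add: facet_def)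
      finally show False using inc_inc[of t y] zy tz by (simp add: facet_def)
    qed
    then obtain s where s: "s \<in> cells X" "s \<noteq> z" "inc X t s * inc X s y = 1" by blast
    then have "inc X t s = 1" "inc X s y = 1" by (cases "inc X t s"; simp)+
    then have f: "facet X t s" "facet X s y" using zy tz s(1) by (auto simp: facet_def)
    have "\<not> vec X h t s" using step.prems s(2) vec_unique_head by blast
    then have "(s, t) \<in> garcs X h" using f by (simp add: garcs_def)
    moreover have "x \<leadsto> s"
    \<comment> \<open>If \<open>s\<close> is the tail of \<open>y\<close>, no arc leads from
      \<open>y\<close> to \<open>s\<close>, and the induction hypothesis supplies the path.\<close>
    proof (cases "vec X h s y")
      case True
      then show ?thesis using step.IH by blast
    next
      case False
      then have "(y, s) \<in> garcs X h" using f by (simp add: garcs_def)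
      then show ?thesis using step.hyps(1) by (rule rtrancl_into_rtrancl[rotated])
    qed
    ultimately show ?thesis by (rule rtrancl_into_rtrancl[rotated])
  qed
qed

lemma gpath_facet:
  assumes "x \<in> critical X h" "x \<leadsto> z" "facet X w z" shows "x \<leadsto> w"
proof (cases "vec X h w z")
  case True then show ?thesis using gpath_tail assms by blast
next
  case False
  then have "(z, w) \<in> garcs X h" using assms(3) by (simp add: garcs_def)
  then show ?thesis using assms(2) by (rule rtrancl_into_rtrancl[rotated])
qed

lemma gpath_head: "x \<leadsto> t \<Longrightarrow> vec X h t s \<Longrightarrow> x \<leadsto> s"
  by (rule rtrancl_into_rtrancl) (auto simp: garcs_def)

text \<open>Heads count with the dimension of their tail: this makes \<open>level\<close> constant
  along vectors and never increasing along arcs.\<close>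

definition level :: "'a \<Rightarrow> nat" where
  "level z = (if z \<in> heads X h then cdim X z - 1 else cdim X z)"

lemma level_garcs:
  assumes "(x, y) \<in> garcs X h" shows "level y \<le> level x"
proof (cases "vec X h x y")
  case True
  then have "x \<in> tails X h" "y \<in> heads X h" by (auto simp: tails_def heads_def)
  moreover have "cdim X y = cdim X x + 1" using True facet_cdim by (simp add: vec_def)
  ultimately show ?thesis using tails_heads_disjoint by (simp add: level_def)
next
  case False
  then have "cdim X x = cdim X y + 1" using assms facet_cdim by (simp add: garcs_def)
  then show ?thesis by (auto simp: level_def)
qed

lemma level_gpath: "x \<leadsto> y \<Longrightarrow> level y \<le> level x"
  by (induction rule: rtrancl_induct) (use level_garcs in fastforce)+

end


section \<open>Reversing the path\<close>

locale reversible_path = morse_complex X h for X :: "'a cell_data" and h :: "'a \<Rightarrow> real" +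
  fixes a b :: 'a
  assumes a_crit: "a \<in> critical X h" and b_crit: "b \<in> critical X h"
    and cdim_b: "cdim X b = cdim X a + 1" and b_to_a: "b \<leadsto> a"
    and succ_unique: "\<And>z w w'. b \<leadsto> z \<Longrightarrow> (z, w) \<in> garcs X h \<Longrightarrow> (z, w') \<in> garcs X h \<Longrightarrow>
      w \<leadsto> a \<Longrightarrow> w' \<leadsto> a \<Longrightarrow> w = w'"
    and pred_unique: "\<And>z z' w. b \<leadsto> z \<Longrightarrow> b \<leadsto> z' \<Longrightarrow> (z, w) \<in> garcs X h \<Longrightarrow> (z', w) \<in> garcs X h \<Longrightarrow>
      w \<leadsto> a \<Longrightarrow> z = z'"
    and values_disjoint: "\<And>x y. x \<in> critical X h \<Longrightarrow> y \<in> critical X h \<Longrightarrow> x \<noteq> b \<Longrightarrow> y \<noteq> a \<Longrightarrow>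
      b \<leadsto> x \<Longrightarrow> y \<leadsto> a \<Longrightarrow> h x < h y"
begin

text \<open>The vertex set of the unique path. Describing it by reachability avoids handling the
  list of arcs; \<open>succ_unique\<close> and \<open>pred_unique\<close> give its linear
  structure.\<close>

definition P :: "'a set" where
  "P = {z. b \<leadsto> z \<and> z \<leadsto> a}"

lemma a_in_P: "a \<in> P" and b_in_P: "b \<in> P"
  using b_to_a by (auto simp: P_def)

lemma a_not: "\<not> vec X h a s" "\<not> vec X h t a" and b_not: "\<not> vec X h b s" "\<not> vec X h t b"
  using a_crit b_crit by (auto simp: critical_def tails_def heads_def)

lemma P_arc:
  assumes "z \<in> P" "(z, w) \<in> garcs X h" "w \<leadsto> a" shows "w \<in> P"
proof -
  have "b \<leadsto> w" using assms by (auto simp: P_def intro: rtrancl_into_rtrancl)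
  then show ?thesis using assms(3) by (simp add: P_def)
qed

text \<open>The critical cell \<open>b\<close> is left through a facet, so the level is at most that
  of \<open>a\<close> from then on, and it cannot be smaller before \<open>a\<close>.\<close>

lemma P_cdim:
  assumes z: "z \<in> P" "z \<noteq> b"
  shows "(z \<in> heads X h \<and> cdim X z = cdim X a + 1) \<or> (z \<notin> heads X h \<and> cdim X z = cdim X a)"
proof -
  have bz: "b \<leadsto> z" and za: "z \<leadsto> a" using z by (auto simp: P_def)
  obtain w where w: "(b, w) \<in> garcs X h" "w \<leadsto> z"
    using bz z(2) by (metis converse_rtranclE)
  have "facet X w b" using w(1) b_not by (auto simp: garcs_def)
  then have "cdim X w = cdim X a" using facet_cdim cdim_b by simp
  then have "level w \<le> cdim X a" by (simp add: level_def)
  then have "level z \<le> cdim X a" using level_gpath[OF w(2)] by simp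
  moreover have "level a = cdim X a" using a_crit by (simp add: level_def critical_def)
  then have "cdim X a \<le> level z" using level_gpath[OF za] by simp
  ultimately have l: "level z = cdim X a" by simp
  show ?thesis
  proof (cases "z \<in> heads X h")
    case True
    then obtain t where "vec X h t z" by (auto simp: heads_def)
    then have "cdim X z = cdim X t + 1" using facet_cdim by (simp add: vec_def)
    then show ?thesis using True l by (simp add: level_def)
  qed (use l in \<open>simp add: level_def\<close>)
qed

lemma P_cdim_cases: "z \<in> P \<Longrightarrow> cdim X z = cdim X a \<or> cdim X z = cdim X a + 1"
  using P_cdim[of z] cdim_b by (cases "z = b") auto

lemma P_succ:
  assumes z: "z \<in> P" "z \<noteq> a" shows "\<exists>w\<in>P. (z, w) \<in> garcs X h"
proof -
  have "z \<leadsto> a" using z by (simp add: P_def)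
  then obtain w where "(z, w) \<in> garcs X h" "w \<leadsto> a" using z(2) by (metis converse_rtranclE)
  then show ?thesis using P_arc[OF z(1)] by blast
qed

lemma P_pred:
  assumes z: "z \<in> P" "z \<noteq> b" shows "\<exists>w\<in>P. (w, z) \<in> garcs X h"
proof -
  have bz: "b \<leadsto> z" and za: "z \<leadsto> a" using z by (auto simp: P_def)
  obtain w where w: "b \<leadsto> w" "(w, z) \<in> garcs X h" using bz z(2) by (metis rtranclE)
  then have "w \<leadsto> a" using za by (rule_tac converse_rtrancl_into_rtrancl)
  then show ?thesis using w by (auto simp: P_def)
qed

lemma P_lower_vec:
  assumes z: "z \<in> P" "cdim X z = cdim X a" "z \<noteq> a" shows "\<exists>s\<in>P. vec X h z s"
proof -
  obtain w where w: "w \<in> P" "(z, w) \<in> garcs X h" using P_succ z by blast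
  have "\<not> facet X w z" using facet_cdim[of w z] P_cdim_cases[OF w(1)] z(2) by auto
  then show ?thesis using w by (auto simp: garcs_def)
qed

lemma P_upper_vec:
  assumes z: "z \<in> P" "cdim X z = cdim X a + 1" "z \<noteq> b" shows "\<exists>t\<in>P. vec X h t z"
proof -
  obtain w where w: "w \<in> P" "(w, z) \<in> garcs X h" using P_pred z by blast
  have "\<not> facet X z w" using facet_cdim[of z w] P_cdim_cases[OF w(1)] z(2) by auto
  then show ?thesis using w by (auto simp: garcs_def)
qed

lemma P_upper_succ:
  assumes z: "z \<in> P" "cdim X z = cdim X a + 1"
  shows "\<exists>w\<in>P. facet X w z \<and> \<not> vec X h w z"
proof -
  have "z \<noteq> a" using z by auto
  then obtain w where w: "w \<in> P" "(z, w) \<in> garcs X h" using P_succ z by blast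
  have "\<not> vec X h z w" using facet_cdim[of z w] P_cdim_cases[OF w(1)] z(2) by (auto simp: vec_def)
  then show ?thesis using w by (auto simp: garcs_def)
qed

lemma P_lower_pred:
  assumes z: "z \<in> P" "cdim X z = cdim X a"
  shows "\<exists>w\<in>P. facet X z w \<and> \<not> vec X h z w"
proof -
  have "z \<noteq> b" using z cdim_b by auto
  then obtain w where w: "w \<in> P" "(w, z) \<in> garcs X h" using P_pred z by blast
  have "\<not> vec X h w z" using facet_cdim[of w z] P_cdim_cases[OF w(1)] z(2) by (auto simp: vec_def)
  then show ?thesis using w by (auto simp: garcs_def)
qed

text \<open>Apart from \<open>a\<close> and \<open>b\<close>, the path leaves its lower cells and
  enters its upper cells along vectors, so a vector lies on the path or misses it.\<close>

lemma P_vec: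
  assumes v: "vec X h t s" shows "t \<in> P \<longleftrightarrow> s \<in> P"
proof
  have d: "cdim X s = cdim X t + 1" using v facet_cdim by (simp add: vec_def)
  show "s \<in> P" if t: "t \<in> P"
  proof -
    have "t \<noteq> a" "t \<noteq> b" using v a_not b_not by auto
    moreover have "t \<notin> heads X h" using v tails_heads_disjoint by (auto simp: tails_def)
    ultimately obtain s' where "s' \<in> P" "vec X h t s'" using P_lower_vec P_cdim t by blast
    then show ?thesis using v vec_unique_head by blast
  qed
  show "t \<in> P" if s: "s \<in> P"
  proof -
    have "s \<noteq> b" using v b_not by auto
    moreover have "s \<in> heads X h" using v by (auto simp: heads_def)
    ultimately obtain t' where "t' \<in> P" "vec X h t' s" using P_upper_vec P_cdim s by blast
    then show ?thesis using v vec_unique_tail by blast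
  qed
qed

text \<open>On the path, the facet relations that were implicit arcs become the vectors; elsewhere
  the old vectors are kept.\<close>

definition vec' :: "'a \<Rightarrow> 'a \<Rightarrow> bool" where
  "vec' t s \<longleftrightarrow> facet X t s \<and> (if t \<in> P \<and> s \<in> P then \<not> vec X h t s else vec X h t s)"

lemma vec'_P: "vec' t s \<Longrightarrow> t \<in> P \<longleftrightarrow> s \<in> P"
  using P_vec by (auto simp: vec'_def split: if_splits)

lemma vec'_in_P:
  assumes v: "vec' t s" and t: "t \<in> P" shows "s \<in> P \<and> (s, t) \<in> garcs X h"
proof -
  have "s \<in> P" using vec'_P[OF v] t by simp
  then show ?thesis using v t by (simp add: vec'_def garcs_def)
qed

lemma vec'_not_P: "vec' t s \<Longrightarrow> t \<notin> P \<Longrightarrow> vec X h t s"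
  by (simp add: vec'_def)

lemma vec'_in_P_cdim:
  assumes v: "vec' t s" and t: "t \<in> P" shows "cdim X t = cdim X a \<and> cdim X s = cdim X a + 1"
proof -
  have "s \<in> P" using vec'_P[OF v] t by simp
  moreover have "cdim X s = cdim X t + 1" using v facet_cdim by (simp add: vec'_def)
  ultimately show ?thesis using P_cdim_cases[of t] P_cdim_cases[of s] t by linarith
qed

lemma vec'_unique_head:
  assumes "vec' t s" "vec' t s'" shows "s = s'"
proof (cases "t \<in> P")
  case True
  then show ?thesis
    using pred_unique[of s s' t] vec'_in_P[OF assms(1)] vec'_in_P[OF assms(2)] by (auto simp: P_def)
next
  case False
  then show ?thesis using vec_unique_head vec'_not_P assms by blast
qed

lemma vec'_unique_tail:
  assumes "vec' t s" "vec' t' s" shows "t = t'"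
proof (cases "s \<in> P")
  case True
  then have "t \<in> P" "t' \<in> P" using vec'_P assms by auto
  then show ?thesis
    using succ_unique[of s t t'] vec'_in_P[OF assms(1)] vec'_in_P[OF assms(2)] True by (auto simp: P_def)
next
  case False
  then have "t \<notin> P" "t' \<notin> P" using vec'_P assms by auto
  then show ?thesis using vec_unique_tail vec'_not_P assms by blast
qed

lemma vec'_disjoint: "vec' t s \<Longrightarrow> \<not> vec' s r"
proof
  assume v: "vec' t s" "vec' s r"
  show False
  proof (cases "s \<in> P")
    case True
    then have "t \<in> P" using vec'_P v(1) by blast
    then show False using vec'_in_P_cdim[OF v(1)] vec'_in_P_cdim[OF v(2) True] by simp
  next
    case False
    then have "vec X h t s" "vec X h s r" using vec'_not_P v vec'_P[OF v(1)] by auto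
    then show False using tails_heads_disjoint[of s] by (auto simp: tails_def heads_def)
  qed
qed

text \<open>On the path both sides describe the cells of the dimension of \<open>a\<close>: each has
  a predecessor on the path, which becomes its new head.\<close>

lemma tail'_iff: "(\<exists>s. vec' t s) \<longleftrightarrow> t \<in> insert a (tails X h)"
proof (cases "t \<in> P")
  case True
  have "(\<exists>s. vec' t s) \<longleftrightarrow> cdim X t = cdim X a"
  proof
    assume "\<exists>s. vec' t s"
    then show "cdim X t = cdim X a" using vec'_in_P_cdim True by blast
  next
    assume "cdim X t = cdim X a"
    then show "\<exists>s. vec' t s" using P_lower_pred[OF True] True by (auto simp: vec'_def)
  qed
  also have "\<dots> \<longleftrightarrow> t \<in> insert a (tails X h)"
  proof
    assume "cdim X t = cdim X a"
    then show "t \<in> insert a (tails X h)" using P_lower_vec[OF True] by (auto simp: tails_def)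
  next
    assume "t \<in> insert a (tails X h)"
    then show "cdim X t = cdim X a"
    proof
      assume t: "t \<in> tails X h"
      then have "t \<noteq> b" using b_not by (auto simp: tails_def)
      then show ?thesis using P_cdim[OF True] tails_heads_disjoint[OF t] by blast
    qed simp
  qed
  finally show ?thesis .
next
  case False
  then have "t \<noteq> a" using a_in_P by blast
  then show ?thesis using False by (auto simp: vec'_def tails_def vec_def)
qed

lemma head'_iff: "(\<exists>t. vec' t s) \<longleftrightarrow> s \<in> insert b (heads X h)"
proof (cases "s \<in> P")
  case True
  have "(\<exists>t. vec' t s) \<longleftrightarrow> cdim X s = cdim X a + 1"
  proof
    assume "\<exists>t. vec' t s"
    then obtain t where t: "vec' t s" by blast
    then show "cdim X s = cdim X a + 1" using vec'_in_P_cdim[OF t] vec'_P[OF t] True by blast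
  next
    assume "cdim X s = cdim X a + 1"
    then show "\<exists>t. vec' t s" using P_upper_succ[OF True] True by (auto simp: vec'_def)
  qed
  also have "\<dots> \<longleftrightarrow> s \<in> insert b (heads X h)"
    using P_cdim[OF True] cdim_b by (cases "s = b") auto
  finally show ?thesis .
next
  case False
  then have "s \<noteq> b" using b_in_P by blast
  then show ?thesis using False by (auto simp: vec'_def heads_def vec_def)
qed

text \<open>Contracts each new vector to its head, so that any function composed with
  \<open>rep\<close> is constant on vectors.\<close>

definition rep :: "'a \<Rightarrow> 'a" where
  "rep x = (if \<exists>s. vec' x s then THE s. vec' x s else x)"

lemma rep_tail: "vec' x s \<Longrightarrow> rep x = s"
  using vec'_unique_head by (auto simp: rep_def intro!: the_equality)

lemma rep_head: "vec' x s \<Longrightarrow> rep s = s"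
  using vec'_disjoint by (auto simp: rep_def)

lemma rep_other: "\<nexists>s. vec' x s \<Longrightarrow> rep x = x"
  by (simp add: rep_def)

lemma rep_cases: "rep x = x \<or> vec' x (rep x)"
  using rep_tail rep_other by metis

lemma rep_eqD: "rep x = rep y \<Longrightarrow> x = y \<or> vec' x y \<or> vec' y x"
  using rep_cases[of x] rep_cases[of y] vec'_unique_tail by metis

lemma rep_P: "rep x \<in> P \<longleftrightarrow> x \<in> P"
  using rep_cases[of x] vec'_P by metis

lemma rep_cells: "x \<in> cells X \<Longrightarrow> rep x \<in> cells X"
  using rep_cases[of x] by (auto simp: vec'_def facet_def)

lemma rep_not_P:
  assumes "x \<notin> P"
  shows "h (rep x) = h x" "y \<in> critical X h \<Longrightarrow> y \<leadsto> rep x \<longleftrightarrow> y \<leadsto> x"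
proof -
  consider "rep x = x" | "vec X h x (rep x)" using rep_cases vec'_not_P assms by blast
  then have "h (rep x) = h x \<and> (y \<in> critical X h \<longrightarrow> (y \<leadsto> rep x \<longleftrightarrow> y \<leadsto> x))"
  proof cases
    case 2
    then show ?thesis using gpath_head[OF _ 2] gpath_tail[OF _ _ 2] by (auto simp: vec_def)
  qed simp
  then show "h (rep x) = h x" "y \<in> critical X h \<Longrightarrow> y \<leadsto> rep x \<longleftrightarrow> y \<leadsto> x" by blast+
qed

lemma from_b_rep: "b \<leadsto> rep x \<longleftrightarrow> b \<leadsto> x"
proof (cases "x \<in> P")
  case True
  then show ?thesis using rep_P[of x] by (auto simp: P_def)
qed (use rep_not_P b_crit in blast)

text \<open>Lexicographic rank showing that the new vector field is acyclic: cells on the path lie between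
  the other cells below \<open>b\<close> and the rest, and on the path the order of \<open>h\<close> is reversed.\<close>

definition rank :: "'a \<Rightarrow> nat \<times> real" where
  "rank z = (if z \<in> P then 1 else if b \<leadsto> z then 0 else 2, if z \<in> P then - h z else h z)"

definition rank_less :: "nat \<times> real \<Rightarrow> nat \<times> real \<Rightarrow> bool" where
  "rank_less p q \<longleftrightarrow> fst p < fst q \<or> (fst p = fst q \<and> snd p < snd q)"

lemma facet_from_b_P:
  assumes "b \<leadsto> z" "facet X w z" "w \<in> P" shows "z \<in> P"
proof (cases "vec X h w z")
  case True
  then show ?thesis using P_vec assms(3) by blast
next
  case False
  then have "(z, w) \<in> garcs X h" using assms(2) by (simp add: garcs_def)
  then have "z \<leadsto> a" using assms(3) by (auto simp: P_def intro: converse_rtrancl_into_rtrancl)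
  then show ?thesis using assms(1) by (simp add: P_def)
qed

text \<open>Cells reachable from \<open>b\<close> are closed under facets, so the first component
  never grows from a cell to its facets. If both cells lie on the path, \<open>(w, z)\<close> is an
  old vector and \<open>w\<close> is represented by its predecessor on the path, whose value is
  larger; hence the reversed sign.\<close>

lemma rank_facet:
  assumes f: "facet X w z" and nv: "\<not> vec' w z"
  shows "rank_less (rank (rep w)) (rank (rep z))"
proof (cases "z \<in> P")
  case z: True
  then have bw: "b \<leadsto> w" using gpath_facet[OF b_crit _ f] by (simp add: P_def)
  show ?thesis
  proof (cases "w \<in> P")
    case w: True
    then have v: "vec X h w z" using z f nv by (simp add: vec'_def)
    have d: "cdim X w = cdim X a" "cdim X z = cdim X a + 1"
      using P_cdim_cases[OF z] P_cdim_cases[OF w] facet_cdim[OF f] by auto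
    obtain s where s: "s \<in> P" "facet X w s" "\<not> vec X h w s" using P_lower_pred[OF w d(1)] by blast
    then have "rep w = s" using w by (intro rep_tail) (simp add: vec'_def)
    moreover have "rep z = z"
      using vec'_in_P_cdim[OF _ z] d by (intro rep_other) auto
    moreover have "h z < h s" using facet_not_vec[OF s(2,3)] v by (simp add: vec_def)
    ultimately show ?thesis using s(1) z by (simp add: rank_def rank_less_def)
  next
    case w: False
    have "rep z \<in> P" "rep w \<notin> P" "b \<leadsto> rep w" using rep_P z w from_b_rep bw by auto
    then show ?thesis by (simp add: rank_def rank_less_def)
  qed
next
  case z: False
  then have "rep z \<notin> P" using rep_P by blast
  have hlt: "h w < h z" using facet_not_vec[OF f] nv f z by (auto simp: vec'_def)
  show ?thesis
  proof (cases "b \<leadsto> z")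
    case True
    then have bw: "b \<leadsto> w" using gpath_facet[OF b_crit _ f] by simp
    have w: "w \<notin> P" using facet_from_b_P[OF True f] z by blast
    then have "rep w \<notin> P" using rep_P by blast
    then show ?thesis
      using \<open>rep z \<notin> P\<close> from_b_rep bw True rep_not_P(1)[OF w] rep_not_P(1)[OF z] hlt
      by (simp add: rank_def rank_less_def)
  next
    case False
    then have "\<not> b \<leadsto> rep z" using from_b_rep by blast
    then show ?thesis
      using \<open>rep z \<notin> P\<close> rep_P[of w] rep_not_P(1)[of w] rep_not_P(1)[OF z] hlt
      by (auto simp: rank_def rank_less_def)
  qed
qed

text \<open>The strict inequalities required of a function on contracted cells.\<close>

definition rep_rel :: "('a \<times> 'a) set" where
  "rep_rel = {(rep w, rep z) | w z. facet X w z \<and> \<not> vec' w z}"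

lemma acyclic_rep_rel: "acyclic rep_rel"
proof -
  have "rank_less (rank x) (rank y)" if "(x, y) \<in> rep_rel\<^sup>+" for x y
    using that
  proof (induction rule: trancl_induct)
    case (base y) then show ?case using rank_facet by (auto simp: rep_rel_def)
  next
    case (step y z)
    then have "rank_less (rank y) (rank z)" using rank_facet by (auto simp: rep_rel_def)
    then show ?case using step.IH by (auto simp: rank_less_def)
  qed
  then have "\<not> (x, x) \<in> rep_rel\<^sup>+" for x by (fastforce simp: rank_less_def)
  then show ?thesis by (simp add: acyclic_def)
qed

lemma rep_rel_facet:
  assumes y: "y \<in> critical X h" and z: "y \<leadsto> z" and f: "facet X w z" and nv: "\<not> vec' w z"
  shows "(rep w \<notin> P \<and> y \<leadsto> rep w \<and> (z \<notin> P \<longrightarrow> h (rep w) < h (rep z))) \<or> (y \<leadsto> a \<and> b \<leadsto> rep w)"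
proof (cases "w \<in> P")
  case True
  have "y \<leadsto> w" using gpath_facet[OF y z f] .
  then have "y \<leadsto> a" using True by (auto simp: P_def)
  moreover have "b \<leadsto> rep w" using True from_b_rep by (simp add: P_def)
  ultimately show ?thesis by blast
next
  case False
  have "y \<leadsto> w" using gpath_facet[OF y z f] .
  then have "y \<leadsto> rep w" using rep_not_P(2)[OF False y] by simp
  moreover have "h (rep w) < h (rep z)" if "z \<notin> P"
    using facet_not_vec[OF f] nv f that rep_not_P(1)[OF that] rep_not_P(1)[OF False]
    by (auto simp: vec'_def)
  ultimately show ?thesis using False rep_P by blast
qed

text \<open>Followed downwards from \<open>y\<close>, a chain of relations stays reachable from
  \<open>y\<close> with values below \<open>h y\<close> until it touches the path. From then on
  \<open>y\<close> reaches \<open>a\<close> and all cells are reachable from \<open>b\<close>, so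
  \<open>values_disjoint\<close> compares the end points.\<close>

lemma rep_rel_critical:
  assumes xy: "(x, y) \<in> rep_rel\<^sup>+"
    and x: "x \<in> critical X h" "x \<noteq> b" and y: "y \<in> critical X h" "y \<noteq> a" "y \<noteq> b"
  shows "h x < h y"
proof -
  have y_not: "\<not> vec' z y" for z
    using head'_iff[of y] y by (auto simp: critical_def)
  have yP: "y \<notin> P"
  proof
    assume "y \<in> P"
    then have "y \<in> heads X h \<or> cdim X y = cdim X a" using P_cdim y(3) by blast
    then show False using P_lower_vec[OF \<open>y \<in> P\<close>] y by (auto simp: critical_def tails_def)
  qed
  have "(x \<notin> P \<and> y \<leadsto> x \<and> h x < h y) \<or> (y \<leadsto> a \<and> b \<leadsto> x)"
    using xy
  proof (induction rule: converse_trancl_induct)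
    case (base x)
    then obtain w z where wz: "x = rep w" "y = rep z" "facet X w z" "\<not> vec' w z"
      by (auto simp: rep_rel_def)
    then have "z = y" using rep_cases[of z] y_not by auto
    then show ?case using rep_rel_facet[OF y(1) _ wz(3,4)] wz yP by auto
  next
    case (step x v)
    then obtain w z where wz: "x = rep w" "v = rep z" "facet X w z" "\<not> vec' w z"
      by (auto simp: rep_rel_def)
    from step.IH show ?case
    proof
      assume v: "v \<notin> P \<and> y \<leadsto> v \<and> h v < h y"
      then have z: "z \<notin> P" using wz(2) rep_P by blast
      have "y \<leadsto> z" using v wz(2) rep_not_P(2)[OF z y(1)] by simp
      then show ?thesis using rep_rel_facet[OF y(1) _ wz(3,4)] z v wz(1,2) by auto
    next
      assume v: "y \<leadsto> a \<and> b \<leadsto> v"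
      then have "b \<leadsto> w" using wz(2) from_b_rep gpath_facet[OF b_crit _ wz(3)] by blast
      then show ?thesis using v wz(1) from_b_rep by blast
    qed
  qed
  then show ?thesis using values_disjoint x y by blast
qed

text \<open>An injective \<open>g\<close> extending \<open>h\<close> on the remaining critical cells
  is composed with \<open>rep\<close>; injectivity makes the fibres exactly the new vectors and the
  singletons.\<close>

lemma reversed_morse_function:
  "\<exists>h'. discrete_morse X h' \<and> tails X h' = insert a (tails X h) \<and> heads X h' = insert b (heads X h) \<and>
     (\<forall>x\<in>critical X h'. h' x = h x)"
proof -
  define C where "C = critical X h - {a, b}"
  have rep_C: "rep x = x" if "x \<in> C" for x
    using that tail'_iff[of x] by (intro rep_other) (auto simp: C_def critical_def)
  have "\<exists>g. inj_on g (cells X) \<and> (\<forall>x y. (x, y) \<in> rep_rel \<longrightarrow> g x < g y) \<and> (\<forall>x\<in>C. g x = h x)"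
  proof (rule extend_strict_mono[OF finite_cells _ acyclic_rep_rel])
    show "rep_rel \<subseteq> cells X \<times> cells X" using rep_cells by (auto simp: rep_rel_def facet_def)
    show "C \<subseteq> cells X" by (auto simp: C_def critical_cell)
    show "inj_on h C"
    proof (rule inj_onI)
      fix x y assume "x \<in> C" "y \<in> C" "h x = h y"
      then show "x = y" using critical_neq[of y x] critical_cell[of x X h] by (auto simp: C_def)
    qed
    show "h x < h y" if "x \<in> C" "y \<in> C" "(x, y) \<in> rep_rel\<^sup>+" for x y
      using rep_rel_critical[OF that(3)] that(1,2) by (auto simp: C_def)
  qed
  then obtain g where g: "inj_on g (cells X)" "\<And>x y. (x, y) \<in> rep_rel \<Longrightarrow> g x < g y"
      "\<And>x. x \<in> C \<Longrightarrow> g x = h x" by blast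
  define h' where "h' x = g (rep x)" for x
  have h'_eq: "h' x = h' y \<longleftrightarrow> rep x = rep y" if "x \<in> cells X" "y \<in> cells X" for x y
    using g(1) rep_cells that by (auto simp: h'_def inj_on_def)
  have h'_facet: "h' x < h' y" if "facet X x y" "\<not> vec' x y" for x y
    using that g(2) by (auto simp: h'_def rep_rel_def)
  have h'_vec: "h' x = h' y" if "vec' x y" for x y
    using that rep_tail rep_head by (simp add: h'_def)
  have vec_h': "vec X h' x y \<longleftrightarrow> vec' x y" for x y
  proof
    assume "vec X h' x y"
    then show "vec' x y" using h'_facet[of x y] by (auto simp: vec_def)
  next
    assume v: "vec' x y"
    then have "facet X x y" by (simp add: vec'_def)
    then show "vec X h' x y" using h'_vec[OF v] by (simp add: vec_def)
  qed
  have tails': "tails X h' = insert a (tails X h)"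
    using tail'_iff by (auto simp: tails_def vec_h')
  have heads': "heads X h' = insert b (heads X h)"
    using head'_iff by (auto simp: heads_def vec_h')
  have "discrete_morse X h'"
    unfolding discrete_morse_def
  proof (intro conjI ballI allI impI)
    fix x y assume xy: "x \<in> cells X" "y \<in> cells X"
    show "h' x \<le> h' y" if "inc X x y = 1"
    proof -
      have "facet X x y" using that xy by (simp add: facet_def)
      then show ?thesis using h'_facet[of x y] h'_vec[of x y] by force
    qed
    show "inc X x y = 1 \<or> inc X y x = 1" if "x \<noteq> y \<and> h' x = h' y"
      using rep_eqD[of x y] h'_eq[OF xy] that by (auto simp: vec'_def facet_def)
  next
    fix v
    show "card {x \<in> cells X. h' x = v} \<le> 2"
    proof (cases "{x \<in> cells X. h' x = v} = {}")
      case False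
      then obtain x where x: "x \<in> cells X" "h' x = v" by blast
      have "{y \<in> cells X. h' y = v} \<subseteq> insert (rep x) {t. vec' t (rep x)}"
      proof
        fix y assume "y \<in> {y \<in> cells X. h' y = v}"
        then have "rep y = rep x" using h'_eq[of y x] x by auto
        then show "y \<in> insert (rep x) {t. vec' t (rep x)}" using rep_cases[of y] by auto
      qed
      moreover have "\<exists>t. {t. vec' t (rep x)} \<subseteq> {t}" using vec'_unique_tail by blast
      ultimately obtain t where "{y \<in> cells X. h' y = v} \<subseteq> {rep x, t}" by blast
      then have "card {y \<in> cells X. h' y = v} \<le> card {rep x, t}" by (intro card_mono) auto
      then show ?thesis using card_insert_le_m1[of 2 "{t}" "rep x"] by simp
    next
      case True
      show ?thesis unfolding True by simp
    qed
  qed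
  moreover have "h' x = h x" if "x \<in> critical X h'" for x
  proof -
    have "x \<in> C" using that tails' heads' by (auto simp: C_def critical_def)
    then show ?thesis using g(3) rep_C by (simp add: h'_def)
  qed
  ultimately show ?thesis using tails' heads' by blast
qed

end

theorem theorem1:
  fixes X :: "'a cell_data" and h :: "'a \<Rightarrow> real" and birth death :: 'a
  assumes "lefschetz_complex X"
    and "discrete_morse X h"
    and "(birth, Some death) \<in> offdiag_BD X h"
    and "death_region X h (birth, Some death) \<inter> birth_region X h (birth, Some death) = {}"
    and "\<exists>!p. pre_digraph.apath (vf_digraph X (morse_vf X h)) death p birth"
  shows "\<exists>h'. discrete_morse X h' \<and>
           offdiag_BD X h' = offdiag_BD X h - {(birth, Some death)} \<and>
           (\<forall>x\<in>Crit (morse_vf X h'). h x = h' x)"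
proof -
  interpret morse_complex X h
    using assms(1,2) by (simp add: morse_complex_def morse_complex_axioms_def)
  have pair: "paired X h birth death" and death: "death \<in> critical X h"
    using assms(3) unfolding offdiag_BD_iff by auto
  have birth: "birth \<in> critical X h"
    using paired_vec[OF pair] death by (auto simp: critical_def heads_def)
  have cells: "birth \<in> cells X" "death \<in> cells X" using birth death by (auto simp: critical_cell)
  have dim: "cdim X death = cdim X birth + 1" using pair by (auto simp: paired_def n_cells_def)
  have disj: False
    if "p \<in> death_region X h (birth, Some death)" "p \<in> birth_region X h (birth, Some death)" for p
    using assms(4) that by blast
  have crit_values: "h x < h y"
    if x: "x \<in> critical X h" "x \<noteq> death" "death \<leadsto> x"
      and y: "y \<in> critical X h" "y \<noteq> birth" "y \<leadsto> birth" for x y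
  proof (rule ccontr)
    assume "\<not> h x < h y"
    \<comment> \<open>The corner of the square of \<open>x\<close> would also lie in the square of
      \<open>y\<close>.\<close>
    then have "(ereal (h x), ereal (h x)) \<in> birth_region X h (birth, Some death)"
      using y reachable_vf_iff critical_cell[OF y(1)] unfolding birth_region_def Crit_morse_vf by force
    moreover have "(ereal (h x), ereal (h x)) \<in> death_region X h (birth, Some death)"
      using x reachable_vf_iff cells(2) unfolding death_region_def Crit_morse_vf by force
    ultimately show False using disj by blast
  qed
  have pairs: "h x < h y"
    if x: "hom_rel X h x death" "x \<in> critical X h" "paired X h z x"
      and g: "cohom_rel X h g birth" "g \<in> critical X h" "paired X h g y" and le: "h g \<le> h z" for x z g y
  proof (rule ccontr)
    \<comment> \<open>The point \<open>(h z, h x)\<close>, the upper right corner of the rectangle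
      of \<open>(z, x)\<close>, would lie in both regions.\<close>
    assume nlt: "\<not> h x < h y"
    have dz: "cdim X z = cdim X birth" using x dim by (auto simp: hom_rel_def paired_def n_cells_def)
    have dg: "cdim X g = cdim X birth" using g by (simp add: cohom_rel_def)
    have "x \<noteq> death" "g \<noteq> birth" using x g by (auto simp: hom_rel_def cohom_rel_def)
    have "y \<in> critical X h"
      using paired_vec[OF g(3)] g(2) by (auto simp: critical_def tails_def)
    then have "(z, Some x) \<in> offdiag_BD_n X h (cdim X birth)" "(g, Some y) \<in> offdiag_BD_n X h (cdim X birth)"
      using x g dz dg by (auto simp: offdiag_BD_n_def offdiag_BD_iff)
    moreover have "pair_hom_rel X h (z, Some x) (birth, Some death)"
      using x(1) dz \<open>x \<noteq> death\<close> by (simp add: pair_hom_rel_def)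
    moreover have "pair_cohom_rel X h (g, Some y) (birth, Some death)"
      using g(1) dg \<open>g \<noteq> birth\<close> by (simp add: pair_cohom_rel_def)
    ultimately have "(ereal (h z), ereal (h x)) \<in> death_region X h (birth, Some death)"
        "(ereal (h z), ereal (h x)) \<in> birth_region X h (birth, Some death)"
      using le nlt \<open>x \<noteq> death\<close> \<open>g \<noteq> birth\<close> unfolding death_region_def birth_region_def
      by (force simp: death_value_def)+
    then show False by (rule disj)
  qed
  note path = unique_apath_arcs[OF assms(5) cells(2)]
  interpret reversible_path X h birth death
    by unfold_locales (use birth death dim path crit_values in blast)+
  obtain h' where h': "discrete_morse X h'" "tails X h' = insert birth (tails X h)"
      "heads X h' = insert death (heads X h)" "\<forall>x\<in>critical X h'. h' x = h x"
    using reversed_morse_function by blast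
  \<comment> \<open>Any bound on the dimensions will do; it serves to form the dual complex.\<close>
  have "finite (cdim X ` cells X)" using finite_cells by simp
  then obtain N where N: "\<forall>n\<in>cdim X ` cells X. n \<le> N" using finite_nat_set_iff_bounded_le by blast
  interpret cancellation X h h' N birth death
    by unfold_locales (use h' N pair death pairs in auto)
  interpret m': morse_complex X h'
    by unfold_locales (rule h'(1))
  show ?thesis using h' offdiag_BD' unfolding m'.Crit_morse_vf[symmetric] by metis
qed

end
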